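(* Let $u_j=u(x,t;\omega_j)$, $j=1,\dots,J$, be an ensemble of weak solutions of the ensemble eddy viscosity model with the shear boundary conditions, each satisfying the energy inequality (model, boundary conditions and energy inequality as specified in the context), with $\mu>0$ constant and $\nu_{turb}=\mu\tau|u'|_e^2$. Let $T^*=L/U$ denote the large scale turnover time. Then $$\limsup_{T\to\infty}\frac1T\int_0^T\varepsilon_{\text{model}}\,dt\le\left(\frac52+16\frac{\nu}{\nu_{eff}}\right)\frac{U^3}{L}+\left(\frac{\sqrt[3]{3}}{6}C_{26}^2\right)\mu\frac{\tau}{T^*}\limsup_{T\to\infty}\frac1T\int_0^T\left(\frac1{|\mathcal S_\beta|}\int_{\mathcal S_\beta}\nu_{eff}\left\langle\left|\frac{\partial u'}{\partial z}\right|^2\right\rangle_e dx\right)dt.$$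
   Context: Setting. $L,U,\nu,\tau>0$, $J\ge1$ an integer, $\Omega=(0,L)^3$, with points written $(x,y,z)$ (abbreviated $x$). The large scale turnover time is $T^*=L/U$; $\tau$ is a selected time scale with $\tau\le T^*$. $\nu$ is the kinematic viscosity. Model. For $j=1,\dots,J$, $u=u(x,t;\omega_j)\in\mathbb R^3$, $p=p(x,t;\omega_j)$ satisfy (weakly, in the standard sense) $$u_t+u\cdot\nabla u-\nu\Delta u-\nabla\cdot(\nu_{turb}\nabla u)+\nabla p=0,\quad \nabla\cdot u=0\ \text{ in }\Omega,\qquad u(x,0;\omega_j)=u^0_j(x),$$ with $u_j^0\in L^2(\Omega)$ divergence free. Shear boundary conditions: $u$ is $L$-periodic in $x$ and in $y$, $u=(0,0,0)$ at $z=0$, and $u=(U,0,0)$ at $z=L$. Ensemble quantities: $\langle\psi\rangle_e=\frac1J\sum_{j=1}^J\psi(\omega_j)$; $u'(x,t;\omega_j)=u(x,t;\omega_j)-\langle u\rangle_e(x,t)$; $|u'|_e^2(x,t)=\frac1J\sum_{j=1}^J|u'(x,t;\omega_j)|^2$. The eddy viscosity is $\nu_{turb}(x,t)=\mu\tau|u'(x,t)|_e^2$. Energy inequality: for each $j$ and every divergence free $\phi(x,y,z)$ with $\phi,\nabla\phi\in L^2(\Omega)$ satisfying the shear boundary conditions, $$\frac12\frac{d}{dt}\|u\|^2+\int_\Omega[\nu+\nu_{turb}]|\nabla u|^2dx\le(u_t,\phi)+\int_\Omega[\nu+\nu_{turb}]\nabla u:\nabla\phi\,dx+(u\cdot\nabla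 u,\phi),$$ understood in time-integrated form over $[0,T]$, where $\|\cdot\|$ and $(\cdot,\cdot)$ are the $L^2(\Omega)$ norm and inner product. Averages and dissipation: $\langle\psi\rangle_\infty=\limsup_{T\to\infty}\frac1T\int_0^T\psi(t)\,dt$, and $$\varepsilon_{\text{model}}(t)=\left\langle\frac1{|\Omega|}\int_\Omega\nu|\nabla u(x,t;\omega_j)|^2+\nu_{turb}|\nabla u(x,t;\omega_j)|^2dx\right\rangle_e.$$ Effective viscosity: $$\nu_{eff}=\frac{\big\langle\langle\frac1{|\Omega|}\int_\Omega[\nu+\nu_{turb}]|\nabla u|^2dx\rangle_e\big\rangle_\infty}{\big\langle\langle\frac1{|\Omega|}\int_\Omega|\nabla u|^2dx\rangle_e\big\rangle_\infty},$$ where the infinite time averages appearing here are finite. $\mathcal Re=UL/\nu$, $\mathcal Re_{eff}=UL/\nu_{eff}$, $\beta=\frac18\mathcal Re_{eff}^{-1}$. Near wall region: $\mathcal S_\beta=\{(x,y,z):0\le x\le L,\ 0\le y\le L,\ (1-\beta)L<z<L\}$. Constant: $C_{26}$ is the optimal constant in the $L^2$–$L^6$ Hardy inequality, i.e. the smallest $C$ such that for all nonnegative measurable $f$ on $(0,\infty)$, $$\left(\int_0^\infty x^{-4}\Big(\int_0^xf(t)\,dt\Big)^6dx\right)^{1/6}\le C\left(\int_0^\infty f(t)^2\,dt\right)^{1/2}.$$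
   Formalization: The formal theorem assumes β ≤ 1, so that the near wall region S_β lies in Ω; for β > 1, u' is undefined on part of S_β, and Couette flow with J = 1 and ν > 18.5 UL violates the bound. *)

theory Defs
  imports "HOL-Analysis.Analysis"
begin

text \<open>
  Vector fields are total functions on \<open>real^3\<close>, chosen Borel measurable; only their values on the
  domain matter. A gradient is a matrix \<open>G\<close> with \<open>G $ i $ k\<close> the derivative of component \<open>i\<close> in
  direction \<open>k\<close>, so that \<open>norm G\<close> and \<open>G \<bullet> H\<close> are the Frobenius norm and the contraction
  \<open>G : H\<close>, \<open>trace G\<close> is the divergence, and \<open>G *v v\<close> is \<open>v \<cdot> \<nabla>\<close> applied to the field with
  gradient \<open>G\<close>.
\<close>

definition cube :: "real \<Rightarrow> (real^3) set" where
  "cube L = {p. \<forall>i. 0 < p $ i \<and> p $ i < L}"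

definition L2_on_cube :: "real \<Rightarrow> (real^3 \<Rightarrow> 'b::euclidean_space) \<Rightarrow> bool" where
  "L2_on_cube L f \<longleftrightarrow>
     f \<in> borel_measurable borel \<and> set_integrable lborel (cube L) (\<lambda>p. (norm (f p))\<^sup>2)"

definition partial :: "3 \<Rightarrow> (real^3 \<Rightarrow> 'b::real_normed_vector) \<Rightarrow> real^3 \<Rightarrow> 'b" where
  "partial k f p = frechet_derivative f (at p) (axis k 1)"

primrec Ck :: "nat \<Rightarrow> (real^3 \<Rightarrow> 'b::real_normed_vector) \<Rightarrow> bool" where
  "Ck 0 f \<longleftrightarrow> continuous_on UNIV f"
| "Ck (Suc n) f \<longleftrightarrow> (\<forall>p. f differentiable (at p)) \<and> (\<forall>k. Ck n (partial k f))"

definition smooth :: "(real^3 \<Rightarrow> 'b::real_normed_vector) \<Rightarrow> bool" where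
  "smooth f \<longleftrightarrow> (\<forall>n. Ck n f)"

definition test_function :: "real \<Rightarrow> (real^3 \<Rightarrow> real) \<Rightarrow> bool" where
  "test_function L q \<longleftrightarrow>
     smooth q \<and> (\<exists>K. compact K \<and> K \<subseteq> cube L \<and> (\<forall>p. p \<notin> K \<longrightarrow> q p = 0))"

definition weak_gradient :: "real \<Rightarrow> (real^3 \<Rightarrow> real^3) \<Rightarrow> (real^3 \<Rightarrow> real^3^3) \<Rightarrow> bool" where
  "weak_gradient L v G \<longleftrightarrow>
     (\<forall>q i k. test_function L q \<longrightarrow>
        (LINT p:cube L|lborel. v p $ i * partial k q p) = - (LINT p:cube L|lborel. G p $ i $ k * q p))"

definition H1_with_gradient :: "real \<Rightarrow> (real^3 \<Rightarrow> real^3) \<Rightarrow> (real^3 \<Rightarrow> real^3^3) \<Rightarrow> bool" where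
  "H1_with_gradient L v G \<longleftrightarrow> L2_on_cube L v \<and> L2_on_cube L G \<and> weak_gradient L v G"

definition weakly_div_free :: "real \<Rightarrow> (real^3 \<Rightarrow> real^3) \<Rightarrow> bool" where
  "weakly_div_free L v \<longleftrightarrow>
     (\<forall>q. test_function L q \<longrightarrow> (LINT p:cube L|lborel. (\<Sum>k\<in>UNIV. v p $ k * partial k q p)) = 0)"

definition slice :: "3 \<Rightarrow> real \<Rightarrow> real^3 \<Rightarrow> real^3" where
  "slice i c p = (\<chi> k. if k = i then c else p $ k)"

text \<open>
  \<open>g\<close> is the boundary trace of the \<open>H1\<close> field \<open>v\<close> with gradient \<open>G\<close>: it is the limit in \<open>L2\<close> of the
  boundary of the restrictions of \<open>C1\<close> fields converging to \<open>v\<close> in \<open>H1\<close>. The face \<open>p $ i = c\<close> of the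
  cube is parametrized redundantly by \<open>slice i c\<close> on the whole cube, which multiplies the surface
  integral over that face by the constant \<open>L\<close>.
\<close>

definition has_trace ::
    "real \<Rightarrow> (real^3 \<Rightarrow> real^3) \<Rightarrow> (real^3 \<Rightarrow> real^3^3) \<Rightarrow> (real^3 \<Rightarrow> real^3) \<Rightarrow> bool" where
  "has_trace L v G g \<longleftrightarrow>
     (\<forall>i. \<forall>c\<in>{0, L}. L2_on_cube L (\<lambda>p. g (slice i c p))) \<and>
     (\<exists>V :: nat \<Rightarrow> real^3 \<Rightarrow> real^3.
        (\<forall>n. Ck 1 (V n)) \<and>
        (\<lambda>n. LINT p:cube L|lborel. (norm (V n p - v p))\<^sup>2) \<longlonglongrightarrow> 0 \<and>
        (\<lambda>n. LINT p:cube L|lborel. (norm (jacobian (V n) (at p) - G p))\<^sup>2) \<longlonglongrightarrow> 0 \<and>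
        (\<forall>i. \<forall>c\<in>{0, L}.
           (\<lambda>n. LINT p:cube L|lborel. (norm (V n (slice i c p) - g (slice i c p)))\<^sup>2) \<longlonglongrightarrow> 0))"

definition shear_bc ::
    "real \<Rightarrow> real \<Rightarrow> (real^3 \<Rightarrow> real^3) \<Rightarrow> (real^3 \<Rightarrow> real^3^3) \<Rightarrow> bool" where
  "shear_bc L U v G \<longleftrightarrow>
     (\<exists>g. has_trace L v G g \<and>
        (\<forall>p\<in>cube L.
           g (slice 1 L p) = g (slice 1 0 p) \<and>
           g (slice 2 L p) = g (slice 2 0 p) \<and>
           g (slice 3 0 p) = 0 \<and>
           g (slice 3 L p) = axis 1 U))"

definition shear_class ::
    "real \<Rightarrow> real \<Rightarrow> (real^3 \<Rightarrow> real^3) \<Rightarrow> (real^3 \<Rightarrow> real^3^3) \<Rightarrow> bool" where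
  "shear_class L U v G \<longleftrightarrow>
     H1_with_gradient L v G \<and> (AE p in lborel. p \<in> cube L \<longrightarrow> trace (G p) = 0) \<and> shear_bc L U v G"

text \<open>
  Test fields for the momentum equation. They are periodic in the first two directions and not
  compactly supported there, so that the equation holds across the periodic faces; being divergence
  free, they eliminate the pressure.
\<close>

definition momentum_test_field :: "real \<Rightarrow> (real^3 \<Rightarrow> real^3) \<Rightarrow> bool" where
  "momentum_test_field L w \<longleftrightarrow>
     smooth w \<and>
     (\<forall>p. w (p + axis 1 L) = w p \<and> w (p + axis 2 L) = w p) \<and>
     (\<exists>\<delta>>0. \<forall>p. p $ 3 < \<delta> \<or> p $ 3 > L - \<delta> \<longrightarrow> w p = 0) \<and>
     (\<forall>p. trace (jacobian w (at p)) = 0)"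

text \<open>
  Weak solution on all of \<open>[0, \<infinity>)\<close> with viscosity \<open>\<nu> + \<nu>T\<close> and initial datum \<open>v0\<close>;
  \<open>G t\<close> is the spatial gradient of \<open>v t\<close>. The equation is the weak form integrated from \<open>0\<close> to \<open>t\<close>,
  for the representative that is weakly continuous in time.
\<close>

definition weak_solution ::
    "real \<Rightarrow> (real \<Rightarrow> real^3 \<Rightarrow> real) \<Rightarrow> real \<Rightarrow> real \<Rightarrow> (real \<Rightarrow> real^3 \<Rightarrow> real^3) \<Rightarrow>
     (real \<Rightarrow> real^3 \<Rightarrow> real^3^3) \<Rightarrow> (real^3 \<Rightarrow> real^3) \<Rightarrow> bool" where
  "weak_solution \<nu> \<nu>T L U v G v0 \<longleftrightarrow>
     (\<lambda>(t, p). v t p) \<in> borel_measurable borel \<and>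
     (\<lambda>(t, p). G t p) \<in> borel_measurable borel \<and>
     (\<forall>t\<ge>0. L2_on_cube L (v t)) \<and>
     (\<forall>T>0. \<exists>C. \<forall>t\<in>{0..T}. (LINT p:cube L|lborel. (norm (v t p))\<^sup>2) \<le> C) \<and>
     (\<forall>T>0. set_integrable lborel ({0..T} \<times> cube L) (\<lambda>(t, p). (norm (G t p))\<^sup>2)) \<and>
     (\<forall>T>0. set_integrable lborel ({0..T} \<times> cube L) (\<lambda>(t, p). \<nu>T t p * (norm (G t p))\<^sup>2)) \<and>
     (AE t in lborel. 0 < t \<longrightarrow> shear_class L U (v t) (G t)) \<and>
     (AE p in lborel. p \<in> cube L \<longrightarrow> v 0 p = v0 p) \<and>
     (\<forall>w. momentum_test_field L w \<longrightarrow>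
        (\<forall>t\<ge>0.
           (LINT p:cube L|lborel. v t p \<bullet> w p)
           + (LINT s:{0..t}|lborel. LINT p:cube L|lborel.
                (G s p *v v s p) \<bullet> w p + (\<nu> + \<nu>T s p) * (G s p \<bullet> jacobian w (at p)))
           = (LINT p:cube L|lborel. v0 p \<bullet> w p)))"

text \<open>
  The integrated energy inequality, for every comparison field \<open>\<phi>\<close> for which the integrals on the
  right are defined: \<open>\<nu>T\<close> need not be bounded, so square integrability of the gradient of \<open>\<phi>\<close> alone
  does not make the eddy viscosity term integrable.
\<close>

definition energy_inequality ::
    "real \<Rightarrow> (real \<Rightarrow> real^3 \<Rightarrow> real) \<Rightarrow> real \<Rightarrow> real \<Rightarrow> (real \<Rightarrow> real^3 \<Rightarrow> real^3) \<Rightarrow>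
     (real \<Rightarrow> real^3 \<Rightarrow> real^3^3) \<Rightarrow> (real^3 \<Rightarrow> real^3) \<Rightarrow> bool" where
  "energy_inequality \<nu> \<nu>T L U v G v0 \<longleftrightarrow>
     (\<forall>\<phi> D T.
        shear_class L U \<phi> D \<and> 0 < T \<and>
        set_integrable lborel ({0..T} \<times> cube L) (\<lambda>(t, p). (\<nu> + \<nu>T t p) * (G t p \<bullet> D p)) \<and>
        set_integrable lborel ({0..T} \<times> cube L) (\<lambda>(t, p). (G t p *v v t p) \<bullet> \<phi> p) \<longrightarrow>
        1/2 * (LINT p:cube L|lborel. (norm (v T p))\<^sup>2)
        - 1/2 * (LINT p:cube L|lborel. (norm (v0 p))\<^sup>2)
        + (LINT t:{0..T}|lborel. LINT p:cube L|lborel. (\<nu> + \<nu>T t p) * (norm (G t p))\<^sup>2)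
        \<le> (LINT p:cube L|lborel. v T p \<bullet> \<phi> p) - (LINT p:cube L|lborel. v0 p \<bullet> \<phi> p)
          + (LINT t:{0..T}|lborel. LINT p:cube L|lborel. (\<nu> + \<nu>T t p) * (G t p \<bullet> D p))
          + (LINT t:{0..T}|lborel. LINT p:cube L|lborel. (G t p *v v t p) \<bullet> \<phi> p))"

definition ens_mean :: "nat \<Rightarrow> (nat \<Rightarrow> 'b::real_vector) \<Rightarrow> 'b" where
  "ens_mean J \<psi> = (1 / real J) *\<^sub>R (\<Sum>j=1..J. \<psi> j)"

definition fluct ::
    "nat \<Rightarrow> (nat \<Rightarrow> real \<Rightarrow> real^3 \<Rightarrow> 'b::real_vector) \<Rightarrow> nat \<Rightarrow> real \<Rightarrow> real^3 \<Rightarrow> 'b" where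
  "fluct J f j t p = f j t p - ens_mean J (\<lambda>i. f i t p)"

definition eddy_viscosity ::
    "real \<Rightarrow> real \<Rightarrow> nat \<Rightarrow> (nat \<Rightarrow> real \<Rightarrow> real^3 \<Rightarrow> real^3) \<Rightarrow> real \<Rightarrow> real^3 \<Rightarrow> real" where
  "eddy_viscosity \<mu> \<tau> J u t p = \<mu> * \<tau> * ens_mean J (\<lambda>j. (norm (fluct J u j t p))\<^sup>2)"

definition infinite_time_average :: "(real \<Rightarrow> real) \<Rightarrow> ereal" where
  "infinite_time_average \<psi> = Limsup at_top (\<lambda>T. ereal (1 / T * (LINT t:{0..T}|lborel. \<psi> t)))"

definition model_dissipation ::
    "real \<Rightarrow> (real \<Rightarrow> real^3 \<Rightarrow> real) \<Rightarrow> real \<Rightarrow> nat \<Rightarrow> (nat \<Rightarrow> real \<Rightarrow> real^3 \<Rightarrow> real^3^3) \<Rightarrow> real \<Rightarrow> real" where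
  "model_dissipation \<nu> \<nu>T L J Du t =
     ens_mean J (\<lambda>j. 1 / measure lborel (cube L) *
       (LINT p:cube L|lborel. \<nu> * (norm (Du j t p))\<^sup>2 + \<nu>T t p * (norm (Du j t p))\<^sup>2))"

definition mean_gradient_energy ::
    "real \<Rightarrow> nat \<Rightarrow> (nat \<Rightarrow> real \<Rightarrow> real^3 \<Rightarrow> real^3^3) \<Rightarrow> real \<Rightarrow> real" where
  "mean_gradient_energy L J Du t =
     ens_mean J (\<lambda>j. 1 / measure lborel (cube L) * (LINT p:cube L|lborel. (norm (Du j t p))\<^sup>2))"

text \<open>Meaningful when both time averages are finite.\<close>

definition effective_viscosity ::
    "real \<Rightarrow> (real \<Rightarrow> real^3 \<Rightarrow> real) \<Rightarrow> real \<Rightarrow> nat \<Rightarrow> (nat \<Rightarrow> real \<Rightarrow> real^3 \<Rightarrow> real^3^3) \<Rightarrow> real" where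
  "effective_viscosity \<nu> \<nu>T L J Du =
     real_of_ereal (infinite_time_average (model_dissipation \<nu> \<nu>T L J Du)) /
     real_of_ereal (infinite_time_average (mean_gradient_energy L J Du))"

definition near_wall :: "real \<Rightarrow> real \<Rightarrow> (real^3) set" where
  "near_wall L \<beta> =
     {p. 0 \<le> p $ 1 \<and> p $ 1 \<le> L \<and> 0 \<le> p $ 2 \<and> p $ 2 \<le> L \<and> (1 - \<beta>) * L < p $ 3 \<and> p $ 3 < L}"

text \<open>
  Hardy's inequality needs checking only for square integrable \<open>f\<close>: for all other \<open>f\<close> the right-hand
  side is infinite. For square integrable \<open>f\<close> the inner integral is finite.
\<close>

definition hardy_2_6 :: "real \<Rightarrow> bool" where
  "hardy_2_6 C \<longleftrightarrow>
     (\<forall>f :: real \<Rightarrow> real.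
        f \<in> borel_measurable borel \<and> (\<forall>t>0. 0 \<le> f t) \<and>
        set_integrable lborel {0<..} (\<lambda>t. (f t)\<^sup>2) \<longrightarrow>
        set_integrable lborel {0<..} (\<lambda>x. (LINT t:{0<..<x}|lborel. f t) ^ 6 / x ^ 4) \<and>
        root 6 (LINT x:{0<..}|lborel. (LINT t:{0<..<x}|lborel. f t) ^ 6 / x ^ 4)
          \<le> C * sqrt (LINT t:{0<..}|lborel. (f t)\<^sup>2))"

definition C26 :: real where
  "C26 = (LEAST C. hardy_2_6 C)"

end

theory Submission
  imports Defs
begin

text \<open>
  The energy inequality is tested with a background flow \<open>\<phi> = (U s\<^sup>2, 0, 0)\<close>, where \<open>s\<close> rises
  linearly from \<open>0\<close> to \<open>1\<close> across the layer of width \<open>b = \<beta> L\<close> at the upper wall. The quadratic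
  profile is continuously differentiable, so \<open>\<phi>\<close> is its own approximating sequence in the trace
  condition.

  By periodicity the convection term only sees \<open>w = u - (U, 0, 0)\<close>, which vanishes at the upper wall;
  a Poincare inequality across the layer bounds it by \<open>U b\<close> times the squared norm of the gradient,
  which on average is one eighth of the dissipation by the choice of \<open>\<beta>\<close>. Young's inequality moves one
  half of the dissipation to the left and leaves the viscous and eddy viscous energy of \<open>\<phi>\<close>; the
  latter is controlled by the same Poincare inequality, since the fluctuations vanish at the wall. After
  absorption the near wall term carries the factor \<open>1/6\<close>, and \<open>1 \<le> root 3 3 * C26\<^sup>2\<close> because testing
  Hardy's inequality with the indicator of \<open>(0, 1)\<close> gives \<open>1/3 \<le> C26 ^ 6\<close>.
\<close>

section \<open>Square integrable functions\<close>

text \<open>The layer width is fixed by the solutions themselves: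
  \<open>b = \<nu>eff / (8 * U)\<close>, where \<open>\<nu>eff\<close> is a quotient of two limits
  superior. It must be a positive real before any background flow exists. This is why the gradient
  is bounded from below: the velocity difference \<open>U\<close> between the walls forces a mean
  squared gradient of at least \<open>U\<^sup>2 / L\<^sup>2\<close>. Since \<open>\<nu>eff\<close>
  is defined by averages, the convection bound becomes a multiple of the dissipation only after the
  time average is taken.

  The eddy viscosity may be unbounded; a background flow with bounded gradient still meets the
  integrability premises of the energy inequality. Its squared slope times the distance to the wall
  stays below \<open>U\<^sup>2 / b\<close>, so the eddy term gets the constant
  \<open>U\<^sup>2\<close> for every \<open>b\<close>. Dividing by the volume
  \<open>b * L\<^sup>2\<close> of the near wall region then leaves 1/8, and absorbing one quarter of
  the dissipation multiplies this by 4/3, whence 1/6.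

  Boundary values exist only as L2 limits, so all facts about the walls and the periodic faces are
  shown for C1 fields and passed to the limit.\<close>

text \<open>Kept generic in the measure: it is used on the cube, on the real line and on
  space-time.\<close>

definition sq_int :: "'a measure \<Rightarrow> ('a \<Rightarrow> 'b::euclidean_space) \<Rightarrow> bool" where
  "sq_int M f \<longleftrightarrow> f \<in> borel_measurable M \<and> integrable M (\<lambda>x. (norm (f x))\<^sup>2)"

lemma sq_int_measurable [measurable_dest]: "sq_int M f \<Longrightarrow> f \<in> borel_measurable M"
  and sq_int_integrable: "sq_int M f \<Longrightarrow> integrable M (\<lambda>x. (norm (f x))\<^sup>2)"
  by (auto simp: sq_int_def)

lemma sq_int_bound:
  assumes "sq_int M f" and [measurable]: "g \<in> borel_measurable M"
    and "\<And>x. x \<in> space M \<Longrightarrow> norm (g x) \<le> K * norm (f x)"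
  shows "sq_int M g"
proof -
  have "norm ((norm (g x))\<^sup>2) \<le> norm (K\<^sup>2 * (norm (f x))\<^sup>2)" if "x \<in> space M" for x
    using power_mono[OF assms(3)[OF that], of 2] by (simp add: power_mult_distrib)
  then have "integrable M (\<lambda>x. (norm (g x))\<^sup>2)"
    by (intro Bochner_Integration.integrable_bound[OF integrable_mult_right[OF sq_int_integrable[OF assms(1)], of "K\<^sup>2"]])
      (auto intro!: AE_I2)
  then show ?thesis by (simp add: sq_int_def)
qed

lemma sq_int_const: "finite_measure M \<Longrightarrow> sq_int M (\<lambda>_. c)"
  by (simp add: sq_int_def finite_measure.integrable_const)

lemma sq_int_zero: "sq_int M (\<lambda>_. 0)"
  by (simp add: sq_int_def)

lemma norm_add_sq_le: "(norm (a + b))\<^sup>2 \<le> 2 * (norm a)\<^sup>2 + 2 * (norm (b::'b::real_normed_vector))\<^sup>2"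
proof -
  have "(norm (a + b))\<^sup>2 \<le> (norm a + norm b)\<^sup>2"
    by (intro power_mono norm_triangle_ineq) auto
  moreover have "(norm a + norm b)\<^sup>2 + (norm a - norm b)\<^sup>2 = 2 * (norm a)\<^sup>2 + 2 * (norm b)\<^sup>2"
    by (simp add: power2_eq_square algebra_simps)
  ultimately show ?thesis using zero_le_power2[of "norm a - norm b"] by linarith
qed

lemma sq_int_add:
  assumes "sq_int M f" "sq_int M g"
  shows "sq_int M (\<lambda>x. f x + g x)"
proof -
  note [measurable] = assms[THEN sq_int_measurable]
  have "integrable M (\<lambda>x. 2 * (norm (f x))\<^sup>2 + 2 * (norm (g x))\<^sup>2)"
    using assms[THEN sq_int_integrable] by auto
  then have "integrable M (\<lambda>x. (norm (f x + g x))\<^sup>2)"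
    by (rule Bochner_Integration.integrable_bound) (auto simp: norm_add_sq_le)
  then show ?thesis by (simp add: sq_int_def)
qed

lemma sq_int_scaleR: "sq_int M f \<Longrightarrow> sq_int M (\<lambda>x. c *\<^sub>R f x)"
  by (auto simp: sq_int_def power_mult_distrib)

lemma sq_int_diff: "sq_int M f \<Longrightarrow> sq_int M g \<Longrightarrow> sq_int M (\<lambda>x. f x - g x)"
  using sq_int_add[of M f "\<lambda>x. (-1) *\<^sub>R g x"] sq_int_scaleR[of M g "-1"] by simp

lemma sq_int_sum: "(\<And>i. i \<in> I \<Longrightarrow> sq_int M (f i)) \<Longrightarrow> sq_int M (\<lambda>x. \<Sum>i\<in>I. f i x)"
  by (induction I rule: infinite_finite_induct) (auto intro!: sq_int_add sq_int_zero)

lemma young_norm: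
  assumes "c > 0"
  shows "norm (a::'a::real_normed_vector) * norm (b::'b::real_normed_vector) \<le> c / 2 * (norm a)\<^sup>2 + 1 / (2 * c) * (norm b)\<^sup>2"
proof -
  have "0 \<le> (c * norm a - norm b)\<^sup>2 / (2 * c)" using assms by simp
  also have "\<dots> = c / 2 * (norm a)\<^sup>2 + 1 / (2 * c) * (norm b)\<^sup>2 - norm a * norm b"
    using assms by (simp add: field_simps power2_eq_square)
  finally show ?thesis by simp
qed

lemma sq_int_norm_mult:
  assumes "sq_int M f" "sq_int M g"
  shows "integrable M (\<lambda>x. norm (f x) * norm (g x))"
proof -
  note [measurable] = assms[THEN sq_int_measurable]
  have "norm (norm (f x) * norm (g x)) \<le> norm ((norm (f x))\<^sup>2 + (norm (g x))\<^sup>2)" for x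
  proof -
    have "norm (f x) * norm (g x) \<le> 1 / 2 * (norm (f x))\<^sup>2 + 1 / 2 * (norm (g x))\<^sup>2"
      using young_norm[of 1 "f x" "g x"] by simp
    moreover have "\<dots> \<le> (norm (f x))\<^sup>2 + (norm (g x))\<^sup>2"
      by (intro add_mono) auto
    ultimately show ?thesis by (simp add: abs_mult)
  qed
  then have "AE x in M. norm (norm (f x) * norm (g x)) \<le> norm ((norm (f x))\<^sup>2 + (norm (g x))\<^sup>2)"
    by simp
  moreover have "integrable M (\<lambda>x. (norm (f x))\<^sup>2 + (norm (g x))\<^sup>2)"
    using assms[THEN sq_int_integrable] by auto
  ultimately show ?thesis
    by (rule_tac Bochner_Integration.integrable_bound) auto
qed

lemma sq_int_inner:
  assumes "sq_int M f" "sq_int M g"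
  shows "integrable M (\<lambda>x. f x \<bullet> g x)"
proof -
  note [measurable] = assms[THEN sq_int_measurable]
  show ?thesis
    by (rule Bochner_Integration.integrable_bound[OF sq_int_norm_mult[OF assms]])
      (auto simp: Cauchy_Schwarz_ineq2)
qed

lemma integral_norm_mult_young:
  assumes "sq_int M f" "sq_int M g" "c > 0"
  shows "(\<integral>x. norm (f x) * norm (g x) \<partial>M) \<le> c / 2 * (\<integral>x. (norm (f x))\<^sup>2 \<partial>M) + 1 / (2 * c) * (\<integral>x. (norm (g x))\<^sup>2 \<partial>M)"
proof -
  note i = assms(1,2)[THEN sq_int_integrable]
  have "(\<integral>x. norm (f x) * norm (g x) \<partial>M) \<le> (\<integral>x. c / 2 * (norm (f x))\<^sup>2 + 1 / (2 * c) * (norm (g x))\<^sup>2 \<partial>M)"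
    using i by (intro integral_mono sq_int_norm_mult assms Bochner_Integration.integrable_add integrable_mult_right young_norm)
  also have "\<dots> = c / 2 * (\<integral>x. (norm (f x))\<^sup>2 \<partial>M) + 1 / (2 * c) * (\<integral>x. (norm (g x))\<^sup>2 \<partial>M)"
    using i by simp
  finally show ?thesis .
qed

text \<open>Young's inequality optimized over its weight. The choice \<open>c = I / A\<close> avoids
  square roots and gives \<open>I \<le> I / 2 + A * B / (2 * I)\<close>.\<close>

lemma integral_norm_mult_cauchy_schwarz:
  assumes "sq_int M f" "sq_int M g"
  shows "(\<integral>x. norm (f x) * norm (g x) \<partial>M)\<^sup>2 \<le> (\<integral>x. (norm (f x))\<^sup>2 \<partial>M) * (\<integral>x. (norm (g x))\<^sup>2 \<partial>M)"
proof -
  define I A B where "I = (\<integral>x. norm (f x) * norm (g x) \<partial>M)"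
    and "A = (\<integral>x. (norm (f x))\<^sup>2 \<partial>M)" and "B = (\<integral>x. (norm (g x))\<^sup>2 \<partial>M)"
  have nn: "I \<ge> 0" "A \<ge> 0" "B \<ge> 0" by (auto simp: I_def A_def B_def)
  have y: "I \<le> c / 2 * A + 1 / (2 * c) * B" if "c > 0" for c
    unfolding I_def A_def B_def by (rule integral_norm_mult_young[OF assms that])
  have "I\<^sup>2 \<le> A * B"
  proof (cases "I = 0")
    case False
    then have I: "I > 0" using nn by simp
    have A: "A > 0"
    proof (rule ccontr)
      assume "\<not> A > 0"
      then have "A = 0" using nn by simp
      \<comment> \<open>If \<open>A = 0\<close>, the first weight gives \<open>B > 0\<close>; the
        weight \<open>B / I\<close> then yields \<open>I \<le> I / 2\<close>, a
        contradiction.\<close>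
      have "B \<ge> I" using y[of "1/2"] \<open>A = 0\<close> by simp
      then have "B > 0" using I by simp
      then show False using y[of "B / I"] \<open>A = 0\<close> I by simp
    qed
    have "I \<le> (I / A) / 2 * A + 1 / (2 * (I / A)) * B" by (rule y) (use I A in simp)
    also have "\<dots> = I / 2 + A * B / (2 * I)" using I A by simp
    finally have "I / 2 \<le> A * B / (2 * I)" by linarith
    then show ?thesis using I by (simp add: field_simps power2_eq_square)
  qed (use nn in simp)
  then show ?thesis by (simp add: I_def A_def B_def)
qed

section \<open>Convergence in L2\<close>

text \<open>Square integrability of the members and of the limit is part of the notion: a
  nonintegrable squared difference has integral \<open>0\<close> by default and would otherwise
  count as convergent.\<close>

definition L2_lim :: "'a measure \<Rightarrow> (nat \<Rightarrow> 'a \<Rightarrow> 'b::euclidean_space) \<Rightarrow> ('a \<Rightarrow> 'b) \<Rightarrow> bool" where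
  "L2_lim M F f \<longleftrightarrow> (\<forall>n. sq_int M (F n)) \<and> sq_int M f \<and>
     (\<lambda>n. \<integral>x. (norm (F n x - f x))\<^sup>2 \<partial>M) \<longlonglongrightarrow> 0"

lemma L2_limD:
  assumes "L2_lim M F f"
  shows "sq_int M (F n)" "sq_int M f" "sq_int M (\<lambda>x. F n x - f x)"
    "(\<lambda>n. \<integral>x. (norm (F n x - f x))\<^sup>2 \<partial>M) \<longlonglongrightarrow> 0"
  using assms by (auto simp: L2_lim_def intro: sq_int_diff)

lemma L2_lim_const: "sq_int M f \<Longrightarrow> L2_lim M (\<lambda>_. f) f"
  by (simp add: L2_lim_def)

lemma L2_lim_add:
  assumes F: "L2_lim M F f" and G: "L2_lim M G g"
  shows "L2_lim M (\<lambda>n x. F n x + G n x) (\<lambda>x. f x + g x)"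
  unfolding L2_lim_def
proof (intro conjI allI)
  show "(\<lambda>n. \<integral>x. (norm (F n x + G n x - (f x + g x)))\<^sup>2 \<partial>M) \<longlonglongrightarrow> 0"
  proof (rule tendsto_sandwich[OF _ _ tendsto_const])
    show "(\<lambda>n. 2 * (\<integral>x. (norm (F n x - f x))\<^sup>2 \<partial>M) + 2 * (\<integral>x. (norm (G n x - g x))\<^sup>2 \<partial>M)) \<longlonglongrightarrow> 0"
      using tendsto_add[OF tendsto_mult[OF tendsto_const L2_limD(4)[OF F]] tendsto_mult[OF tendsto_const L2_limD(4)[OF G]]]
      by simp
    show "\<forall>\<^sub>F n in sequentially. (\<integral>x. (norm (F n x + G n x - (f x + g x)))\<^sup>2 \<partial>M)
        \<le> 2 * (\<integral>x. (norm (F n x - f x))\<^sup>2 \<partial>M) + 2 * (\<integral>x. (norm (G n x - g x))\<^sup>2 \<partial>M)"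
    proof (intro always_eventually allI)
      fix n
      note i = L2_limD(3)[OF F, of n] L2_limD(3)[OF G, of n]
      note ii = i[THEN sq_int_integrable]
      have e: "F n x + G n x - (f x + g x) = (F n x - f x) + (G n x - g x)" for x by simp
      have "(\<integral>x. (norm (F n x + G n x - (f x + g x)))\<^sup>2 \<partial>M)
        \<le> (\<integral>x. 2 * (norm (F n x - f x))\<^sup>2 + 2 * (norm (G n x - g x))\<^sup>2 \<partial>M)"
        unfolding e using ii sq_int_integrable[OF sq_int_add[OF i]]
        by (intro integral_mono norm_add_sq_le) auto
      also have "\<dots> = 2 * (\<integral>x. (norm (F n x - f x))\<^sup>2 \<partial>M) + 2 * (\<integral>x. (norm (G n x - g x))\<^sup>2 \<partial>M)"
        using ii by simp
      finally show "(\<integral>x. (norm (F n x + G n x - (f x + g x)))\<^sup>2 \<partial>M)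
        \<le> 2 * (\<integral>x. (norm (F n x - f x))\<^sup>2 \<partial>M) + 2 * (\<integral>x. (norm (G n x - g x))\<^sup>2 \<partial>M)" .
    qed
  qed auto
qed (use L2_limD[OF F] L2_limD[OF G] in \<open>auto intro: sq_int_add\<close>)

text \<open>Pointwise linear maps with a common bound \<open>K\<close> act continuously on L2. The
  instances are multiplication by a bounded weight and the passage from a gradient to one of its
  columns.\<close>

lemma L2_lim_image:
  assumes F: "L2_lim M F f"
    and meas: "\<And>g. g \<in> borel_measurable M \<Longrightarrow> (\<lambda>x. h x (g x)) \<in> borel_measurable M"
    and lin: "\<And>x. x \<in> space M \<Longrightarrow> linear (h x)"
    and bd: "\<And>x v. x \<in> space M \<Longrightarrow> norm (h x v) \<le> K * norm v"
  shows "L2_lim M (\<lambda>n x. h x (F n x)) (\<lambda>x. h x (f x))"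
proof -
  have s: "sq_int M (\<lambda>x. h x (g x))" if "sq_int M g" for g
    by (rule sq_int_bound[OF that meas[OF sq_int_measurable[OF that]]]) (rule bd)
  have "(\<lambda>n. \<integral>x. (norm (h x (F n x) - h x (f x)))\<^sup>2 \<partial>M) \<longlonglongrightarrow> 0"
  proof (rule tendsto_sandwich[OF _ _ tendsto_const])
    show "(\<lambda>n. K\<^sup>2 * (\<integral>x. (norm (F n x - f x))\<^sup>2 \<partial>M)) \<longlonglongrightarrow> 0"
      using tendsto_mult[OF tendsto_const L2_limD(4)[OF F]] by simp
    show "\<forall>\<^sub>F n in sequentially. (\<integral>x. (norm (h x (F n x) - h x (f x)))\<^sup>2 \<partial>M)
        \<le> K\<^sup>2 * (\<integral>x. (norm (F n x - f x))\<^sup>2 \<partial>M)"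
    proof (intro always_eventually allI)
      fix n
      have "(\<integral>x. (norm (h x (F n x) - h x (f x)))\<^sup>2 \<partial>M) \<le> (\<integral>x. K\<^sup>2 * (norm (F n x - f x))\<^sup>2 \<partial>M)"
      proof (rule integral_mono)
        show "integrable M (\<lambda>x. (norm (h x (F n x) - h x (f x)))\<^sup>2)"
          by (intro sq_int_integrable sq_int_diff s L2_limD[OF F])
        show "integrable M (\<lambda>x. K\<^sup>2 * (norm (F n x - f x))\<^sup>2)"
          by (intro integrable_mult_right sq_int_integrable L2_limD[OF F])
        show "(norm (h x (F n x) - h x (f x)))\<^sup>2 \<le> K\<^sup>2 * (norm (F n x - f x))\<^sup>2" if "x \<in> space M" for x
          using power_mono[OF bd[OF that, of "F n x - f x"], of 2] linear_diff[OF lin[OF that]]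
          by (simp add: power_mult_distrib)
      qed
      then show "(\<integral>x. (norm (h x (F n x) - h x (f x)))\<^sup>2 \<partial>M) \<le> K\<^sup>2 * (\<integral>x. (norm (F n x - f x))\<^sup>2 \<partial>M)"
        by simp
    qed
  qed auto
  then show ?thesis
    unfolding L2_lim_def by (intro conjI allI s L2_limD[OF F])
qed

lemma L2_lim_scaleR: "L2_lim M F f \<Longrightarrow> L2_lim M (\<lambda>n x. c *\<^sub>R F n x) (\<lambda>x. c *\<^sub>R f x)"
  by (rule L2_lim_image[where K="\<bar>c\<bar>" and h="\<lambda>_ v. c *\<^sub>R v" and F=F and f=f]) (auto intro!: linearI simp: algebra_simps)

lemma L2_lim_diff: "L2_lim M F f \<Longrightarrow> L2_lim M G g \<Longrightarrow> L2_lim M (\<lambda>n x. F n x - G n x) (\<lambda>x. f x - g x)"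
  using L2_lim_add[of M F f "\<lambda>n x. (-1) *\<^sub>R G n x" "\<lambda>x. (-1) *\<^sub>R g x"] L2_lim_scaleR[of M G g "-1"] by simp

text \<open>By Cauchy-Schwarz, strong convergence implies weak convergence. Linear identities
  between integrals of C1 fields pass to the limit in this way.\<close>

lemma L2_lim_weak:
  assumes F: "L2_lim M F f" and w: "sq_int M w"
  shows "(\<lambda>n. \<integral>x. F n x \<bullet> w x \<partial>M) \<longlonglongrightarrow> (\<integral>x. f x \<bullet> w x \<partial>M)"
proof -
  have "(\<lambda>n. (\<integral>x. F n x \<bullet> w x \<partial>M) - (\<integral>x. f x \<bullet> w x \<partial>M)) \<longlonglongrightarrow> 0"
  proof (rule tendsto_0_le[where K=1, OF tendsto_real_sqrt[OF tendsto_mult_left_zero[OF L2_limD(4)[OF F]], of "\<integral>x. (norm (w x))\<^sup>2 \<partial>M", unfolded real_sqrt_zero]], intro always_eventually allI)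
    fix n
    let ?d = "\<lambda>x. F n x - f x"
    note d = L2_limD(3)[OF F, of n]
    have "(\<integral>x. F n x \<bullet> w x \<partial>M) - (\<integral>x. f x \<bullet> w x \<partial>M) = (\<integral>x. ?d x \<bullet> w x \<partial>M)"
      using sq_int_inner[OF L2_limD(1)[OF F, of n] w] sq_int_inner[OF L2_limD(2)[OF F] w]
      by (simp add: inner_diff_left)
    also have "\<bar>\<dots>\<bar> \<le> (\<integral>x. norm (?d x) * norm (w x) \<partial>M)"
      using sq_int_inner[OF d w] sq_int_norm_mult[OF d w]
      by (intro order_trans[OF integral_abs_bound] integral_mono) (auto simp: Cauchy_Schwarz_ineq2)
    also have "\<dots> \<le> sqrt ((\<integral>x. (norm (?d x))\<^sup>2 \<partial>M) * (\<integral>x. (norm (w x))\<^sup>2 \<partial>M))"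
      by (rule real_le_rsqrt[OF integral_norm_mult_cauchy_schwarz[OF d w]])
    finally show "norm ((\<integral>x. F n x \<bullet> w x \<partial>M) - (\<integral>x. f x \<bullet> w x \<partial>M))
      \<le> norm (sqrt ((\<integral>x. (norm (?d x))\<^sup>2 \<partial>M) * (\<integral>x. (norm (w x))\<^sup>2 \<partial>M))) * 1"
      by simp
  qed
  then show ?thesis by (simp add: LIM_zero_iff)
qed

text \<open>Expanding the square of \<open>F n - f\<close> reduces the claim to weak convergence
  tested against \<open>f\<close> itself. Quadratic inequalities pass to the limit in this
  way.\<close>

lemma L2_lim_norm:
  assumes F: "L2_lim M F f"
  shows "(\<lambda>n. \<integral>x. (norm (F n x))\<^sup>2 \<partial>M) \<longlonglongrightarrow> (\<integral>x. (norm (f x))\<^sup>2 \<partial>M)"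
proof -
  note f = L2_limD(2)[OF F]
  have "(\<integral>x. (norm (F n x))\<^sup>2 \<partial>M) = (\<integral>x. (norm (F n x - f x))\<^sup>2 \<partial>M) + 2 * (\<integral>x. F n x \<bullet> f x \<partial>M) - (\<integral>x. (norm (f x))\<^sup>2 \<partial>M)" for n
  proof -
    have "(norm (F n x))\<^sup>2 = (norm (F n x - f x))\<^sup>2 + 2 * (F n x \<bullet> f x) - (norm (f x))\<^sup>2" for x
      by (simp add: power2_norm_eq_inner inner_diff_left inner_diff_right inner_commute)
    then have "(\<integral>x. (norm (F n x))\<^sup>2 \<partial>M) = (\<integral>x. (norm (F n x - f x))\<^sup>2 + 2 * (F n x \<bullet> f x) - (norm (f x))\<^sup>2 \<partial>M)"
      by simp
    then show ?thesis
      using sq_int_integrable[OF L2_limD(3)[OF F, of n]] sq_int_integrable[OF f] sq_int_inner[OF L2_limD(1)[OF F, of n] f]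
      by simp
  qed
  moreover have "(\<lambda>n. (\<integral>x. (norm (F n x - f x))\<^sup>2 \<partial>M) + 2 * (\<integral>x. F n x \<bullet> f x \<partial>M) - (\<integral>x. (norm (f x))\<^sup>2 \<partial>M))
     \<longlonglongrightarrow> 0 + 2 * (\<integral>x. f x \<bullet> f x \<partial>M) - (\<integral>x. (norm (f x))\<^sup>2 \<partial>M)"
    by (intro tendsto_intros L2_limD(4)[OF F] L2_lim_weak[OF F f])
  ultimately show ?thesis by (simp add: power2_norm_eq_inner)
qed

section \<open>Slices of the cube\<close>

lemma slice_eq: "slice k s p = p + (s - p $ k) *\<^sub>R axis k 1"
  by (auto simp: slice_def vec_eq_iff axis_def)

lemma slice_nth: "slice k s p $ i = (if i = k then s else p $ i)"
  by (simp add: slice_def)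

lemma slice_slice: "slice k s (slice k r p) = slice k s p"
  by (simp add: slice_def vec_eq_iff)

lemma slice_self [simp]: "slice k (p $ k) p = p"
  by (simp add: slice_def vec_eq_iff)

lemma continuous_slice: "continuous_on UNIV (\<lambda>(s, p). slice k s p)"
  unfolding slice_eq case_prod_beta by (intro continuous_intros)

lemma slice_measurable [measurable]: "(\<lambda>p. slice k s p) \<in> borel_measurable borel"
  "(\<lambda>s. slice k s p) \<in> borel_measurable borel"
  "(\<lambda>(s, p). slice k s p) \<in> borel_measurable (borel \<Otimes>\<^sub>M borel)"
proof -
  show "(\<lambda>p. slice k s p) \<in> borel_measurable borel" "(\<lambda>s. slice k s p) \<in> borel_measurable borel"
    unfolding slice_eq by (auto intro!: borel_measurable_continuous_onI continuous_intros)
  show "(\<lambda>(s, p). slice k s p) \<in> borel_measurable (borel \<Otimes>\<^sub>M borel)"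
    unfolding borel_prod by (rule borel_measurable_continuous_onI[OF continuous_slice])
qed

lemma open_cube: "open (cube L)"
proof -
  have "cube L = (\<Inter>i\<in>UNIV. {p. 0 < p $ i} \<inter> {p. p $ i < L})" by (auto simp: cube_def)
  moreover have "open \<dots>" by (intro open_INT ballI open_Int open_Collect_less continuous_intros) auto
  ultimately show ?thesis by simp
qed

lemma cube_measurable [measurable]: "cube L \<in> sets borel"
  using open_cube by auto

lemma cube_eq_box: "cube L = box 0 (\<chi> i. L)"
  by (auto simp: cube_def mem_box_cart)

lemma measure_cube: "L > 0 \<Longrightarrow> measure lborel (cube L) = L ^ 3"
proof -
  assume "L > 0"
  then have "measure lborel (cube L) = (\<Prod>b\<in>Basis. ((\<chi> i. L) :: real^3) \<bullet> b)"
    unfolding cube_eq_box by (subst measure_lborel_box) (auto simp: Basis_vec_def inner_axis)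
  also have "\<dots> = L ^ card (Basis :: (real^3) set)"
    by (subst prod_constant[symmetric], intro prod.cong) (auto simp: Basis_vec_def inner_axis)
  finally show ?thesis by simp
qed

text \<open>With \<open>r = s - p $ k\<close> the slice becomes the translate of \<open>p\<close> by
  \<open>r\<close> along the axis. Tonelli and translation invariance for each fixed
  \<open>r\<close> exchange the roles of the two points, and every point is counted along a chord of
  length \<open>L\<close>.\<close>

lemma nn_integral_slice_indicator:
  fixes f :: "real^3 \<Rightarrow> ennreal"
  assumes [measurable]: "f \<in> borel_measurable borel" and "L > 0"
  shows "(\<integral>\<^sup>+p. (\<integral>\<^sup>+s. f (slice k s p) * indicator {0<..<L} s \<partial>lborel) * indicator (cube L) p \<partial>lborel)
    = ennreal L * (\<integral>\<^sup>+p. f p * indicator (cube L) p \<partial>lborel)"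
proof -
  have tr: "(\<integral>\<^sup>+s. g s \<partial>lborel) = (\<integral>\<^sup>+r. g (c + r) \<partial>lborel)" if [measurable]: "g \<in> borel_measurable borel" 
    for g :: "'c::euclidean_space \<Rightarrow> ennreal" and c
    by (subst lborel_distr_plus[of c, symmetric]) (simp add: nn_integral_distr)
  have [measurable]: "(\<lambda>p :: real^3. p $ k) \<in> borel_measurable borel"
    by (intro borel_measurable_continuous_onI continuous_intros)
  let ?e = "axis k 1 :: real^3"
  have [measurable]: "?e \<in> space borel" by simp
  have "(\<integral>\<^sup>+p. (\<integral>\<^sup>+s. f (slice k s p) * indicator {0<..<L} s \<partial>lborel) * indicator (cube L) p \<partial>lborel)
      = (\<integral>\<^sup>+p. (\<integral>\<^sup>+r. f (p + r *\<^sub>R ?e) * indicator {0<..<L} (p $ k + r) * indicator (cube L) p \<partial>lborel) \<partial>lborel)"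
  proof (intro nn_integral_cong)
    fix p :: "real^3"
    have "(\<integral>\<^sup>+s. f (slice k s p) * indicator {0<..<L} s \<partial>lborel) = 
       (\<integral>\<^sup>+r. f (p + r *\<^sub>R ?e) * indicator {0<..<L} (p $ k + r) \<partial>lborel)"
      using tr[of "\<lambda>s. f (slice k s p) * indicator {0<..<L} s" "p $ k"] by (simp add: slice_eq)
    then show "(\<integral>\<^sup>+s. f (slice k s p) * indicator {0<..<L} s \<partial>lborel) * indicator (cube L) p
      = (\<integral>\<^sup>+r. f (p + r *\<^sub>R ?e) * indicator {0<..<L} (p $ k + r) * indicator (cube L) p \<partial>lborel)"
      by (simp add: nn_integral_multc)
  qed
  also have "\<dots> = (\<integral>\<^sup>+r. (\<integral>\<^sup>+p. f (p + r *\<^sub>R ?e) * indicator {0<..<L} (p $ k + r) * indicator (cube L) p \<partial>lborel) \<partial>lborel)"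
    by (rule lborel_pair.Fubini') measurable
  also have "\<dots> = (\<integral>\<^sup>+r. (\<integral>\<^sup>+q. f q * indicator (cube L) q * indicator {0<..<L} (q $ k - r) \<partial>lborel) \<partial>lborel)"
  proof (rule nn_integral_cong)
    fix r :: real
    have "(\<integral>\<^sup>+q. f q * indicator (cube L) q * indicator {0<..<L} (q $ k - r) \<partial>lborel)
      = (\<integral>\<^sup>+p. f (r *\<^sub>R ?e + p) * indicator (cube L) (r *\<^sub>R ?e + p) * indicator {0<..<L} ((r *\<^sub>R ?e + p) $ k - r) \<partial>lborel)"
      by (rule tr) measurable
    also have "\<dots> = (\<integral>\<^sup>+p. f (p + r *\<^sub>R ?e) * indicator {0<..<L} (p $ k + r) * indicator (cube L) p \<partial>lborel)"
    proof (intro nn_integral_cong)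
      fix p :: "real^3"
      \<comment> \<open>The translation moves only coordinate \<open>k\<close>, so the two
        membership conditions merely trade which of \<open>p $ k\<close> and
        \<open>p $ k + r\<close> is constrained by the cube.\<close>
      have "r *\<^sub>R ?e + p \<in> cube L \<and> 0 < p $ k \<and> p $ k < L \<longleftrightarrow> 0 < p $ k + r \<and> p $ k + r < L \<and> p \<in> cube L"
        by (auto simp: cube_def axis_def algebra_simps)
      then show "f (r *\<^sub>R ?e + p) * indicator (cube L) (r *\<^sub>R ?e + p) * indicator {0<..<L} ((r *\<^sub>R ?e + p) $ k - r)
        = f (p + r *\<^sub>R ?e) * indicator {0<..<L} (p $ k + r) * indicator (cube L) p"
        by (auto simp: indicator_def add.commute split: if_splits)
    qed
    finally show "(\<integral>\<^sup>+p. f (p + r *\<^sub>R ?e) * indicator {0<..<L} (p $ k + r) * indicator (cube L) p \<partial>lborel)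
      = (\<integral>\<^sup>+q. f q * indicator (cube L) q * indicator {0<..<L} (q $ k - r) \<partial>lborel)" by simp
  qed
  also have "\<dots> = (\<integral>\<^sup>+q. (\<integral>\<^sup>+r. f q * indicator (cube L) q * indicator {0<..<L} (q $ k - r) \<partial>lborel) \<partial>lborel)"
    by (rule lborel_pair.Fubini'[symmetric]) measurable
  also have "\<dots> = (\<integral>\<^sup>+q. f q * indicator (cube L) q * ennreal L \<partial>lborel)"
  proof (intro nn_integral_cong)
    fix q :: "real^3"
    \<comment> \<open>The admissible translations fill an interval whose length \<open>L\<close>
      does not depend on \<open>q\<close>.\<close>
    have "(\<integral>\<^sup>+r. f q * indicator (cube L) q * indicator {0<..<L} (q $ k - r) \<partial>lborel)
      = f q * indicator (cube L) q * (\<integral>\<^sup>+r. indicator {q $ k - L<..<q $ k} r \<partial>lborel)"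
      by (subst nn_integral_cmult[symmetric]) (auto intro!: nn_integral_cong simp: indicator_def)
    then show "(\<integral>\<^sup>+r. f q * indicator (cube L) q * indicator {0<..<L} (q $ k - r) \<partial>lborel) = f q * indicator (cube L) q * ennreal L"
      using assms by simp
  qed
  also have "\<dots> = (\<integral>\<^sup>+q. f q * indicator (cube L) q \<partial>lborel) * ennreal L"
    by (rule nn_integral_multc) measurable
  also have "\<dots> = ennreal L * (\<integral>\<^sup>+q. f q * indicator (cube L) q \<partial>lborel)"
    by (rule mult.commute)
  finally show ?thesis .
qed

section \<open>Continuously differentiable fields\<close>

lemma partial_eqI: "(f has_derivative f') (at p) \<Longrightarrow> partial k f p = f' (axis k 1)"
  using frechet_derivative_at by (metis partial_def)

lemma Ck_1_iff: "Ck 1 f \<longleftrightarrow> (\<forall>p. f differentiable (at p)) \<and> (\<forall>k. continuous_on UNIV (partial k f))"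
  by (simp only: One_nat_def Ck.simps)

lemma Ck_1I:
  assumes "\<And>p. (f has_derivative f' p) (at p)" "\<And>k. continuous_on UNIV (\<lambda>p. f' p (axis k 1))"
  shows "Ck 1 f"
proof -
  have "partial k f = (\<lambda>p. f' p (axis k 1))" for k
    using partial_eqI[OF assms(1)] by auto
  then show ?thesis
    using assms by (auto simp: Ck_1_iff differentiable_def)
qed

lemma Ck_1_has_derivative: "Ck 1 f \<Longrightarrow> (f has_derivative frechet_derivative f (at p)) (at p)"
  by (simp add: Ck_1_iff frechet_derivative_works)

lemma Ck_1_continuous_partial: "Ck 1 f \<Longrightarrow> continuous_on UNIV (partial k f)"
  by (simp add: Ck_1_iff)

lemma Ck_1_continuous: "Ck 1 f \<Longrightarrow> continuous_on UNIV f"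
  by (metis Ck_1_iff differentiable_imp_continuous_on differentiable_on_def differentiable_at_withinI)

lemma jacobian_nth: "jacobian V (at p) $ i $ k = partial k V p $ i"
  by (simp add: jacobian_def matrix_def partial_def)

lemma Ck_1_continuous_jacobian:
  assumes "Ck 1 (V :: real^3 \<Rightarrow> real^3)"
  shows "continuous_on UNIV (\<lambda>p. jacobian V (at p))"
proof -
  have eq: "(\<lambda>p. jacobian V (at p)) = (\<lambda>p. \<chi> i k. partial k V p $ i)"
    by (auto simp: vec_eq_iff jacobian_nth)
  show ?thesis
    unfolding eq by (auto intro!: continuous_intros continuous_on_vec_lambda Ck_1_continuous_partial[OF assms])
qed

lemma Ck_1_nth:
  assumes "Ck 1 (V :: real^3 \<Rightarrow> real^3)"
  shows "Ck 1 (\<lambda>p. V p $ i)" and "partial k (\<lambda>p. V p $ i) p = partial k V p $ i"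
proof -
  have d: "((\<lambda>p. V p $ i) has_derivative (\<lambda>h. frechet_derivative V (at p) h $ i)) (at p)" for p
    by (rule bounded_linear.has_derivative[OF bounded_linear_vec_nth Ck_1_has_derivative[OF assms]])
  show "partial k (\<lambda>p. V p $ i) p = partial k V p $ i"
    by (simp add: partial_eqI[OF d] partial_def)
  show "Ck 1 (\<lambda>p. V p $ i)"
    using Ck_1_continuous_partial[OF assms]
    by (intro Ck_1I[OF d]) (auto simp: partial_def[symmetric] intro!: continuous_intros)
qed

lemma Ck_1_mult:
  assumes f: "Ck 1 (f :: real^3 \<Rightarrow> real)" and g: "Ck 1 g"
  shows "Ck 1 (\<lambda>p. f p * g p)" and "partial k (\<lambda>p. f p * g p) p = f p * partial k g p + partial k f p * g p"
proof -
  have d: "((\<lambda>p. f p * g p) has_derivative (\<lambda>h. f p * frechet_derivative g (at p) h + frechet_derivative f (at p) h * g p)) (at p)" for p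
    by (rule has_derivative_mult[OF Ck_1_has_derivative[OF f] Ck_1_has_derivative[OF g]])
  show "partial k (\<lambda>p. f p * g p) p = f p * partial k g p + partial k f p * g p"
    by (simp add: partial_eqI[OF d] partial_def)
  show "Ck 1 (\<lambda>p. f p * g p)"
    using Ck_1_continuous_partial[OF f] Ck_1_continuous_partial[OF g] Ck_1_continuous[OF f] Ck_1_continuous[OF g]
    by (intro Ck_1I[OF d]) (auto simp: partial_def[symmetric] intro!: continuous_intros)
qed

lemma has_vector_derivative_slice:
  assumes "(f :: real^3 \<Rightarrow> 'b::real_normed_vector) differentiable (at (slice k s p))"
  shows "((\<lambda>s. f (slice k s p)) has_vector_derivative partial k f (slice k s p)) (at s within S)"
proof -
  let ?q = "slice k s p"
  have 1: "((\<lambda>s. slice k s p) has_derivative (\<lambda>h. h *\<^sub>R axis k 1)) (at s within S)"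
    unfolding slice_eq by (auto intro!: derivative_eq_intros)
  have 2: "(f has_derivative frechet_derivative f (at ?q)) (at ?q)"
    using assms by (simp add: frechet_derivative_works)
  have "((\<lambda>s. f (slice k s p)) has_derivative (\<lambda>h. frechet_derivative f (at ?q) (h *\<^sub>R axis k 1))) (at s within S)"
    by (rule has_derivative_compose[OF 1 2])
  moreover have "frechet_derivative f (at ?q) (h *\<^sub>R axis k 1) = h *\<^sub>R partial k f ?q" for h
    using linear_frechet_derivative[OF assms] by (simp add: partial_def linear_cmul)
  ultimately show ?thesis by (simp add: has_vector_derivative_def)
qed

text \<open>Slices at \<open>0\<close> and \<open>L\<close> lie on the faces, outside the open cube;
  compactness of the closed cube covers both bounds.\<close>

lemma bounded_on_cube:
  assumes "continuous_on UNIV (f :: real^3 \<Rightarrow> 'b::real_normed_vector)"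
  obtains B where "\<And>p. p \<in> cube L \<Longrightarrow> norm (f p) \<le> B"
    and "\<And>p k s. p \<in> cube L \<Longrightarrow> 0 \<le> s \<Longrightarrow> s \<le> L \<Longrightarrow> norm (f (slice k s p)) \<le> B"
proof -
  have "compact (f ` cbox 0 (\<chi> i. L))"
    by (intro compact_continuous_image continuous_on_subset[OF assms]) auto
  then have "bounded (f ` cbox 0 (\<chi> i. L))" by (rule compact_imp_bounded)
  then obtain B where "\<forall>x\<in>f ` cbox 0 (\<chi> i. L). norm x \<le> B" by (auto simp only: bounded_iff)
  then have B: "\<And>p. p \<in> cbox 0 (\<chi> i. L) \<Longrightarrow> norm (f p) \<le> B" by simp
  show ?thesis
    by (rule that[of B]; rule B) (auto simp: cube_def mem_box_cart slice_nth less_imp_le)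
qed

section \<open>Integration along slices\<close>

lemma emeasure_cube_finite: "emeasure lborel (cube L) < \<infinity>"
  unfolding cube_eq_box using emeasure_lborel_box_finite by (simp add: less_top)

lemma set_integrable_const:
  fixes c :: "'b::euclidean_space"
  assumes [measurable]: "A \<in> sets borel" and "emeasure lborel A < \<infinity>"
  shows "set_integrable lborel A (\<lambda>_. c)"
  using integrable_indicator_iff[of lborel A] assms
  by (auto simp: set_integrable_def intro!: integrable_scaleR_left)

lemma set_integrable_bounded:
  fixes f :: "'a::euclidean_space \<Rightarrow> 'b::euclidean_space"
  assumes [measurable]: "A \<in> sets borel" "f \<in> borel_measurable borel"
    and f: "\<And>x. x \<in> A \<Longrightarrow> norm (f x) \<le> B" and "emeasure lborel A < \<infinity>"
  shows "set_integrable lborel A f"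
  unfolding set_integrable_def
proof (rule Bochner_Integration.integrable_bound)
  show "integrable lborel (\<lambda>x. indicator A x *\<^sub>R B)"
    using set_integrable_const[of A B] assms by (simp add: set_integrable_def)
  show "AE x in lborel. norm (indicator A x *\<^sub>R f x) \<le> norm (indicator A x *\<^sub>R B)"
    using f by (intro AE_I2) (auto simp: indicator_def intro: order_trans[OF _ abs_ge_self])
qed simp

lemma set_integral_eq_nn_integral:
  fixes f :: "'a::euclidean_space \<Rightarrow> real"
  assumes [measurable]: "A \<in> sets borel" "f \<in> borel_measurable borel"
    and f: "\<And>x. x \<in> A \<Longrightarrow> 0 \<le> f x" "\<And>x. x \<in> A \<Longrightarrow> f x \<le> B" and "emeasure lborel A < \<infinity>"
  shows "set_integrable lborel A f"
    and "ennreal (LINT x:A|lborel. f x) = (\<integral>\<^sup>+x. ennreal (f x) * indicator A x \<partial>lborel)"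
proof -
  show i: "set_integrable lborel A f"
    by (rule set_integrable_bounded[where B=B]) (use assms in auto)
  have "ennreal (LINT x:A|lborel. f x) = (\<integral>\<^sup>+x. ennreal (indicator A x *\<^sub>R f x) \<partial>lborel)"
    unfolding set_lebesgue_integral_def
    using i f by (intro nn_integral_eq_integral[symmetric]) (auto simp: set_integrable_def indicator_def)
  also have "\<dots> = (\<integral>\<^sup>+x. ennreal (f x) * indicator A x \<partial>lborel)"
    by (intro nn_integral_cong) (auto simp: indicator_def)
  finally show "ennreal (LINT x:A|lborel. f x) = (\<integral>\<^sup>+x. ennreal (f x) * indicator A x \<partial>lborel)" .
qed

lemma slice_in_cube: "p \<in> cube L \<Longrightarrow> 0 < s \<Longrightarrow> s < L \<Longrightarrow> slice k s p \<in> cube L"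
  by (auto simp: cube_def slice_nth)

lemma slice_section_measurable [measurable]:
  fixes f :: "real^3 \<Rightarrow> real"
  assumes [measurable]: "f \<in> borel_measurable borel"
  shows "(\<lambda>p. LINT s:{0<..<L}|lborel. f (slice k s p)) \<in> borel_measurable borel"
proof -
  have "(\<lambda>p. LINT s|lborel. indicator {0<..<L} s *\<^sub>R f (slice k s p)) \<in> borel_measurable lborel"
    by (rule lborel.borel_measurable_lebesgue_integral) measurable
  then show ?thesis by (simp add: set_lebesgue_integral_def)
qed

text \<open>The bound \<open>B\<close> makes both sides finite, so that the identity for extended
  nonnegative integrals descends to real ones.\<close>

lemma integral_slice_nonneg:
  fixes f :: "real^3 \<Rightarrow> real"
  assumes [measurable]: "f \<in> borel_measurable borel" and "L > 0"
    and f: "\<And>p. p \<in> cube L \<Longrightarrow> 0 \<le> f p" "\<And>p. p \<in> cube L \<Longrightarrow> f p \<le> B"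
  shows "(LINT p:cube L|lborel. LINT s:{0<..<L}|lborel. f (slice k s p)) = L * (LINT p:cube L|lborel. f p)"
proof -
  define g where "g p = (LINT s:{0<..<L}|lborel. f (slice k s p))" for p
  have [measurable]: "g \<in> borel_measurable borel" unfolding g_def by measurable
  have gi: "set_integrable lborel {0<..<L} (\<lambda>s. f (slice k s p))"
    and gn: "ennreal (g p) = (\<integral>\<^sup>+s. ennreal (f (slice k s p)) * indicator {0<..<L} s \<partial>lborel)" if "p \<in> cube L" for p
    unfolding g_def
    by (rule set_integral_eq_nn_integral[of _ _ B]; use that f assms(2) in \<open>auto intro!: slice_in_cube\<close>)+
  have g0: "0 \<le> g p" if "p \<in> cube L" for p
    using that f unfolding g_def set_lebesgue_integral_def
    by (intro integral_nonneg_AE AE_I2) (auto simp: indicator_def slice_in_cube)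
  have gB: "g p \<le> L * B" if "p \<in> cube L" for p
  proof -
    have "g p \<le> (LINT s:{0<..<L}|lborel. B)"
      unfolding g_def by (intro set_integral_mono gi that f slice_in_cube set_integrable_const) (use assms(2) in auto)
    then show ?thesis using assms(2) by (simp add: set_lebesgue_integral_def)
  qed
  have "ennreal (LINT p:cube L|lborel. g p) = (\<integral>\<^sup>+p. ennreal (g p) * indicator (cube L) p \<partial>lborel)"
    by (rule set_integral_eq_nn_integral[of _ _ "L * B"]) (use g0 gB emeasure_cube_finite in auto)
  also have "\<dots> = (\<integral>\<^sup>+p. (\<integral>\<^sup>+s. ennreal (f (slice k s p)) * indicator {0<..<L} s \<partial>lborel) * indicator (cube L) p \<partial>lborel)"
    by (intro nn_integral_cong) (auto simp: gn indicator_def)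
  also have "\<dots> = ennreal L * (\<integral>\<^sup>+p. ennreal (f p) * indicator (cube L) p \<partial>lborel)"
    by (rule nn_integral_slice_indicator) (use assms in auto)
  also have "(\<integral>\<^sup>+p. ennreal (f p) * indicator (cube L) p \<partial>lborel) = ennreal (LINT p:cube L|lborel. f p)"
    by (rule set_integral_eq_nn_integral(2)[symmetric, of _ _ B]) (use f emeasure_cube_finite in auto)
  also have "ennreal L * \<dots> = ennreal (L * (LINT p:cube L|lborel. f p))"
    using assms(2) by (simp add: ennreal_mult')
  finally show ?thesis
    unfolding g_def[symmetric]
    using assms(2) f g0 by (subst (asm) ennreal_inj) (auto intro!: mult_nonneg_nonneg Bochner_Integration.integral_nonneg simp: set_lebesgue_integral_def indicator_def)
qed

lemma integral_slice:
  fixes f :: "real^3 \<Rightarrow> real"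
  assumes [measurable]: "f \<in> borel_measurable borel" and "L > 0"
    and f: "\<And>p. p \<in> cube L \<Longrightarrow> \<bar>f p\<bar> \<le> B"
  shows "(LINT p:cube L|lborel. LINT s:{0<..<L}|lborel. f (slice k s p)) = L * (LINT p:cube L|lborel. f p)"
proof -
  have i: "set_integrable lborel (cube L) f"
    by (rule set_integrable_bounded[where B=B]) (use f emeasure_cube_finite in auto)
  have c: "set_integrable lborel (cube L) (\<lambda>_. c::real)" for c
    using emeasure_cube_finite by (intro set_integrable_const) auto
  have gi: "set_integrable lborel {0<..<L} (\<lambda>s. f (slice k s p))" if "p \<in> cube L" for p
    by (rule set_integrable_bounded[where B=B]) (use that f assms(2) in \<open>auto intro!: slice_in_cube\<close>)
  have ci: "set_integrable lborel {0<..<L} (\<lambda>s. c::real)" for c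
    by (intro set_integrable_const) (use assms(2) in auto)
  define g where "g p = (LINT s:{0<..<L}|lborel. f (slice k s p))" for p
  have [measurable]: "g \<in> borel_measurable borel" unfolding g_def by measurable
  have gB: "\<bar>g p\<bar> \<le> L * B" if "p \<in> cube L" for p
  proof -
    have "\<bar>g p\<bar> \<le> (LINT s:{0<..<L}|lborel. \<bar>f (slice k s p)\<bar>)"
      unfolding g_def by (rule set_integral_norm_bound[OF gi[OF that], simplified])
    also have "\<dots> \<le> (LINT s:{0<..<L}|lborel. B)"
      using that by (intro set_integral_mono ci set_integrable_abs gi f slice_in_cube) auto
    finally show ?thesis using assms(2) by (simp add: set_lebesgue_integral_def)
  qed
  have g_int: "set_integrable lborel (cube L) g"
    by (rule set_integrable_bounded[where B="L * B"]) (use gB emeasure_cube_finite in auto)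
  \<comment> \<open>Adding \<open>B\<close> makes the integrand nonnegative; the constant
    contributes \<open>L ^ 4 * B\<close> to both sides and cancels.\<close>
  have "(LINT p:cube L|lborel. LINT s:{0<..<L}|lborel. f (slice k s p) + B) = L * (LINT p:cube L|lborel. f p + B)"
  proof (rule integral_slice_nonneg[where B="2 * B"])
    show "0 \<le> f p + B" "f p + B \<le> 2 * B" if "p \<in> cube L" for p
      using f[OF that] by auto
  qed (use assms in auto)
  also have "(LINT p:cube L|lborel. LINT s:{0<..<L}|lborel. f (slice k s p) + B) = (LINT p:cube L|lborel. g p + L * B)"
  proof (intro set_lebesgue_integral_cong ballI allI impI)
    fix p assume p: "p \<in> cube L"
    show "(LINT s:{0<..<L}|lborel. f (slice k s p) + B) = g p + L * B"
      using set_integral_add(2)[OF gi[OF p] ci[of B]] assms(2) by (simp add: g_def) (simp add: set_lebesgue_integral_def)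
  qed auto
  also have "\<dots> = (LINT p:cube L|lborel. g p) + L ^ 3 * (L * B)"
    using set_integral_add(2)[OF g_int c[of "L * B"]] measure_cube[OF assms(2)]
    by simp (simp add: set_lebesgue_integral_def)
  also have "(LINT p:cube L|lborel. f p + B) = (LINT p:cube L|lborel. f p) + L ^ 3 * B"
    using set_integral_add(2)[OF i c[of "B"]] measure_cube[OF assms(2)]
    by simp (simp add: set_lebesgue_integral_def)
  finally show ?thesis by (simp add: g_def algebra_simps)
qed

lemma integral_Ioo_eq_Icc:
  fixes f :: "real \<Rightarrow> 'b::euclidean_space"
  assumes "a \<le> b"
  shows "(LINT s:{a<..<b}|lborel. f s) = (LINT s:{a..b}|lborel. f s)"
  using interval_integral_Icc[of a b f] interval_integral_Ioo[of a b f] assms by simp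

lemma slice_FTC:
  fixes f :: "real^3 \<Rightarrow> 'b::euclidean_space"
  assumes "Ck 1 f" and "a \<le> b"
  shows "set_integrable lborel {a..b} (\<lambda>s. partial k f (slice k s p))"
    and "(LINT s:{a..b}|lborel. partial k f (slice k s p)) = f (slice k b p) - f (slice k a p)"
proof -
  have c: "continuous_on {a..b} (\<lambda>s. partial k f (slice k s p))"
    by (rule continuous_on_compose2[OF Ck_1_continuous_partial[OF assms(1)]])
      (auto simp: slice_eq intro!: continuous_intros)
  then show "set_integrable lborel {a..b} (\<lambda>s. partial k f (slice k s p))"
    by (rule borel_integrable_atLeastAtMost')
  show "(LINT s:{a..b}|lborel. partial k f (slice k s p)) = f (slice k b p) - f (slice k a p)"
    unfolding set_lebesgue_integral_def
    by (rule integral_FTC_atLeastAtMost[OF assms(2) has_vector_derivative_slice c])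
      (use assms(1) in \<open>auto simp: Ck_1_iff\<close>)
qed

text \<open>The divergence theorem for a single direction. The factor \<open>L\<close> reflects the
  redundant parametrization of the faces by the whole cube.\<close>

lemma cube_FTC:
  fixes f :: "real^3 \<Rightarrow> real"
  assumes f: "Ck 1 f" and "L > 0"
  shows "L * (LINT p:cube L|lborel. partial k f p) = (LINT p:cube L|lborel. f (slice k L p) - f (slice k 0 p))"
proof -
  obtain B where B: "\<And>p. p \<in> cube L \<Longrightarrow> norm (partial k f p) \<le> B"
    using bounded_on_cube[OF Ck_1_continuous_partial[OF f]] by metis
  have [measurable]: "partial k f \<in> borel_measurable borel"
    by (rule borel_measurable_continuous_onI[OF Ck_1_continuous_partial[OF f]])
  have "L * (LINT p:cube L|lborel. partial k f p) = (LINT p:cube L|lborel. LINT s:{0<..<L}|lborel. partial k f (slice k s p))"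
    by (rule integral_slice[symmetric, where B=B]) (use B assms in auto)
  also have "\<dots> = (LINT p:cube L|lborel. f (slice k L p) - f (slice k 0 p))"
    using slice_FTC(2)[OF f, of 0 L] assms(2) by (simp add: integral_Ioo_eq_Icc)
  finally show ?thesis .
qed

section \<open>A weighted Poincare inequality\<close>

lemma vec_nth_measurable [measurable]: "(\<lambda>p :: real^3. p $ k) \<in> borel_measurable borel"
  by (intro borel_measurable_continuous_onI continuous_intros)

text \<open>The increment is the integral of the partial derivative over \<open>{z..L}\<close>;
  Cauchy-Schwarz against the constant 1 produces the length \<open>L - z\<close>. The extended
  nonnegative form is ready for Tonelli.\<close>

lemma slice_increment_sq_le:
  fixes V :: "real^3 \<Rightarrow> 'b::euclidean_space"
  assumes V: "Ck 1 V" and z: "z \<le> L"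
  shows "ennreal ((norm (V (slice k L p) - V (slice k z p)))\<^sup>2)
    \<le> ennreal (L - z) * (\<integral>\<^sup>+s. ennreal ((norm (partial k V (slice k s p)))\<^sup>2) * indicator {z..L} s \<partial>lborel)"
proof -
  define g where "g s = partial k V (slice k s p)" for s
  define G where "G s = indicator {z..L} s *\<^sub>R g s" for s
  have cg: "continuous_on {z..L} g"
    unfolding g_def by (rule continuous_on_compose2[OF Ck_1_continuous_partial[OF V]])
      (auto simp: slice_eq intro!: continuous_intros)
  have iG: "integrable lborel G"
    unfolding G_def using slice_FTC(1)[OF V z] by (simp add: set_integrable_def g_def)
  have "integrable lborel (\<lambda>s. indicator {z..L} s *\<^sub>R (norm (g s))\<^sup>2)"
    unfolding set_integrable_def[symmetric]
    by (rule borel_integrable_atLeastAtMost') (intro continuous_intros cg)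
  then have iG2: "integrable lborel (\<lambda>s. (norm (G s))\<^sup>2)"
    by (rule Bochner_Integration.integrable_cong[THEN iffD1, rotated 2]) (auto simp: G_def indicator_def)
  have sG: "sq_int lborel G"
    using iG iG2 by (simp add: sq_int_def)
  have s1: "sq_int lborel (indicator {z..L} :: real \<Rightarrow> real)"
  proof -
    have "(\<lambda>s. (norm (indicator {z..L} s :: real))\<^sup>2) = indicator {z..L}"
      by (auto simp: indicator_def)
    moreover have "integrable lborel (indicator {z..L} :: real \<Rightarrow> real)"
      by (rule integrable_real_indicator) (use z in auto)
    ultimately show ?thesis by (simp add: sq_int_def)
  qed
  have "(\<integral>s. norm (G s) \<partial>lborel) = (\<integral>s. norm (G s) * norm (indicator {z..L} s :: real) \<partial>lborel)"
    by (intro Bochner_Integration.integral_cong) (auto simp: G_def indicator_def)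
  then have "(\<integral>s. norm (G s) \<partial>lborel)\<^sup>2 \<le> (\<integral>s. (norm (G s))\<^sup>2 \<partial>lborel) * (\<integral>s. (norm (indicator {z..L} s :: real))\<^sup>2 \<partial>lborel)"
    using integral_norm_mult_cauchy_schwarz[OF sG s1] by simp
  also have "(\<integral>s. (norm (indicator {z..L} s :: real))\<^sup>2 \<partial>lborel) = (\<integral>s. indicator {z..L} s \<partial>lborel)"
    by (intro Bochner_Integration.integral_cong) (auto simp: indicator_def)
  also have "\<dots> = L - z" using z by simp
  finally have cs: "(\<integral>s. norm (G s) \<partial>lborel)\<^sup>2 \<le> (L - z) * (\<integral>s. (norm (G s))\<^sup>2 \<partial>lborel)"
    by (simp add: mult.commute)
  have "V (slice k L p) - V (slice k z p) = (\<integral>s. G s \<partial>lborel)"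
    using slice_FTC(2)[OF V z, of k p] by (simp add: G_def g_def set_lebesgue_integral_def)
  then have "norm (V (slice k L p) - V (slice k z p)) \<le> (\<integral>s. norm (G s) \<partial>lborel)"
    by (simp add: integral_norm_bound)
  then have "(norm (V (slice k L p) - V (slice k z p)))\<^sup>2 \<le> (L - z) * (\<integral>s. (norm (G s))\<^sup>2 \<partial>lborel)"
    using cs by (meson norm_ge_zero order_trans power_mono)
  then have "ennreal ((norm (V (slice k L p) - V (slice k z p)))\<^sup>2) \<le> ennreal ((L - z) * (\<integral>s. (norm (G s))\<^sup>2 \<partial>lborel))"
    by (rule ennreal_leI)
  also have "\<dots> = ennreal (L - z) * ennreal (\<integral>s. (norm (G s))\<^sup>2 \<partial>lborel)"
    using z by (simp add: ennreal_mult')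
  also have "ennreal (\<integral>s. (norm (G s))\<^sup>2 \<partial>lborel) = (\<integral>\<^sup>+s. ennreal ((norm (G s))\<^sup>2) \<partial>lborel)"
    by (rule nn_integral_eq_integral[OF iG2, symmetric]) simp
  also have "\<dots> = (\<integral>\<^sup>+s. ennreal ((norm (g s))\<^sup>2) * indicator {z..L} s \<partial>lborel)"
    by (rule nn_integral_cong) (auto simp: G_def indicator_def)
  finally show ?thesis by (simp add: g_def)
qed

text \<open>The weight \<open>h\<close> has to compensate only the length \<open>L - z\<close>, and
  the condition on \<open>M\<close> says exactly this. Keeping it general serves both the indicator
  of the layer and the squared slope of the background flow.\<close>

lemma nn_integral_slice_poincare:
  fixes V :: "real^3 \<Rightarrow> 'b::euclidean_space"
  assumes V: "Ck 1 V" and L: "L > 0" and a: "0 \<le> a" "a \<le> L" and [measurable]: "h \<in> borel_measurable borel"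
    and h: "\<And>z. z \<le> a \<Longrightarrow> h z = 0" "\<And>z. 0 \<le> h z" "\<And>z. a < z \<Longrightarrow> z < L \<Longrightarrow> h z * (L - z) \<le> M" and M: "M \<ge> 0"
  shows "(\<integral>\<^sup>+p. ennreal (h (p $ k) * (norm (V p - V (slice k L p)))\<^sup>2) * indicator (cube L) p \<partial>lborel)
    \<le> ennreal (M * (L - a)) * (\<integral>\<^sup>+p. indicator {a<..} (p $ k) * ennreal ((norm (partial k V p))\<^sup>2) * indicator (cube L) p \<partial>lborel)"
proof -
  define f where "f p = indicator {a<..} (p $ k) * ennreal ((norm (partial k V p))\<^sup>2)" for p
  define N where "N p = (\<integral>\<^sup>+s. f (slice k s p) * indicator {0<..<L} s \<partial>lborel)" for p
  have [measurable]: "partial k V \<in> borel_measurable borel" "V \<in> borel_measurable borel"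
    by (auto intro!: borel_measurable_continuous_onI Ck_1_continuous_partial[OF V] Ck_1_continuous[OF V])
  have [measurable]: "f \<in> borel_measurable borel" unfolding f_def by measurable
  have "(\<lambda>p. \<integral>\<^sup>+s. f (slice k s p) * indicator {0<..<L} s \<partial>lborel) \<in> borel_measurable lborel"
    by (rule lborel.borel_measurable_nn_integral) measurable
  then have [measurable]: "N \<in> borel_measurable borel" unfolding N_def by simp
  \<comment> \<open>The weight absorbs the length from Cauchy-Schwarz. What remains is an integral
    over the part of the chord above \<open>a\<close>, and \<open>N p\<close> does not depend on
    \<open>p $ k\<close>.\<close>
  have point: "ennreal (h (p $ k) * (norm (V p - V (slice k L p)))\<^sup>2) \<le> ennreal M * (indicator {a<..<L} (p $ k) * N p)"
    if p: "p \<in> cube L" for p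
  proof (cases "a < p $ k")
    case True
    have pL: "p $ k < L" using p by (simp add: cube_def)
    have "ennreal ((norm (V p - V (slice k L p)))\<^sup>2)
      \<le> ennreal (L - p $ k) * (\<integral>\<^sup>+s. ennreal ((norm (partial k V (slice k s p)))\<^sup>2) * indicator {p $ k..L} s \<partial>lborel)"
      using slice_increment_sq_le[OF V, of "p $ k" L k p] pL by (simp add: norm_minus_commute)
    \<comment> \<open>The increment estimate includes the endpoint \<open>L\<close>, whereas
      \<open>N\<close> stops short of it; a single point is null.\<close>
    also have "(\<integral>\<^sup>+s. ennreal ((norm (partial k V (slice k s p)))\<^sup>2) * indicator {p $ k..L} s \<partial>lborel) \<le> N p"
      unfolding N_def
      by (rule nn_integral_mono_AE, rule AE_mp[OF AE_lborel_singleton[of L]])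
        (use True a in \<open>auto simp: f_def slice_nth indicator_def\<close>)
    finally have "ennreal ((norm (V p - V (slice k L p)))\<^sup>2) \<le> ennreal (L - p $ k) * N p"
      by (simp add: mult_left_mono)
    then have "ennreal (h (p $ k)) * ennreal ((norm (V p - V (slice k L p)))\<^sup>2) \<le> ennreal (h (p $ k)) * (ennreal (L - p $ k) * N p)"
      by (rule mult_left_mono) simp
    also have "\<dots> = ennreal (h (p $ k) * (L - p $ k)) * N p"
      using pL h(2) by (simp add: ennreal_mult' mult.assoc)
    also have "\<dots> \<le> ennreal M * N p"
      using h(3)[OF True pL] by (intro mult_right_mono ennreal_leI) auto
    finally show ?thesis using True pL h(2) by (simp add: ennreal_mult')
  qed (simp add: h(1))
  have "(\<integral>\<^sup>+p. ennreal (h (p $ k) * (norm (V p - V (slice k L p)))\<^sup>2) * indicator (cube L) p \<partial>lborel)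
    \<le> (\<integral>\<^sup>+p. ennreal M * ((indicator {a<..<L} (p $ k) * N p) * indicator (cube L) p) \<partial>lborel)"
    by (rule nn_integral_mono) (use point in \<open>auto simp: indicator_def\<close>)
  also have "\<dots> = ennreal M * (\<integral>\<^sup>+p. (indicator {a<..<L} (p $ k) * N p) * indicator (cube L) p \<partial>lborel)"
    by (rule nn_integral_cmult) measurable
  also have "(\<integral>\<^sup>+p. (indicator {a<..<L} (p $ k) * N p) * indicator (cube L) p \<partial>lborel)
     = ennreal (L - a) * (\<integral>\<^sup>+p. f p * indicator (cube L) p \<partial>lborel)" (is "?I = _ * ?J")
  proof -
    have Ns: "N (slice k s p) = N p" for s p by (simp add: N_def slice_slice)
    \<comment> \<open>Averaging over chords is applied twice: first to the indicator times
      \<open>N\<close>, where \<open>N\<close> is constant along the chord and the indicator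
      integrates to \<open>L - a\<close>, and then to \<open>N\<close> itself. The factor
      \<open>L\<close> arises both times and cancels.\<close>
    have "ennreal L * ?I = (\<integral>\<^sup>+p. (\<integral>\<^sup>+s. (indicator {a<..<L} (slice k s p $ k) * N (slice k s p)) * indicator {0<..<L} s \<partial>lborel) * indicator (cube L) p \<partial>lborel)"
      by (rule nn_integral_slice_indicator[symmetric]) (use L in auto)
    also have "\<dots> = (\<integral>\<^sup>+p. ennreal (L - a) * (N p * indicator (cube L) p) \<partial>lborel)"
    proof (rule nn_integral_cong)
      fix p :: "real^3"
      have "(\<integral>\<^sup>+s. (indicator {a<..<L} (slice k s p $ k) * N (slice k s p)) * indicator {0<..<L} s \<partial>lborel)
         = (\<integral>\<^sup>+s. N p * indicator {a<..<L} s \<partial>lborel)"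
        by (rule nn_integral_cong) (use a in \<open>auto simp: Ns slice_nth indicator_def\<close>)
      also have "\<dots> = N p * ennreal (L - a)"
        using a by (simp add: nn_integral_cmult)
      finally show "(\<integral>\<^sup>+s. (indicator {a<..<L} (slice k s p $ k) * N (slice k s p)) * indicator {0<..<L} s \<partial>lborel) * indicator (cube L) p
        = ennreal (L - a) * (N p * indicator (cube L) p)" by (simp add: ac_simps)
    qed
    also have "\<dots> = ennreal (L - a) * (\<integral>\<^sup>+p. N p * indicator (cube L) p \<partial>lborel)"
      by (rule nn_integral_cmult) measurable
    also have "(\<integral>\<^sup>+p. N p * indicator (cube L) p \<partial>lborel) = ennreal L * ?J"
      unfolding N_def by (rule nn_integral_slice_indicator) (use L in auto)
    finally have "ennreal L * ?I = ennreal L * (ennreal (L - a) * ?J)" by (simp add: ac_simps)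
    then show ?thesis using L by (subst (asm) ennreal_mult_cancel_left) auto
  qed
  also have "ennreal M * (ennreal (L - a) * ?J) = ennreal (M * (L - a)) * ?J"
    using M a by (simp add: ennreal_mult' mult.assoc)
  finally show ?thesis by (simp add: f_def)
qed

text \<open>The restriction to the cube turns the set integrals of the definitions into plain ones.\<close>

definition cubeM :: "real \<Rightarrow> (real^3) measure" where
  "cubeM L = restrict_space lborel (cube L)"

lemma space_cubeM [simp]: "space (cubeM L) = cube L"
  by (simp add: cubeM_def space_restrict_space)

lemma cubeM_measurableI: "f \<in> borel_measurable borel \<Longrightarrow> f \<in> borel_measurable (cubeM L)"
  unfolding cubeM_def by (rule measurable_restrict_space1) simp

lemma integrable_cubeM:
  "integrable (cubeM L) f \<longleftrightarrow> set_integrable lborel (cube L) (f :: _ \<Rightarrow> 'b::euclidean_space)"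
  by (simp add: cubeM_def integrable_restrict_space set_integrable_def)

lemma integral_cubeM:
  "integral\<^sup>L (cubeM L) f = (LINT p:cube L|lborel. f p :: 'b::euclidean_space)"
  by (simp add: cubeM_def integral_restrict_space set_lebesgue_integral_def)

lemma nn_integral_cubeM: "integral\<^sup>N (cubeM L) f = (\<integral>\<^sup>+p. f p * indicator (cube L) p \<partial>lborel)"
  by (simp add: cubeM_def nn_integral_restrict_space)

lemma finite_measure_cubeM: "finite_measure (cubeM L)"
  by (rule finite_measureI)
    (use emeasure_cube_finite[of L] in \<open>simp add: cubeM_def space_restrict_space emeasure_restrict_space\<close>)

lemma L2_on_cube_sq_int: "L2_on_cube L f \<Longrightarrow> sq_int (cubeM L) f"
  by (simp add: L2_on_cube_def sq_int_def cubeM_measurableI integrable_cubeM)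

lemma sq_int_continuous:
  assumes "continuous_on UNIV (f :: real^3 \<Rightarrow> 'b::euclidean_space)"
  shows "sq_int (cubeM L) f" and "0 \<le> s \<Longrightarrow> s \<le> L \<Longrightarrow> sq_int (cubeM L) (\<lambda>p. f (slice k s p))"
proof -
  obtain B where B: "\<And>p. p \<in> cube L \<Longrightarrow> norm (f p) \<le> B"
    and B2: "\<And>p k s. p \<in> cube L \<Longrightarrow> 0 \<le> s \<Longrightarrow> s \<le> L \<Longrightarrow> norm (f (slice k s p)) \<le> B"
    using bounded_on_cube[OF assms] by metis
  have m[measurable]: "f \<in> borel_measurable borel" by (rule borel_measurable_continuous_onI[OF assms])
  show "sq_int (cubeM L) f"
    by (rule sq_int_bound[OF sq_int_const[OF finite_measure_cubeM, where c="1::real"] cubeM_measurableI[OF m], where K=B])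
      (use B in auto)
  show "sq_int (cubeM L) (\<lambda>p. f (slice k s p))" if "0 \<le> s" "s \<le> L"
    by (rule sq_int_bound[OF sq_int_const[OF finite_measure_cubeM, where c="1::real"] cubeM_measurableI, where K=B])
      (use B2 that in auto)
qed

text \<open>The weight is written as a square so that both sides are L2 norms of linear expressions
  in \<open>V\<close> and can follow an L2 limit. The bound \<open>K\<close> secures integrability,
  and \<open>M\<close> gives the constant.\<close>

lemma slice_poincare:
  fixes V :: "real^3 \<Rightarrow> 'b::euclidean_space"
  assumes V: "Ck 1 V" and L: "L > 0" and a: "0 \<le> a" "a \<le> L" and [measurable]: "c \<in> borel_measurable borel"
    and c: "\<And>z. z \<le> a \<Longrightarrow> c z = 0" "\<And>z. z < L \<Longrightarrow> \<bar>c z\<bar> \<le> K" "\<And>z. a < z \<Longrightarrow> z < L \<Longrightarrow> (c z)\<^sup>2 * (L - z) \<le> M" and M: "M \<ge> 0"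
  shows "(\<integral>p. (norm (c (p $ k) *\<^sub>R (V p - V (slice k L p))))\<^sup>2 \<partial>cubeM L)
    \<le> M * (L - a) * (\<integral>p. (norm ((indicator {a<..} (p $ k) :: real) *\<^sub>R partial k V p))\<^sup>2 \<partial>cubeM L)"
proof -
  have [measurable]: "partial k V \<in> borel_measurable borel" "V \<in> borel_measurable borel"
    by (auto intro!: borel_measurable_continuous_onI Ck_1_continuous_partial[OF V] Ck_1_continuous[OF V])
  have "sq_int (cubeM L) (\<lambda>p. V p - V (slice k L p))"
    using L by (intro sq_int_diff sq_int_continuous Ck_1_continuous V) auto
  then have 1: "sq_int (cubeM L) (\<lambda>p. c (p $ k) *\<^sub>R (V p - V (slice k L p)))"
    by (rule sq_int_bound[where K=K]) (use c(2) in \<open>auto intro!: cubeM_measurableI mult_right_mono simp: cube_def\<close>)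
  have 2: "sq_int (cubeM L) (\<lambda>p. (indicator {a<..} (p $ k) :: real) *\<^sub>R partial k V p)"
    by (rule sq_int_bound[where K=1, OF sq_int_continuous(1)[OF Ck_1_continuous_partial[OF V]]])
      (auto intro!: cubeM_measurableI simp: indicator_def)
  have "ennreal (\<integral>p. (norm (c (p $ k) *\<^sub>R (V p - V (slice k L p))))\<^sup>2 \<partial>cubeM L)
    = (\<integral>\<^sup>+p. ennreal ((c (p $ k))\<^sup>2 * (norm (V p - V (slice k L p)))\<^sup>2) * indicator (cube L) p \<partial>lborel)"
    by (subst nn_integral_eq_integral[symmetric, OF sq_int_integrable[OF 1]])
      (auto simp: nn_integral_cubeM power_mult_distrib)
  also have "\<dots> \<le> ennreal (M * (L - a)) * (\<integral>\<^sup>+p. indicator {a<..} (p $ k) * ennreal ((norm (partial k V p))\<^sup>2) * indicator (cube L) p \<partial>lborel)"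
    by (rule nn_integral_slice_poincare) (use assms in auto)
  also have "(\<integral>\<^sup>+p. indicator {a<..} (p $ k) * ennreal ((norm (partial k V p))\<^sup>2) * indicator (cube L) p \<partial>lborel)
    = ennreal (\<integral>p. (norm ((indicator {a<..} (p $ k) :: real) *\<^sub>R partial k V p))\<^sup>2 \<partial>cubeM L)"
    by (subst nn_integral_eq_integral[symmetric, OF sq_int_integrable[OF 2]])
      (auto simp: nn_integral_cubeM indicator_def intro!: nn_integral_cong)
  also have "ennreal (M * (L - a)) * \<dots> = ennreal (M * (L - a) * (\<integral>p. (norm ((indicator {a<..} (p $ k) :: real) *\<^sub>R partial k V p))\<^sup>2 \<partial>cubeM L))"
    using M a by (intro ennreal_mult'[symmetric]) auto
  finally show ?thesis using M a by (subst (asm) ennreal_le_iff) auto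
qed

section \<open>The background flow\<close>

definition ramp :: "real \<Rightarrow> real \<Rightarrow> real \<Rightarrow> real \<Rightarrow> real" where
  "ramp U L b z = U / b\<^sup>2 * (max 0 (z - (L - b)))\<^sup>2"

definition ramp_deriv :: "real \<Rightarrow> real \<Rightarrow> real \<Rightarrow> real \<Rightarrow> real" where
  "ramp_deriv U L b z = 2 * U / b\<^sup>2 * max 0 (z - (L - b))"

definition background :: "real \<Rightarrow> real \<Rightarrow> real \<Rightarrow> real^3 \<Rightarrow> real^3" where
  "background U L b p = axis 1 (ramp U L b (p $ 3))"

definition background_grad :: "real \<Rightarrow> real \<Rightarrow> real \<Rightarrow> real^3 \<Rightarrow> real^3^3" where
  "background_grad U L b p = axis 1 (axis 3 (ramp_deriv U L b (p $ 3)))"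

text \<open>At the kink the difference quotient is bounded by \<open>norm h\<close>. Squaring the
  positive part is what makes the profile C1.\<close>

lemma has_real_derivative_max_sq: "((\<lambda>x::real. (max 0 x)\<^sup>2) has_real_derivative 2 * max 0 x) (at x)"
proof -
  consider "x < 0" | "x > 0" | "x = 0" by linarith
  then show ?thesis
  proof cases
    case 1
    have "((\<lambda>_. 0) has_real_derivative 0) (at x)" by simp
    then have "((\<lambda>x::real. (max 0 x)\<^sup>2) has_real_derivative 0) (at x)"
      by (rule has_field_derivative_transform_within_open[of _ _ _ "{..<0}"]) (use 1 in auto)
    then show ?thesis using 1 by simp
  next
    case 2
    have "((\<lambda>x. x\<^sup>2) has_real_derivative 2 * x) (at x)" by (auto intro!: derivative_eq_intros)
    then have "((\<lambda>x::real. (max 0 x)\<^sup>2) has_real_derivative 2 * x) (at x)"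
      by (rule has_field_derivative_transform_within_open[of _ _ _ "{0<..}"]) (use 2 in auto)
    then show ?thesis using 2 by simp
  next
    case 3
    have "(\<lambda>h::real. ((max 0 h)\<^sup>2 - 0) / h) \<midarrow>0\<rightarrow> 0"
    proof (rule tendsto_0_le[OF tendsto_ident_at, where K=1], intro always_eventually allI)
      show "norm (((max 0 h)\<^sup>2 - 0) / h) \<le> norm h * 1" for h :: real
        by (cases "h > 0") (auto simp: power2_eq_square)
    qed
    then show ?thesis using 3 by (simp add: DERIV_def)
  qed
qed

lemma ramp_has_derivative: "(ramp U L b has_real_derivative ramp_deriv U L b z) (at z)"
proof -
  have "((\<lambda>z. (max 0 (z - (L - b)))\<^sup>2) has_real_derivative 2 * max 0 (z - (L - b)) * 1) (at z)"
    by (rule DERIV_chain2[OF has_real_derivative_max_sq]) (auto intro!: derivative_eq_intros)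
  from DERIV_cmult[OF this, of "U / b\<^sup>2"] show ?thesis
    unfolding ramp_def[abs_def] ramp_deriv_def by (simp add: ac_simps)
qed

lemma continuous_ramp_deriv: "continuous_on UNIV (ramp_deriv U L b)"
  unfolding ramp_deriv_def[abs_def] by (intro continuous_intros)

lemma continuous_ramp_deriv_field: "continuous_on UNIV (\<lambda>p :: real^3. ramp_deriv U L b (p $ 3))"
  by (rule continuous_on_compose2[OF continuous_ramp_deriv]) (auto intro!: continuous_intros)

lemma ramp_field_has_derivative:
  "((\<lambda>p :: real^3. ramp U L b (p $ 3)) has_derivative (\<lambda>h. ramp_deriv U L b (p $ 3) * h $ 3)) (at p)"
  by (rule has_derivative_compose[OF bounded_linear_imp_has_derivative[OF bounded_linear_vec_nth] ramp_has_derivative[unfolded has_field_derivative_def]])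

lemma ramp_Ck: "Ck 1 (\<lambda>p :: real^3. ramp U L b (p $ 3))"
  by (rule Ck_1I[OF ramp_field_has_derivative])
    (intro continuous_intros continuous_ramp_deriv_field)

lemma ramp_partial: "partial k (\<lambda>p. ramp U L b (p $ 3)) p = (if k = 3 then ramp_deriv U L b (p $ 3) else 0)"
  using partial_eqI[OF ramp_field_has_derivative] by (auto simp: axis_def)

lemma bounded_linear_axis: "bounded_linear (axis i :: 'b::euclidean_space \<Rightarrow> 'b^'n)"
  unfolding linear_conv_bounded_linear[symmetric]
  by (rule linearI) (auto simp: axis_def vec_eq_iff)

lemma background_has_derivative:
  "(background U L b has_derivative (\<lambda>h. axis 1 (ramp_deriv U L b (p $ 3) * h $ 3))) (at p)"
  using bounded_linear.has_derivative[OF bounded_linear_axis ramp_field_has_derivative]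
  by (simp add: background_def[abs_def])

lemma continuous_axis: "continuous_on S f \<Longrightarrow> continuous_on S (\<lambda>x. axis i (f x) :: ('b::euclidean_space)^'n)"
  by (rule bounded_linear.continuous_on[OF bounded_linear_axis])

lemma background_Ck: "Ck 1 (background U L b)"
  by (rule Ck_1I[OF background_has_derivative])
    (intro continuous_axis continuous_intros continuous_ramp_deriv_field)

lemma background_jacobian: "jacobian (background U L b) (at p) = background_grad U L b p"
  by (auto simp: vec_eq_iff jacobian_nth partial_eqI[OF background_has_derivative] background_grad_def axis_def)

lemma ramp_props:
  assumes "0 < b" "b \<le> L" "U > 0"
  shows "0 \<le> ramp U L b z" "z \<le> L \<Longrightarrow> ramp U L b z \<le> U" "z \<le> L - b \<Longrightarrow> ramp U L b z = 0"
    "ramp U L b L = U" "ramp U L b 0 = 0"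
    "0 \<le> ramp_deriv U L b z" "z \<le> L - b \<Longrightarrow> ramp_deriv U L b z = 0" "z \<le> L \<Longrightarrow> ramp_deriv U L b z \<le> 2 * U / b"
    "L - b < z \<Longrightarrow> z < L \<Longrightarrow> (ramp_deriv U L b z)\<^sup>2 * (L - z) \<le> U\<^sup>2 / b"
proof -
  show "0 \<le> ramp U L b z" "0 \<le> ramp_deriv U L b z"
    using assms by (simp_all add: ramp_def ramp_deriv_def)
  show "z \<le> L - b \<Longrightarrow> ramp U L b z = 0" "ramp U L b L = U" "ramp U L b 0 = 0"
    "z \<le> L - b \<Longrightarrow> ramp_deriv U L b z = 0"
    using assms by (simp_all add: ramp_def ramp_deriv_def max_def)
  show "ramp U L b z \<le> U" if "z \<le> L"
  proof -
    have "(max 0 (z - (L - b)))\<^sup>2 \<le> b\<^sup>2" using that assms by (intro power_mono) auto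
    then have "U / b\<^sup>2 * (max 0 (z - (L - b)))\<^sup>2 \<le> U / b\<^sup>2 * b\<^sup>2" using assms by (intro mult_left_mono) auto
    then show ?thesis using assms by (simp add: ramp_def)
  qed
  show "ramp_deriv U L b z \<le> 2 * U / b" if "z \<le> L"
  proof -
    have "2 * U / b\<^sup>2 * max 0 (z - (L - b)) \<le> 2 * U / b\<^sup>2 * b" using that assms by (intro mult_left_mono) auto
    then show ?thesis using assms by (simp add: ramp_deriv_def power2_eq_square)
  qed
  show "(ramp_deriv U L b z)\<^sup>2 * (L - z) \<le> U\<^sup>2 / b" if "L - b < z" "z < L"
  proof -
    define s where "s = z - (L - b)"
    have s: "0 < s" "s < b" "L - z = b - s" using that by (auto simp: s_def)
    \<comment> \<open>The squared slope times the wall distance is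
      \<open>4 * U\<^sup>2 / b ^ 4\<close> times \<open>s * s * (b - s)\<close>; the bounds
      \<open>4 * s * (b - s) \<le> b * b\<close> and \<open>s \<le> b\<close> give
      \<open>U\<^sup>2 / b\<close>.\<close>
    have "0 \<le> (2 * s - b) * (2 * s - b)" by simp
    then have k: "s * (b - s) * 4 \<le> b * b" by (simp add: algebra_simps)
    have "s * (s * (b - s) * 4) \<le> b * (b * b)"
      by (rule mult_mono) (use s k assms in \<open>simp_all\<close>)
    then have "U * U / (b * b * b * b) * (s * (s * (b - s) * 4)) \<le> U * U / (b * b * b * b) * (b * (b * b))"
      by (rule mult_left_mono) (use assms in simp)
    also have "\<dots> = U\<^sup>2 / b" using assms by (simp add: power2_eq_square)
    also have "U * U / (b * b * b * b) * (s * (s * (b - s) * 4)) = (2 * U / b\<^sup>2 * s)\<^sup>2 * (b - s)"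
      by (simp add: power2_eq_square ac_simps)
    finally have f: "(2 * U / b\<^sup>2 * s)\<^sup>2 * (b - s) \<le> U\<^sup>2 / b" .
    have "ramp_deriv U L b z = 2 * U / b\<^sup>2 * s" using s(1) by (simp add: ramp_deriv_def s_def)
    then show ?thesis using f s(3) by simp
  qed
qed

lemma ramp_measurable [measurable]: "ramp U L b \<in> borel_measurable borel" "ramp_deriv U L b \<in> borel_measurable borel"
  unfolding ramp_def[abs_def] ramp_deriv_def[abs_def] by measurable

lemma continuous_background_grad: "continuous_on UNIV (background_grad U L b)"
  using Ck_1_continuous_jacobian[OF background_Ck] by (simp add: background_jacobian)

lemma background_measurable [measurable]: "background U L b \<in> borel_measurable borel"
  "background_grad U L b \<in> borel_measurable borel"
  by (rule borel_measurable_continuous_onI[OF Ck_1_continuous[OF background_Ck]]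
    borel_measurable_continuous_onI[OF continuous_background_grad])+

lemma sq_int_L2_on_cube: "sq_int (cubeM L) f \<Longrightarrow> f \<in> borel_measurable borel \<Longrightarrow> L2_on_cube L f"
  by (simp add: L2_on_cube_def sq_int_def integrable_cubeM)

text \<open>Integration by parts in one direction, applied to the product of the profile and the
  test function.\<close>

lemma weak_gradient_background: 
  assumes "L > 0"
  shows "weak_gradient L (background U L b) (background_grad U L b)"
  unfolding weak_gradient_def
proof (intro allI impI)
  fix q :: "real^3 \<Rightarrow> real" and i k :: 3 assume q: "test_function L q"
  then have qC: "Ck 1 q" unfolding test_function_def smooth_def by blast
  from q have q0: "\<And>p. p \<notin> cube L \<Longrightarrow> q p = 0" unfolding test_function_def by blast
  let ?r = "\<lambda>p :: real^3. ramp U L b (p $ 3)"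
  let ?r' = "\<lambda>p :: real^3. if k = 3 then ramp_deriv U L b (p $ 3) else 0"
  show "(LINT p:cube L|lborel. background U L b p $ i * partial k q p) = - (LINT p:cube L|lborel. background_grad U L b p $ i $ k * q p)"
  proof (cases "i = 1")
    case True
    have r': "continuous_on UNIV ?r'"
      by (cases "k = 3") (simp_all add: continuous_ramp_deriv_field)
    have c: "continuous_on UNIV (\<lambda>p. ?r p * partial k q p)" "continuous_on UNIV (\<lambda>p. ?r' p * q p)"
      by (rule continuous_on_mult[OF Ck_1_continuous[OF ramp_Ck] Ck_1_continuous_partial[OF qC]]
        continuous_on_mult[OF r' Ck_1_continuous[OF qC]])+
    have i: "integrable (cubeM L) f" if "continuous_on UNIV f" for f :: "real^3 \<Rightarrow> real"
      using sq_int_inner[OF sq_int_continuous(1)[OF that] sq_int_continuous(1)[OF continuous_on_const[of _ "1::real"]]] by simp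
    \<comment> \<open>The faces lie outside the open cube, where the test function vanishes, so no
      boundary term survives.\<close>
    have "slice k L p \<notin> cube L" "slice k 0 p \<notin> cube L" for p
      by (auto simp: cube_def slice_nth intro!: exI[of _ k])
    then have "L * (LINT p:cube L|lborel. partial k (\<lambda>p. ?r p * q p) p) = 0"
      using cube_FTC[OF Ck_1_mult(1)[OF ramp_Ck qC] assms] by (simp add: q0)
    then have "0 = (\<integral>p. ?r p * partial k q p + ?r' p * q p \<partial>cubeM L)"
      using assms by (simp add: Ck_1_mult(2)[OF ramp_Ck qC] ramp_partial integral_cubeM)
    also have "\<dots> = (\<integral>p. ?r p * partial k q p \<partial>cubeM L) + (\<integral>p. ?r' p * q p \<partial>cubeM L)"
      by (intro Bochner_Integration.integral_add i c)
    finally show ?thesis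
      using True by (simp add: integral_cubeM background_def background_grad_def axis_def)
  next
    case False
    then show ?thesis by (simp add: background_def background_grad_def axis_def)
  qed
qed

text \<open>The flow depends on the third coordinate alone, hence is periodic in the others. The
  only nonzero entry of its gradient is off the diagonal, hence the trace vanishes.\<close>

lemma shear_class_background:
  assumes "0 < b" "b \<le> L" "U > 0"
  shows "shear_class L U (background U L b) (background_grad U L b)"
proof -
  have L: "L > 0" using assms by simp
  have "L2_on_cube L (background U L b)" "L2_on_cube L (background_grad U L b)"
    by (rule sq_int_L2_on_cube[OF sq_int_continuous(1)[OF Ck_1_continuous[OF background_Ck]]]
      sq_int_L2_on_cube[OF sq_int_continuous(1)[OF continuous_background_grad]]; measurable)+
  moreover have "has_trace L (background U L b) (background_grad U L b) (background U L b)"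
    unfolding has_trace_def
  proof (intro conjI allI ballI exI[of _ "\<lambda>_. background U L b"])
    fix i c assume "c \<in> {0, L}"
    then show "L2_on_cube L (\<lambda>p. background U L b (slice i c p))"
      using L by (intro sq_int_L2_on_cube sq_int_continuous(2)[OF Ck_1_continuous[OF background_Ck]]) auto
  qed (simp_all only: background_jacobian background_Ck, simp_all)
  moreover have "trace (background_grad U L b p) = 0" for p
    by (simp add: trace_def background_grad_def sum_3 axis_def)
  ultimately show ?thesis
    unfolding shear_class_def H1_with_gradient_def shear_bc_def
    using weak_gradient_background[OF L] ramp_props(4,5)[OF assms]
    by (auto intro!: exI[of _ "background U L b"] simp: background_def slice_nth axis_eq_0_iff)
qed

text \<open>The slope contributes \<open>4 / 3 * U\<^sup>2 / b\<close> across the layer, and the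
  cross section contributes \<open>L\<^sup>2\<close>. A linear profile would give 1 in place of 4/3;
  the excess is the price of a C1 profile.\<close>

lemma integral_ramp_deriv_sq:
  assumes "0 < b" "b \<le> L" "U > 0"
  shows "(\<integral>p. (ramp_deriv U L b (p $ 3))\<^sup>2 \<partial>cubeM L) = 4 / 3 * U\<^sup>2 * L\<^sup>2 / b"
proof -
  have L: "L > 0" using assms by simp
  let ?f = "\<lambda>z. (ramp_deriv U L b z)\<^sup>2"
  let ?F = "\<lambda>z. 4 / 3 * U\<^sup>2 / b ^ 4 * (max 0 (z - (L - b))) ^ 3"
  have 1: "((\<lambda>x::real. (max 0 x) ^ 3) has_real_derivative 3 * (max 0 x)\<^sup>2) (at x)" for x
  proof -
    \<comment> \<open>Splitting off one factor \<open>x\<close> reduces the cube to the square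
      already differentiated, including at the kink.\<close>
    have eq: "(\<lambda>x::real. (max 0 x) ^ 3) = (\<lambda>x. x * (max 0 x)\<^sup>2)"
      by (auto simp: max_def power2_eq_square power3_eq_cube)
    show ?thesis unfolding eq
      by (rule DERIV_mult[OF DERIV_ident has_real_derivative_max_sq, THEN DERIV_cong])
        (simp add: max_def power2_eq_square)
  qed
  have "((\<lambda>z. (max 0 (z - (L - b))) ^ 3) has_real_derivative 3 * (max 0 (z - (L - b)))\<^sup>2 * 1) (at z)" for z
    by (rule DERIV_chain2[OF 1]) (auto intro!: derivative_eq_intros)
  from DERIV_cmult[OF this, of "4 / 3 * U\<^sup>2 / b ^ 4"]
  have F: "(?F has_real_derivative ?f z) (at z)" for z
    by (rule DERIV_cong) (simp add: ramp_deriv_def power2_eq_square eval_nat_numeral ac_simps)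
  have "integral\<^sup>L lborel (\<lambda>x. indicator {0 .. L} x *\<^sub>R ?f x) = ?F L - ?F 0"
    by (rule integral_FTC_atLeastAtMost)
      (use L F in \<open>auto simp: has_real_derivative_iff_has_vector_derivative[symmetric] intro: has_field_derivative_at_within
        intro!: continuous_intros continuous_on_subset[OF continuous_ramp_deriv]\<close>)
  also have "\<dots> = 4 / 3 * U\<^sup>2 / b"
    using assms by (simp add: eval_nat_numeral)
  finally have I: "(LINT s:{0<..<L}|lborel. ?f s) = 4 / 3 * U\<^sup>2 / b"
    using L integral_Ioo_eq_Icc[of 0 L ?f] by (simp add: set_lebesgue_integral_def)
  have "L * (LINT p:cube L|lborel. ?f (p $ 3)) = (LINT p:cube L|lborel. LINT s:{0<..<L}|lborel. ?f (slice 3 s p $ 3))"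
    by (rule integral_slice[symmetric, where B="(2 * U / b)\<^sup>2"])
      (use L ramp_props(6,8)[OF assms] in \<open>auto intro!: power_mono simp: cube_def less_imp_le\<close>)
  also have "\<dots> = L ^ 3 * (4 / 3 * U\<^sup>2 / b)"
    using measure_cube[OF L] emeasure_cube_finite[of L] by (simp add: slice_nth I) (simp add: set_lebesgue_integral_def)
  finally have "L * (\<integral>p. ?f (p $ 3) \<partial>cubeM L) = L * (4 / 3 * U\<^sup>2 * L\<^sup>2 / b)"
    by (simp add: integral_cubeM power3_eq_cube power2_eq_square)
  then show ?thesis using L by (subst (asm) mult_left_cancel) auto
qed

section \<open>Boundary traces\<close>

lemma partial_add: "Ck 1 f \<Longrightarrow> Ck 1 g \<Longrightarrow> partial k (\<lambda>p. f p + g p) p = partial k f p + partial k g p"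
  using partial_eqI[OF has_derivative_add[OF Ck_1_has_derivative Ck_1_has_derivative]]
  by (simp add: partial_def)

lemma partial_scaleR: "Ck 1 f \<Longrightarrow> partial k (\<lambda>p. c *\<^sub>R f p) p = c *\<^sub>R partial k f p"
  using partial_eqI[OF has_derivative_scaleR_right[OF Ck_1_has_derivative]]
  by (simp add: partial_def)

lemma Ck_1_add: "Ck 1 f \<Longrightarrow> Ck 1 g \<Longrightarrow> Ck 1 (\<lambda>p. f p + g p)"
  by (rule Ck_1I[OF has_derivative_add[OF Ck_1_has_derivative Ck_1_has_derivative]])
    (simp_all only: partial_def[symmetric], intro continuous_on_add Ck_1_continuous_partial)

lemma Ck_1_scaleR: "Ck 1 f \<Longrightarrow> Ck 1 (\<lambda>p. c *\<^sub>R f p)"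
  by (rule Ck_1I[OF has_derivative_scaleR_right[OF Ck_1_has_derivative]])
    (simp_all only: partial_def[symmetric], intro continuous_intros Ck_1_continuous_partial)

text \<open>The boundary values are prescribed only on slices through points of the cube, so
  functions may be exchanged only on the space of the measure.\<close>

lemma L2_lim_cong:
  fixes f g :: "'a \<Rightarrow> 'b::euclidean_space"
  assumes "L2_lim M F f" "\<And>x. x \<in> space M \<Longrightarrow> f x = g x" "\<And>n x. x \<in> space M \<Longrightarrow> F n x = G n x"
  shows "L2_lim M G g"
proof -
  have sq: "sq_int M f \<longleftrightarrow> sq_int M g" if "\<And>x. x \<in> space M \<Longrightarrow> f x = g x" for f g :: "'a \<Rightarrow> 'b"
  proof -
    have "f \<in> borel_measurable M \<longleftrightarrow> g \<in> borel_measurable M" by (rule measurable_cong[OF that])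
    moreover have "integrable M (\<lambda>x. (norm (f x))\<^sup>2) \<longleftrightarrow> integrable M (\<lambda>x. (norm (g x))\<^sup>2)"
      by (rule Bochner_Integration.integrable_cong) (simp_all add: that)
    ultimately show ?thesis by (simp add: sq_int_def)
  qed
  have "sq_int M f \<longleftrightarrow> sq_int M g" "\<And>n. sq_int M (F n) \<longleftrightarrow> sq_int M (G n)"
    using sq[OF assms(2)] sq[OF assms(3)] by auto
  moreover have "(\<integral>x. (norm (F n x - f x))\<^sup>2 \<partial>M) = (\<integral>x. (norm (G n x - g x))\<^sup>2 \<partial>M)" for n
    using assms(2,3) by (intro Bochner_Integration.integral_cong) auto
  ultimately show ?thesis using assms(1) by (simp add: L2_lim_def)
qed

text \<open>The part of the trace condition at the upper wall; unlike \<^const>\<open>shear_class\<close> it is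
  linear, hence inherited by fluctuations.\<close>

definition upper_wall_value ::
    "real \<Rightarrow> (real^3 \<Rightarrow> real^3) \<Rightarrow> (real^3 \<Rightarrow> real^3^3) \<Rightarrow> real^3 \<Rightarrow> bool" where
  "upper_wall_value L v G d \<longleftrightarrow>
     (\<exists>V. (\<forall>n. Ck 1 (V n)) \<and> L2_lim (cubeM L) V v \<and> L2_lim (cubeM L) (\<lambda>n p. jacobian (V n) (at p)) G \<and>
        L2_lim (cubeM L) (\<lambda>n p. V n (slice 3 L p)) (\<lambda>_. d))"

lemma upper_wall_valueI:
  assumes "\<And>n. Ck 1 (V n)" "L2_lim (cubeM L) V v" "L2_lim (cubeM L) (\<lambda>n p. jacobian (V n) (at p)) G"
    "L2_lim (cubeM L) (\<lambda>n p. V n (slice 3 L p)) (\<lambda>_. d)"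
  shows "upper_wall_value L v G d"
  unfolding upper_wall_value_def by (intro exI[of _ V] conjI allI assms)

lemma upper_wall_valueE:
  assumes "upper_wall_value L v G d"
  obtains V where "\<And>n. Ck 1 (V n)" "L2_lim (cubeM L) V v" "L2_lim (cubeM L) (\<lambda>n p. jacobian (V n) (at p)) G"
    "L2_lim (cubeM L) (\<lambda>n p. V n (slice 3 L p)) (\<lambda>_. d)"
  using assms unfolding upper_wall_value_def by (elim exE conjE) (rule that, (erule spec)+)

lemma upper_wall_value_add:
  assumes v: "upper_wall_value L v G c" and w: "upper_wall_value L w H d"
  shows "upper_wall_value L (\<lambda>p. v p + w p) (\<lambda>p. G p + H p) (c + d)"
proof -
  obtain V where V: "\<And>n. Ck 1 (V n)" "L2_lim (cubeM L) V v" "L2_lim (cubeM L) (\<lambda>n p. jacobian (V n) (at p)) G"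
    "L2_lim (cubeM L) (\<lambda>n p. V n (slice 3 L p)) (\<lambda>_. c)" by (rule upper_wall_valueE[OF v]) (rule that)
  obtain W where W: "\<And>n. Ck 1 (W n)" "L2_lim (cubeM L) W w" "L2_lim (cubeM L) (\<lambda>n p. jacobian (W n) (at p)) H"
    "L2_lim (cubeM L) (\<lambda>n p. W n (slice 3 L p)) (\<lambda>_. d)" by (rule upper_wall_valueE[OF w]) (rule that)
  have "jacobian (\<lambda>p. V n p + W n p) (at p) = jacobian (V n) (at p) + jacobian (W n) (at p)" for n p
    unfolding vec_eq_iff vector_add_component jacobian_nth partial_add[OF V(1) W(1)] by (intro allI refl)
  then have "L2_lim (cubeM L) (\<lambda>n p. jacobian (\<lambda>p. V n p + W n p) (at p)) (\<lambda>p. G p + H p)"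
    using L2_lim_add[OF V(3) W(3)] by (simp only:)
  then show ?thesis
    by (intro upper_wall_valueI[of "\<lambda>n p. V n p + W n p"] Ck_1_add V(1) W(1)
      L2_lim_add[OF V(2) W(2)] L2_lim_add[OF V(4) W(4)])
qed

lemma upper_wall_value_scaleR:
  assumes v: "upper_wall_value L v G c"
  shows "upper_wall_value L (\<lambda>p. r *\<^sub>R v p) (\<lambda>p. r *\<^sub>R G p) (r *\<^sub>R c)"
proof -
  obtain V where V: "\<And>n. Ck 1 (V n)" "L2_lim (cubeM L) V v" "L2_lim (cubeM L) (\<lambda>n p. jacobian (V n) (at p)) G"
    "L2_lim (cubeM L) (\<lambda>n p. V n (slice 3 L p)) (\<lambda>_. c)" by (rule upper_wall_valueE[OF v]) (rule that)
  have "jacobian (\<lambda>p. r *\<^sub>R V n p) (at p) = r *\<^sub>R jacobian (V n) (at p)" for n p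
    unfolding vec_eq_iff vector_scaleR_component jacobian_nth partial_scaleR[OF V(1)] by (intro allI refl)
  then have "L2_lim (cubeM L) (\<lambda>n p. jacobian (\<lambda>p. r *\<^sub>R V n p) (at p)) (\<lambda>p. r *\<^sub>R G p)"
    using L2_lim_scaleR[OF V(3)] by (simp only:)
  then show ?thesis
    by (intro upper_wall_valueI[of "\<lambda>n p. r *\<^sub>R V n p"] Ck_1_scaleR V(1)
      L2_lim_scaleR[OF V(2)] L2_lim_scaleR[OF V(4)])
qed

lemma upper_wall_value_0: "upper_wall_value L (\<lambda>_. 0) (\<lambda>_. 0) 0"
proof -
  have d: "((\<lambda>_::real^3. 0::real^3) has_derivative (\<lambda>_. 0)) (at p)" for p by simp
  have "jacobian (\<lambda>_::real^3. 0::real^3) (at p) = 0" for p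
    unfolding vec_eq_iff jacobian_nth partial_eqI[OF d] by simp
  then have "L2_lim (cubeM L) (\<lambda>n p. jacobian (\<lambda>_::real^3. 0::real^3) (at p)) (\<lambda>_. 0)"
    by (simp only: L2_lim_const[OF sq_int_zero])
  then show ?thesis
    by (intro upper_wall_valueI[of "\<lambda>_ _. 0"] L2_lim_const sq_int_zero Ck_1I[OF d] continuous_on_const)
qed

lemma upper_wall_value_sum:
  assumes "\<And>i. i \<in> I \<Longrightarrow> upper_wall_value L (v i) (G i) (c i)"
  shows "upper_wall_value L (\<lambda>p. \<Sum>i\<in>I. v i p) (\<lambda>p. \<Sum>i\<in>I. G i p) (\<Sum>i\<in>I. c i)"
  using assms
  by (induction I rule: infinite_finite_induct) (simp_all add: upper_wall_value_0 upper_wall_value_add)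

lemma column_jacobian: "column k (jacobian V (at p)) = partial k V p"
  by (simp add: column_def vec_eq_iff jacobian_nth)

lemma norm_column_le: "norm (column k G) \<le> norm (G :: real^'n^'m)"
proof -
  have "norm (column k G) = L2_set (\<lambda>i. norm (G $ i $ k)) UNIV"
    by (simp add: norm_vec_def column_def)
  also have "\<dots> \<le> L2_set (\<lambda>i. norm (G $ i)) UNIV"
    by (rule L2_set_mono) (simp_all add: component_le_norm_cart)
  also have "\<dots> = norm G" by (rule norm_vec_def[symmetric])
  finally show ?thesis .
qed

lemma column_measurable: "g \<in> borel_measurable M \<Longrightarrow> (\<lambda>x. column k (g x :: real^3^3)) \<in> borel_measurable M"
proof -
  have "continuous_on UNIV (\<lambda>G :: real^3^3. column k G)"
    unfolding column_def by (intro continuous_intros)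
  then show "g \<in> borel_measurable M \<Longrightarrow> (\<lambda>x. column k (g x)) \<in> borel_measurable M"
    by (rule borel_measurable_continuous_on)
qed

text \<open>The Poincare inequality holds for the C1 approximants with their own wall values. These
  converge to \<open>d\<close>, and both sides are continuous in L2.\<close>

lemma upper_wall_poincare:
  assumes v: "upper_wall_value L v G d" and L: "L > 0" and a: "0 \<le> a" "a \<le> L" and cm: "c \<in> borel_measurable borel"
    and c: "\<And>z. z \<le> a \<Longrightarrow> c z = 0" "\<And>z. z < L \<Longrightarrow> \<bar>c z\<bar> \<le> K" "\<And>z. a < z \<Longrightarrow> z < L \<Longrightarrow> (c z)\<^sup>2 * (L - z) \<le> M" and M: "M \<ge> 0"
  shows "(\<integral>p. (norm (c (p $ 3) *\<^sub>R (v p - d)))\<^sup>2 \<partial>cubeM L)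
    \<le> M * (L - a) * (\<integral>p. (norm ((indicator {a<..} (p $ 3) :: real) *\<^sub>R column 3 (G p)))\<^sup>2 \<partial>cubeM L)"
proof -
  note [measurable] = cm
  obtain V where V: "\<And>n. Ck 1 (V n)" "L2_lim (cubeM L) V v" "L2_lim (cubeM L) (\<lambda>n p. jacobian (V n) (at p)) G"
    "L2_lim (cubeM L) (\<lambda>n p. V n (slice 3 L p)) (\<lambda>_. d)" by (rule upper_wall_valueE[OF v]) (rule that)
  have 1: "L2_lim (cubeM L) (\<lambda>n p. c (p $ 3) *\<^sub>R (V n p - V n (slice 3 L p))) (\<lambda>p. c (p $ 3) *\<^sub>R (v p - d))"
  proof (rule L2_lim_image[where K=K and h="\<lambda>p v. c (p $ 3) *\<^sub>R v", OF L2_lim_diff[OF V(2,4)]])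
    fix g :: "real^3 \<Rightarrow> real^3" assume "g \<in> borel_measurable (cubeM L)"
    moreover have "(\<lambda>p. c (p $ 3)) \<in> borel_measurable (cubeM L)" by (rule cubeM_measurableI) measurable
    ultimately show "(\<lambda>p. c (p $ 3) *\<^sub>R g p) \<in> borel_measurable (cubeM L)" by (rule borel_measurable_scaleR[rotated])
  next
    show "norm (c (p $ 3) *\<^sub>R x) \<le> K * norm x" if "p \<in> space (cubeM L)" for p and x :: "real^3"
      using mult_right_mono[OF c(2), of "p $ 3" "norm x"] that by (simp add: cube_def)
  qed (auto intro!: linearI simp: algebra_simps)
  have 2: "L2_lim (cubeM L) (\<lambda>n p. (indicator {a<..} (p $ 3) :: real) *\<^sub>R column 3 (jacobian (V n) (at p)))
      (\<lambda>p. (indicator {a<..} (p $ 3) :: real) *\<^sub>R column 3 (G p))"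
  proof (rule L2_lim_image[where K=1 and h="\<lambda>p v. (indicator {a<..} (p $ 3) :: real) *\<^sub>R column 3 v", OF V(3)])
    fix g :: "real^3 \<Rightarrow> real^3^3" assume "g \<in> borel_measurable (cubeM L)"
    then have "(\<lambda>p. column 3 (g p)) \<in> borel_measurable (cubeM L)" by (rule column_measurable)
    moreover have "(\<lambda>p. indicator {a<..} (p $ 3) :: real) \<in> borel_measurable (cubeM L)" by (rule cubeM_measurableI) measurable
    ultimately show "(\<lambda>p. (indicator {a<..} (p $ 3) :: real) *\<^sub>R column 3 (g p)) \<in> borel_measurable (cubeM L)"
      by (rule borel_measurable_scaleR[rotated])
  next
    show "norm ((indicator {a<..} (p $ 3) :: real) *\<^sub>R column 3 x) \<le> 1 * norm x" for p :: "real^3" and x :: "real^3^3"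
      using norm_column_le[of 3 x] by (auto simp: indicator_def)
  qed (auto intro!: linearI simp: vec_eq_iff column_def algebra_simps)
  show ?thesis
  proof (rule LIMSEQ_le[OF L2_lim_norm[OF 1] tendsto_mult[OF tendsto_const L2_lim_norm[OF 2]]], intro exI allI impI)
    fix n
    show "(\<integral>p. (norm (c (p $ 3) *\<^sub>R (V n p - V n (slice 3 L p))))\<^sup>2 \<partial>cubeM L)
      \<le> M * (L - a) * (\<integral>p. (norm ((indicator {a<..} (p $ 3) :: real) *\<^sub>R column 3 (jacobian (V n) (at p))))\<^sup>2 \<partial>cubeM L)"
      unfolding column_jacobian by (rule slice_poincare[OF V(1) L a cm c M])
  qed
qed

text \<open>One approximating sequence serves all faces at once. Periodicity in the first direction
  appears as the common limit \<open>h\<close> on the two opposite faces.\<close>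

lemma shear_class_trace:
  assumes "shear_class L U v G" "L > 0"
  obtains V h where "\<And>n. Ck 1 (V n)" "L2_lim (cubeM L) V v" "L2_lim (cubeM L) (\<lambda>n p. jacobian (V n) (at p)) G"
    "L2_lim (cubeM L) (\<lambda>n p. V n (slice 3 L p)) (\<lambda>_. axis 1 U)" "L2_lim (cubeM L) (\<lambda>n p. V n (slice 3 0 p)) (\<lambda>_. 0)"
    "L2_lim (cubeM L) (\<lambda>n p. V n (slice 1 L p)) h" "L2_lim (cubeM L) (\<lambda>n p. V n (slice 1 0 p)) h"
proof -
  obtain g where t: "has_trace L v G g" and g: "\<And>p. p \<in> cube L \<Longrightarrow> g (slice 1 L p) = g (slice 1 0 p)"
      "\<And>p. p \<in> cube L \<Longrightarrow> g (slice 3 0 p) = 0" "\<And>p. p \<in> cube L \<Longrightarrow> g (slice 3 L p) = axis 1 U"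
    using assms(1) by (auto simp: shear_class_def shear_bc_def)
  have vG: "L2_on_cube L v" "L2_on_cube L G"
    using assms(1) by (auto simp: shear_class_def H1_with_gradient_def)
  have g2: "L2_on_cube L (\<lambda>p. g (slice i c p))" if "c \<in> {0, L}" for i c
    using t that unfolding has_trace_def by blast
  from t[unfolded has_trace_def, THEN conjunct2] obtain V where V0:
    "(\<forall>n. Ck 1 (V n)) \<and> (\<lambda>n. LINT p:cube L|lborel. (norm (V n p - v p))\<^sup>2) \<longlonglongrightarrow> 0 \<and>
     (\<lambda>n. LINT p:cube L|lborel. (norm (jacobian (V n) (at p) - G p))\<^sup>2) \<longlonglongrightarrow> 0 \<and>
     (\<forall>i. \<forall>c\<in>{0, L}. (\<lambda>n. LINT p:cube L|lborel. (norm (V n (slice i c p) - g (slice i c p)))\<^sup>2) \<longlonglongrightarrow> 0)" ..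
  have V: "\<And>n. Ck 1 (V n)"
    "(\<lambda>n. LINT p:cube L|lborel. (norm (V n p - v p))\<^sup>2) \<longlonglongrightarrow> 0"
    "(\<lambda>n. LINT p:cube L|lborel. (norm (jacobian (V n) (at p) - G p))\<^sup>2) \<longlonglongrightarrow> 0"
    and V4: "\<And>i c. c \<in> {0, L} \<Longrightarrow> (\<lambda>n. LINT p:cube L|lborel. (norm (V n (slice i c p) - g (slice i c p)))\<^sup>2) \<longlonglongrightarrow> 0"
    using V0 by blast+
  have s: "L2_lim (cubeM L) (\<lambda>n p. V n (slice i c p)) (\<lambda>p. g (slice i c p))" if "c \<in> {0, L}" for i c
    unfolding L2_lim_def integral_cubeM
    by (intro conjI allI V4[OF that] L2_on_cube_sq_int g2[OF that] sq_int_continuous(2)[OF Ck_1_continuous[OF V(1)]])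
      (use that assms(2) in auto)
  show ?thesis
  proof (rule that)
    show "Ck 1 (V n)" for n by (rule V)
    show "L2_lim (cubeM L) V v"
      unfolding L2_lim_def integral_cubeM
      by (intro conjI allI V(2) L2_on_cube_sq_int vG sq_int_continuous(1)[OF Ck_1_continuous[OF V(1)]])
    show "L2_lim (cubeM L) (\<lambda>n p. jacobian (V n) (at p)) G"
      unfolding L2_lim_def integral_cubeM
      by (intro conjI allI V(3) L2_on_cube_sq_int vG sq_int_continuous(1)[OF Ck_1_continuous_jacobian[OF V(1)]])
    show "L2_lim (cubeM L) (\<lambda>n p. V n (slice 3 L p)) (\<lambda>_. axis 1 U)"
      by (rule L2_lim_cong[OF s[of L 3]]) (auto simp: g)
    show "L2_lim (cubeM L) (\<lambda>n p. V n (slice 3 0 p)) (\<lambda>_. 0)"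
      by (rule L2_lim_cong[OF s[of 0 3]]) (auto simp: g)
    show "L2_lim (cubeM L) (\<lambda>n p. V n (slice 1 L p)) (\<lambda>p. g (slice 1 L p))"
      by (rule s) simp
    show "L2_lim (cubeM L) (\<lambda>n p. V n (slice 1 0 p)) (\<lambda>p. g (slice 1 L p))"
      by (rule L2_lim_cong[OF s[of 0 1]]) (auto simp: g)
  qed
qed

lemma shear_class_upper_wall: "shear_class L U v G \<Longrightarrow> L > 0 \<Longrightarrow> upper_wall_value L v G (axis 1 U)"
  by (erule (1) shear_class_trace) (rule upper_wall_valueI)

lemma shear_class_sq_int:
  assumes "shear_class L U v G"
  shows "sq_int (cubeM L) v" "sq_int (cubeM L) G"
  using assms by (auto simp: shear_class_def H1_with_gradient_def L2_on_cube_sq_int)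

section \<open>Estimates for a single shear field\<close>

lemma abs_matrix_vector_nth_le: "\<bar>((G :: real^'n^'m) *v w) $ i\<bar> \<le> norm G * norm w"
proof -
  have "(G *v w) $ i = G $ i \<bullet> w" by (simp add: matrix_vector_mult_def inner_vec_def)
  also have "\<bar>\<dots>\<bar> \<le> norm (G $ i) * norm w" by (rule Cauchy_Schwarz_ineq2)
  also have "\<dots> \<le> norm G * norm w" by (intro mult_right_mono Finite_Cartesian_Product.norm_nth_le) auto
  finally show ?thesis .
qed

lemma axis_inner: "axis i (c::real) \<bullet> x = c * x $ i" "x \<bullet> axis i c = x $ i * c"
  by (simp_all add: inner_axis inner_axis' ac_simps)

lemma mat_axis_inner: "(G :: real^3^3) \<bullet> axis i (axis k c) = G $ i $ k * c"
  by (simp add: inner_axis axis_inner)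

lemma sq_int_bounded_scaleR:
  assumes "sq_int (cubeM L) f" and r: "r \<in> borel_measurable borel" and b: "\<And>p. p \<in> cube L \<Longrightarrow> \<bar>r p\<bar> \<le> K"
  shows "sq_int (cubeM L) (\<lambda>p. r p *\<^sub>R f p)"
proof (rule sq_int_bound[OF assms(1)])
  show "(\<lambda>p. r p *\<^sub>R f p) \<in> borel_measurable (cubeM L)"
    by (rule borel_measurable_scaleR[OF cubeM_measurableI[OF r] sq_int_measurable[OF assms(1)]])
  show "norm (r p *\<^sub>R f p) \<le> K * norm (f p)" if "p \<in> space (cubeM L)" for p
    using mult_right_mono[OF b, of p "norm (f p)"] that by simp
qed

lemma sq_int_const_cube: "sq_int (cubeM L) (\<lambda>_. c)"
  by (rule sq_int_const[OF finite_measure_cubeM])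

lemma integrable_cubeM_sq_int: "sq_int (cubeM L) f \<Longrightarrow> integrable (cubeM L) (\<lambda>p. f p \<bullet> c)"
  by (rule sq_int_inner[OF _ sq_int_const_cube])

lemma integral_const_cubeM: "L > 0 \<Longrightarrow> (\<integral>p. c \<partial>cubeM L) = L ^ 3 * (c::real)"
  unfolding integral_cubeM set_lebesgue_integral_def
  using measure_cube[of L] emeasure_cube_finite[of L] by simp

text \<open>The fundamental theorem between the two walls fixes the integral of the vertical
  derivative of the first component at \<open>U * L\<^sup>2\<close>; Cauchy-Schwarz over the volume
  \<open>L ^ 3\<close> does the rest. This keeps the denominator of the effective viscosity away
  from zero.\<close>

lemma shear_gradient_lower_bound:
  assumes v: "shear_class L U v G" and L: "L > 0" and U: "U > 0"
  shows "U\<^sup>2 * L \<le> (\<integral>p. (norm (G p))\<^sup>2 \<partial>cubeM L)"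
proof -
  note sG = shear_class_sq_int(2)[OF v]
  obtain V h where V: "\<And>n. Ck 1 (V n)" "L2_lim (cubeM L) V v" "L2_lim (cubeM L) (\<lambda>n p. jacobian (V n) (at p)) G"
    "L2_lim (cubeM L) (\<lambda>n p. V n (slice 3 L p)) (\<lambda>_. axis 1 U)" "L2_lim (cubeM L) (\<lambda>n p. V n (slice 3 0 p)) (\<lambda>_. 0)"
    by (rule shear_class_trace[OF v L]) (rule that)
  have "L * (\<integral>p. jacobian (V n) (at p) \<bullet> axis 1 (axis 3 1) \<partial>cubeM L)
      = (\<integral>p. (V n (slice 3 L p) - V n (slice 3 0 p)) \<bullet> axis 1 1 \<partial>cubeM L)" for n
    using cube_FTC[OF Ck_1_nth(1)[OF V(1)] L, of 3 n 1]
    by (simp add: mat_axis_inner jacobian_nth Ck_1_nth(2)[OF V(1)] axis_inner integral_cubeM)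
  moreover have "(\<lambda>n. L * (\<integral>p. jacobian (V n) (at p) \<bullet> axis 1 (axis 3 1) \<partial>cubeM L)) \<longlonglongrightarrow> L * (\<integral>p. G p \<bullet> axis 1 (axis 3 1) \<partial>cubeM L)"
    by (intro tendsto_intros L2_lim_weak[OF V(3)] sq_int_const_cube)
  moreover have "(\<lambda>n. \<integral>p. (V n (slice 3 L p) - V n (slice 3 0 p)) \<bullet> axis 1 1 \<partial>cubeM L) \<longlonglongrightarrow> (\<integral>p. (axis 1 U - 0 :: real^3) \<bullet> axis 1 1 \<partial>cubeM L)"
    by (intro L2_lim_weak[OF L2_lim_diff[OF V(4,5)]] sq_int_const_cube)
  ultimately have "L * (\<integral>p. G p \<bullet> axis 1 (axis 3 1) \<partial>cubeM L) = (\<integral>p. (axis 1 U - 0 :: real^3) \<bullet> axis 1 1 \<partial>cubeM L)"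
    by (metis (no_types, lifting) LIMSEQ_unique ext)
  also have "\<dots> = L * (U * L\<^sup>2)"
    using integral_const_cubeM[OF L, of U] by (simp add: axis_inner power2_eq_square power3_eq_cube mult.assoc)
  finally have "U * L\<^sup>2 = (\<integral>p. G p \<bullet> axis 1 (axis 3 1) \<partial>cubeM L)" using L by simp
  also have "\<dots> \<le> (\<integral>p. norm (G p) * norm (1::real) \<partial>cubeM L)"
  proof (rule integral_mono[OF integrable_cubeM_sq_int[OF sG] sq_int_norm_mult[OF sG sq_int_const_cube]])
    show "G p \<bullet> axis 1 (axis 3 1) \<le> norm (G p) * norm (1::real)" for p
      using norm_cauchy_schwarz[of "G p" "axis 1 (axis 3 1)"] by simp
  qed
  finally have "(U * L\<^sup>2)\<^sup>2 \<le> (\<integral>p. norm (G p) * norm (1::real) \<partial>cubeM L)\<^sup>2"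
    using U by (intro power_mono) auto
  also have "\<dots> \<le> (\<integral>p. (norm (G p))\<^sup>2 \<partial>cubeM L) * L ^ 3"
    using integral_norm_mult_cauchy_schwarz[OF sG sq_int_const_cube[of L "1::real"]] integral_const_cubeM[OF L, of 1] by simp
  finally have "L ^ 3 * (U\<^sup>2 * L) \<le> L ^ 3 * (\<integral>p. (norm (G p))\<^sup>2 \<partial>cubeM L)"
    by (simp add: power_mult_distrib eval_nat_numeral ac_simps)
  then show ?thesis using L by (subst (asm) mult_le_cancel_left_pos) auto
qed

lemma sq_int_ramp_matrix: "sq_int (cubeM L) (\<lambda>p. axis i (axis k (ramp U L b (p $ 3))) :: real^3^3)"
  by (intro sq_int_continuous(1) continuous_axis Ck_1_continuous[OF ramp_Ck])

text \<open>The profile is constant in the first direction, so the integrand is the first partial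
  derivative of a product whose values on opposite faces agree in the limit. This permits
  subtracting the wall velocity in the convection term.\<close>

lemma shear_periodic_orthogonality:
  assumes v: "shear_class L U v G" and b: "0 < b" "b \<le> L" and U: "U > 0"
  shows "(\<integral>p. G p \<bullet> axis 1 (axis 1 (ramp U L b (p $ 3))) \<partial>cubeM L) = 0"
proof -
  have L: "L > 0" using b by simp
  obtain V h where V: "\<And>n. Ck 1 (V n)" "L2_lim (cubeM L) V v" "L2_lim (cubeM L) (\<lambda>n p. jacobian (V n) (at p)) G"
    "L2_lim (cubeM L) (\<lambda>n p. V n (slice 1 L p)) h" "L2_lim (cubeM L) (\<lambda>n p. V n (slice 1 0 p)) h"
    by (rule shear_class_trace[OF v L]) (rule that)
  let ?r = "\<lambda>p :: real^3. ramp U L b (p $ 3)"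
  have cr: "continuous_on UNIV ?r" by (rule Ck_1_continuous[OF ramp_Ck])
  have w1: "sq_int (cubeM L) (\<lambda>p. axis 1 (axis 1 (?r p)) :: real^3^3)"
    by (rule sq_int_ramp_matrix)
  have w2: "sq_int (cubeM L) (\<lambda>p. axis 1 (?r p) :: real^3)"
    by (rule sq_int_continuous(1)[OF continuous_axis[OF cr]])
  have "L * (\<integral>p. jacobian (V n) (at p) \<bullet> axis 1 (axis 1 (?r p)) \<partial>cubeM L)
      = (\<integral>p. (V n (slice 1 L p) - V n (slice 1 0 p)) \<bullet> axis 1 (?r p) \<partial>cubeM L)" for n
  proof -
    note V1 = Ck_1_nth[OF V(1)[of n], where i=1]
    have "L * (\<integral>p. jacobian (V n) (at p) \<bullet> axis 1 (axis 1 (?r p)) \<partial>cubeM L)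
      = L * (LINT p:cube L|lborel. partial 1 (\<lambda>p. V n p $ 1 * ?r p) p)"
      by (simp add: Ck_1_mult(2)[OF V1(1) ramp_Ck] ramp_partial V1(2) mat_axis_inner jacobian_nth integral_cubeM)
    also have "\<dots> = (\<integral>p. (V n (slice 1 L p) - V n (slice 1 0 p)) \<bullet> axis 1 (?r p) \<partial>cubeM L)"
      using cube_FTC[OF Ck_1_mult(1)[OF V1(1) ramp_Ck] L, of 1]
      by (simp add: axis_inner slice_nth integral_cubeM left_diff_distrib)
    finally show ?thesis .
  qed
  moreover have "(\<lambda>n. L * (\<integral>p. jacobian (V n) (at p) \<bullet> axis 1 (axis 1 (?r p)) \<partial>cubeM L)) \<longlonglongrightarrow> L * (\<integral>p. G p \<bullet> axis 1 (axis 1 (?r p)) \<partial>cubeM L)"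
    by (intro tendsto_intros L2_lim_weak[OF V(3)] w1)
  moreover have "(\<lambda>n. \<integral>p. (V n (slice 1 L p) - V n (slice 1 0 p)) \<bullet> axis 1 (?r p) \<partial>cubeM L) \<longlonglongrightarrow> (\<integral>p. (h p - h p) \<bullet> axis 1 (?r p) \<partial>cubeM L)"
    by (intro L2_lim_weak[OF L2_lim_diff[OF V(4,5)]] w2)
  ultimately have "L * (\<integral>p. G p \<bullet> axis 1 (axis 1 (?r p)) \<partial>cubeM L) = (\<integral>p. (h p - h p) \<bullet> axis 1 (?r p) \<partial>cubeM L)"
    by (metis (no_types, lifting) LIMSEQ_unique ext)
  then show ?thesis using L by simp
qed

text \<open>No derivative is moved onto the background flow: its size \<open>U\<close> inside the
  layer and the smallness of \<open>v\<close> minus the wall velocity there suffice, so the steep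
  slope does not enter.\<close>

lemma convection_background_bound:
  assumes v: "shear_class L U v G" and b: "0 < b" "b \<le> L" and U: "U > 0"
  shows "integrable (cubeM L) (\<lambda>p. (G p *v v p) \<bullet> background U L b p)"
    and "(\<integral>p. (G p *v v p) \<bullet> background U L b p \<partial>cubeM L) \<le> U * b * (\<integral>p. (norm (G p))\<^sup>2 \<partial>cubeM L)"
proof -
  have L: "L > 0" using b by simp
  note s = shear_class_sq_int[OF v]
  note rp = ramp_props[OF b U]
  let ?r = "\<lambda>p :: real^3. ramp U L b (p $ 3)"
  let ?e = "axis 1 U :: real^3"
  let ?i = "\<lambda>p :: real^3. indicator {L - b<..} (p $ 3) :: real"
  have r_le: "0 \<le> ?r p" "?r p \<le> U * ?i p" if "p \<in> cube L" for p
    using rp(1)[of "p $ 3"] rp(2,3)[of "p $ 3"] that by (auto simp: indicator_def cube_def less_imp_le)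
  have sw: "sq_int (cubeM L) (\<lambda>p. v p - ?e)"
    by (rule sq_int_diff[OF s(1) sq_int_const_cube])
  have siw: "sq_int (cubeM L) (\<lambda>p. ?i p *\<^sub>R (v p - ?e))"
    by (rule sq_int_bounded_scaleR[OF sw, where K=1]) (auto simp: indicator_def)
  have sG1: "sq_int (cubeM L) (\<lambda>p. axis 1 (axis 1 (?r p)) :: real^3^3)"
    by (rule sq_int_ramp_matrix)
  have i1: "integrable (cubeM L) (\<lambda>p. G p \<bullet> axis 1 (axis 1 (?r p)))"
    by (rule sq_int_inner[OF s(2) sG1])
  have i2: "integrable (cubeM L) (\<lambda>p. U * (norm (G p) * norm (?i p *\<^sub>R (v p - ?e))))"
    by (intro integrable_mult_right sq_int_norm_mult s siw)
  have meas: "(\<lambda>p. (G p *v w p) $ 1 * ?r p) \<in> borel_measurable (cubeM L)" if "sq_int (cubeM L) w" for w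
  proof -
    note [measurable] = sq_int_measurable[OF s(2)] sq_int_measurable[OF that]
    have [measurable]: "?r \<in> borel_measurable (cubeM L)" by (rule cubeM_measurableI) measurable
    have "(\<lambda>p. G p $ 1) \<in> borel_measurable (cubeM L)"
      by (rule borel_measurable_continuous_on[OF _ sq_int_measurable[OF s(2)]]) (intro continuous_intros)
    then have "(\<lambda>p. (G p $ 1 \<bullet> w p) * ?r p) \<in> borel_measurable (cubeM L)" by measurable
    moreover have "(G p *v w p) $ 1 = G p $ 1 \<bullet> w p" for p
      by (simp add: matrix_vector_mult_def inner_vec_def)
    ultimately show ?thesis by simp
  qed
  have pw: "\<bar>(G p *v (v p - ?e)) $ 1 * ?r p\<bar> \<le> U * (norm (G p) * norm (?i p *\<^sub>R (v p - ?e)))" if p: "p \<in> cube L" for p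
  proof -
    have "\<bar>(G p *v (v p - ?e)) $ 1 * ?r p\<bar> = \<bar>(G p *v (v p - ?e)) $ 1\<bar> * ?r p"
      using r_le(1)[OF p] by (simp add: abs_mult)
    also have "\<dots> \<le> (norm (G p) * norm (v p - ?e)) * (U * ?i p)"
      using r_le[OF p] by (intro mult_mono abs_matrix_vector_nth_le) auto
    finally show ?thesis by (simp add: ac_simps)
  qed
  have i3: "integrable (cubeM L) (\<lambda>p. (G p *v (v p - ?e)) $ 1 * ?r p)"
    by (rule Bochner_Integration.integrable_bound[OF i2 meas[OF sw]])
      (use pw U in \<open>auto intro!: AE_I2 simp: abs_mult\<close>)
  \<comment> \<open>Splitting \<open>v\<close> into its deviation from the wall velocity and the
    wall velocity leaves \<open>U\<close> times the expression whose integral vanishes by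
    periodicity.\<close>
  have eq: "(G p *v v p) \<bullet> background U L b p = (G p *v (v p - ?e)) $ 1 * ?r p + U * (G p \<bullet> axis 1 (axis 1 (?r p)))" for p
  proof -
    have "?e $ 1 = U" "?e $ 2 = 0" "?e $ 3 = 0" by (simp_all add: axis_def)
    then show ?thesis
      unfolding background_def axis_inner mat_axis_inner
      by (simp add: matrix_vector_mult_def sum_3 algebra_simps)
  qed
  show "integrable (cubeM L) (\<lambda>p. (G p *v v p) \<bullet> background U L b p)"
    unfolding eq using i1 i3 by simp
  have "(\<integral>p. (G p *v v p) \<bullet> background U L b p \<partial>cubeM L) = (\<integral>p. (G p *v (v p - ?e)) $ 1 * ?r p \<partial>cubeM L)"
    unfolding eq using i1 i3 shear_periodic_orthogonality[OF v b U] by simp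
  also have "\<dots> \<le> (\<integral>p. U * (norm (G p) * norm (?i p *\<^sub>R (v p - ?e))) \<partial>cubeM L)"
    by (rule integral_mono[OF i3 i2]) (use pw in \<open>force dest: abs_le_D1\<close>)
  also have "\<dots> = U * (\<integral>p. norm (G p) * norm (?i p *\<^sub>R (v p - ?e)) \<partial>cubeM L)"
    by (rule integral_mult_right_zero)
  \<comment> \<open>The Poincare constant of the layer is \<open>b\<^sup>2\<close>, so the weight
    \<open>b\<close> balances the two halves and each contributes \<open>b / 2\<close>.\<close>
  also have "\<dots> \<le> U * (b / 2 * (\<integral>p. (norm (G p))\<^sup>2 \<partial>cubeM L) + 1 / (2 * b) * (\<integral>p. (norm (?i p *\<^sub>R (v p - ?e)))\<^sup>2 \<partial>cubeM L))"
    using U b by (intro mult_left_mono integral_norm_mult_young s siw) auto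
  also have "(\<integral>p. (norm (?i p *\<^sub>R (v p - ?e)))\<^sup>2 \<partial>cubeM L) \<le> b\<^sup>2 * (\<integral>p. (norm (G p))\<^sup>2 \<partial>cubeM L)"
  proof -
    \<comment> \<open>The weight is the indicator of the layer, where the wall distance is below
      \<open>b\<close>; hence \<open>M = b\<close>, and the width supplies the second factor
      \<open>b\<close>.\<close>
    have "(\<integral>p. (norm (?i p *\<^sub>R (v p - ?e)))\<^sup>2 \<partial>cubeM L)
       \<le> b * (L - (L - b)) * (\<integral>p. (norm (?i p *\<^sub>R column 3 (G p)))\<^sup>2 \<partial>cubeM L)"
      by (rule upper_wall_poincare[OF shear_class_upper_wall[OF v L] L, where K=1]) (use b in \<open>auto simp: indicator_def\<close>)
    also have "\<dots> \<le> b * (L - (L - b)) * (\<integral>p. (norm (G p))\<^sup>2 \<partial>cubeM L)"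
    proof (rule mult_left_mono)
      have le: "norm (?i p *\<^sub>R column 3 (G p)) \<le> 1 * norm (G p)" for p
        using norm_column_le[of 3 "G p"] by (auto simp: indicator_def)
      have "(\<lambda>p. ?i p *\<^sub>R column 3 (G p)) \<in> borel_measurable (cubeM L)"
        by (intro borel_measurable_scaleR column_measurable sq_int_measurable[OF s(2)] cubeM_measurableI) measurable
      then have "sq_int (cubeM L) (\<lambda>p. ?i p *\<^sub>R column 3 (G p))"
        by (rule sq_int_bound[OF s(2)]) (rule le)
      then show "(\<integral>p. (norm (?i p *\<^sub>R column 3 (G p)))\<^sup>2 \<partial>cubeM L) \<le> (\<integral>p. (norm (G p))\<^sup>2 \<partial>cubeM L)"
        using le by (intro integral_mono sq_int_integrable s) (auto intro: power_mono)
    qed (use b in auto)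
    finally show ?thesis by (simp add: power2_eq_square)
  qed
  finally have "(\<integral>p. (G p *v v p) \<bullet> background U L b p \<partial>cubeM L) \<le> U * (b / 2 * (\<integral>p. (norm (G p))\<^sup>2 \<partial>cubeM L) + 1 / (2 * b) * (b\<^sup>2 * (\<integral>p. (norm (G p))\<^sup>2 \<partial>cubeM L)))"
    using U b by (simp add: mult_left_mono divide_right_mono)
  also have "\<dots> = U * b * (\<integral>p. (norm (G p))\<^sup>2 \<partial>cubeM L)"
    using b by (simp add: power2_eq_square field_simps)
  finally show "(\<integral>p. (G p *v v p) \<bullet> background U L b p \<partial>cubeM L) \<le> U * b * (\<integral>p. (norm (G p))\<^sup>2 \<partial>cubeM L)" .
qed

section \<open>The Hardy constant\<close>

lemma hardy_primitive_measurable: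
  fixes f :: "real \<Rightarrow> real"
  assumes [measurable]: "f \<in> borel_measurable borel"
  shows "(\<lambda>x. LINT t:{0<..<x}|lborel. f t) \<in> borel_measurable borel"
proof -
  have "(\<lambda>x. LINT t|lborel. (if 0 < t \<and> t < x then f t else 0)) \<in> borel_measurable lborel"
    by (rule lborel.borel_measurable_lebesgue_integral) measurable
  moreover have "(LINT t:{0<..<x}|lborel. f t) = (LINT t|lborel. (if 0 < t \<and> t < x then f t else 0))" for x
    unfolding set_lebesgue_integral_def by (rule Bochner_Integration.integral_cong) auto
  ultimately show ?thesis by simp
qed

text \<open>Two applications of Cauchy-Schwarz. Using the plain bound three times would bound the
  Hardy integrand by a multiple of \<open>1 / x\<close>, which diverges at both ends; using the
  weighted bound once makes Tonelli applicable.\<close>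

lemma hardy_primitive_bounds:
  fixes f :: "real \<Rightarrow> real"
  assumes [measurable]: "f \<in> borel_measurable borel" and f0: "\<forall>t>0. 0 \<le> f t"
    and f2: "set_integrable lborel {0<..} (\<lambda>t. (f t)\<^sup>2)" and x: "x > 0"
  shows "0 \<le> (LINT t:{0<..<x}|lborel. f t)" (is ?nonneg)
    and "(LINT t:{0<..<x}|lborel. f t)\<^sup>2 \<le> x * (LINT t:{0<..}|lborel. (f t)\<^sup>2)" (is ?plain)
    and "ennreal ((LINT t:{0<..<x}|lborel. f t)\<^sup>2)
      \<le> ennreal (2 * x powr (1/2)) * (\<integral>\<^sup>+t. ennreal ((f t)\<^sup>2 * t powr (1/2)) * indicator {0<..<x} t \<partial>lborel)" (is ?weighted)
proof -
  define F where "F = (LINT t:{0<..<x}|lborel. f t)"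
  show ?nonneg
    unfolding set_lebesgue_integral_def by (rule integral_nonneg_AE) (auto simp: f0 indicator_def)
  have i2: "integrable lborel (\<lambda>t. indicator {0<..} t * (f t)\<^sup>2)"
    using f2 by (simp add: set_integrable_def)
  define h where "h t = indicator {0<..<x} t * f t" for t
  have h: "sq_int lborel h"
    unfolding sq_int_def
  proof
    show "integrable lborel (\<lambda>t. (norm (h t))\<^sup>2)"
      by (rule Bochner_Integration.integrable_bound[OF i2]) (auto simp: h_def indicator_def)
  qed (simp add: h_def[abs_def])
  have one: "integrable lborel (indicator {0<..<x} :: real \<Rightarrow> real)"
    by (rule integrable_real_indicator) (use x in auto)
  have ind2: "(\<lambda>t. (norm (indicator {0<..<x} t :: real))\<^sup>2) = indicator {0<..<x}"
    by (auto simp: indicator_def)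
  have j: "sq_int lborel (indicator {0<..<x} :: real \<Rightarrow> real)"
    using one by (simp add: sq_int_def ind2 del: real_norm_def)
  have "F = (\<integral>t. norm (h t) * norm (indicator {0<..<x} t :: real) \<partial>lborel)"
    unfolding F_def set_lebesgue_integral_def
    by (rule Bochner_Integration.integral_cong) (auto simp: h_def indicator_def f0)
  then have "F\<^sup>2 \<le> (\<integral>t. (norm (h t))\<^sup>2 \<partial>lborel) * (\<integral>t. (norm (indicator {0<..<x} t :: real))\<^sup>2 \<partial>lborel)"
    using integral_norm_mult_cauchy_schwarz[OF h j] by simp
  also have "(\<integral>t. (norm (indicator {0<..<x} t :: real))\<^sup>2 \<partial>lborel) = x"
    unfolding ind2 using x by simp
  also have "(\<integral>t. (norm (h t))\<^sup>2 \<partial>lborel) \<le> (LINT t:{0<..}|lborel. (f t)\<^sup>2)"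
    unfolding set_lebesgue_integral_def real_scaleR_def
    by (rule integral_mono[OF sq_int_integrable[OF h] i2]) (auto simp: h_def indicator_def)
  finally show ?plain
    using x by (simp add: F_def mult.commute)
  \<comment> \<open>The integrand is split as \<open>f t * t powr (1/4)\<close> times
    \<open>t powr (-1/4)\<close>; the square of the second factor has integral
    \<open>2 * x powr (1/2)\<close>.\<close>
  define g where "g t = indicator {0<..<x} t * (f t * t powr (1/4))" for t
  define k where "k t = indicator {0<..<x} t * t powr (-1/4)" for t :: real
  have sqr: "(t powr c)\<^sup>2 = t powr (2 * c)" if "t > 0" for t c :: real
    using that by (simp add: power2_eq_square powr_add[symmetric])
  have g2: "(g t)\<^sup>2 = indicator {0<..<x} t * ((f t)\<^sup>2 * t powr (1/2))" for t
    by (auto simp: g_def indicator_def power_mult_distrib sqr)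
  have k2: "(k t)\<^sup>2 = indicator {0<..<x} t * t powr (-1/2)" for t
    by (auto simp: k_def indicator_def sqr)
  have [measurable]: "g \<in> borel_measurable borel" "k \<in> borel_measurable borel"
    unfolding g_def[abs_def] k_def[abs_def] by measurable
  have g: "sq_int lborel g"
    unfolding sq_int_def
  proof
    show "integrable lborel (\<lambda>t. (norm (g t))\<^sup>2)"
    proof (rule Bochner_Integration.integrable_bound[OF integrable_mult_right[OF i2, of "x powr (1/2)"]])
      have "t powr (1/2) * (f t)\<^sup>2 \<le> x powr (1/2) * (f t)\<^sup>2" if "0 < t" "t < x" for t
        using that by (intro mult_right_mono powr_mono2) auto
      then show "AE t in lborel. norm ((norm (g t))\<^sup>2) \<le> norm (x powr (1/2) * (indicator {0<..} t * (f t)\<^sup>2))"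
        by (intro AE_I2) (auto simp: g2 indicator_def mult.commute)
    qed simp
  qed simp
  have "(\<integral>\<^sup>+t. ennreal (indicator {0..x} t * t powr (-1/2)) \<partial>lborel) = ennreal (x powr (-1/2 + 1) / (-1/2 + 1))"
    using nn_integral_has_integral_lebesgue[OF _ has_integral_powr_from_0[of "-1/2" x]] x by simp
  moreover have "(\<integral>\<^sup>+t. ennreal ((norm (k t))\<^sup>2) \<partial>lborel) \<le> (\<integral>\<^sup>+t. ennreal (indicator {0..x} t * t powr (-1/2)) \<partial>lborel)"
    by (rule nn_integral_mono) (auto simp: k2 indicator_def)
  ultimately have kn: "(\<integral>\<^sup>+t. ennreal ((norm (k t))\<^sup>2) \<partial>lborel) \<le> ennreal (2 * x powr (1/2))"
    by (simp add: mult.commute)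
  have ki: "integrable lborel (\<lambda>t. (norm (k t))\<^sup>2)"
    by (rule integrableI_nonneg) (use kn in \<open>auto simp: order_le_less_trans\<close>)
  then have k: "sq_int lborel k" by (simp add: sq_int_def)
  have "ennreal (\<integral>t. (norm (k t))\<^sup>2 \<partial>lborel) \<le> ennreal (2 * x powr (1/2))"
    using kn by (subst nn_integral_eq_integral[symmetric, OF ki]) auto
  then have kI: "(\<integral>t. (norm (k t))\<^sup>2 \<partial>lborel) \<le> 2 * x powr (1/2)" by (subst (asm) ennreal_le_iff) auto
  have "F = (\<integral>t. norm (g t) * norm (k t) \<partial>lborel)"
    unfolding F_def set_lebesgue_integral_def
    by (rule Bochner_Integration.integral_cong)
      (auto simp: g_def k_def indicator_def f0 abs_mult powr_add[symmetric] mult.assoc)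
  then have "F\<^sup>2 \<le> (\<integral>t. (norm (g t))\<^sup>2 \<partial>lborel) * (\<integral>t. (norm (k t))\<^sup>2 \<partial>lborel)"
    using integral_norm_mult_cauchy_schwarz[OF g k] by simp
  also have "\<dots> \<le> (\<integral>t. (norm (g t))\<^sup>2 \<partial>lborel) * (2 * x powr (1/2))"
    by (rule mult_left_mono[OF kI]) simp
  finally have "ennreal (F\<^sup>2) \<le> ennreal ((2 * x powr (1/2)) * (\<integral>t. (norm (g t))\<^sup>2 \<partial>lborel))"
    by (intro ennreal_leI) (simp add: mult.commute)
  also have "\<dots> = ennreal (2 * x powr (1/2)) * ennreal (\<integral>t. (norm (g t))\<^sup>2 \<partial>lborel)"
    by (rule ennreal_mult') simp
  also have "ennreal (\<integral>t. (norm (g t))\<^sup>2 \<partial>lborel) = (\<integral>\<^sup>+t. ennreal ((norm (g t))\<^sup>2) \<partial>lborel)"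
    by (rule nn_integral_eq_integral[OF sq_int_integrable[OF g], symmetric]) simp
  also have "\<dots> = (\<integral>\<^sup>+t. ennreal ((f t)\<^sup>2 * t powr (1/2)) * indicator {0<..<x} t \<partial>lborel)"
    by (rule nn_integral_cong) (auto simp: g2 indicator_def)
  finally show ?weighted
    by (simp only: F_def)
qed

text \<open>Supplies an admissible constant, so that \<open>C26\<close> is a least element of a
  nonempty set. The argument gives the sixth power 4; the constant 2 has sixth power 64 and is
  chosen for convenience.\<close>

lemma hardy_2_6_exists: "hardy_2_6 2"
  unfolding hardy_2_6_def
proof (intro allI impI, elim conjE)
  fix f :: "real \<Rightarrow> real"
  assume [measurable]: "f \<in> borel_measurable borel" and f0: "\<forall>t>0. 0 \<le> f t"
    and f2: "set_integrable lborel {0<..} (\<lambda>t. (f t)\<^sup>2)"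
  define F where "F x = (LINT t:{0<..<x}|lborel. f t)" for x
  define A where "A = (LINT t:{0<..}|lborel. (f t)\<^sup>2)"
  have [measurable]: "F \<in> borel_measurable borel"
    unfolding F_def[abs_def] by (rule hardy_primitive_measurable) simp
  note b = hardy_primitive_bounds[OF \<open>f \<in> _\<close> f0 f2, folded F_def A_def]
  have A: "A \<ge> 0"
    unfolding A_def set_lebesgue_integral_def by (rule integral_nonneg_AE) (auto simp: indicator_def)
  have An: "(\<integral>\<^sup>+t. ennreal ((f t)\<^sup>2) * indicator {0<..} t \<partial>lborel) = ennreal A"
  proof -
    have "(\<integral>\<^sup>+t. ennreal ((f t)\<^sup>2) * indicator {0<..} t \<partial>lborel) = (\<integral>\<^sup>+t. ennreal (indicator {0<..} t *\<^sub>R (f t)\<^sup>2) \<partial>lborel)"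
      by (rule nn_integral_cong) (auto simp: indicator_def)
    also have "\<dots> = ennreal A"
      unfolding A_def set_lebesgue_integral_def using f2
      by (intro nn_integral_eq_integral) (auto simp: set_integrable_def)
    finally show ?thesis .
  qed
  have pt: "ennreal (F x ^ 6 / x ^ 4) \<le> ennreal (2 * A\<^sup>2) *
      (\<integral>\<^sup>+t. ennreal (x powr (-3/2)) * (ennreal ((f t)\<^sup>2 * t powr (1/2)) * indicator {0<..<x} t) \<partial>lborel)" if x: "x > 0" for x
  proof -
    have e: "2 * x powr (1/2) / x\<^sup>2 = 2 * x powr (-3/2)"
    proof -
      have "x powr (-3/2 + 2) = x powr (-3/2) * x powr 2" by (rule powr_add)
      moreover have "x powr 2 = x\<^sup>2" using x by simp
      moreover have "-3/2 + 2 = (1/2 :: real)" by simp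
      ultimately have "x powr (1/2) = x powr (-3/2) * x\<^sup>2" by (simp only:)
      then show ?thesis using x by simp
    qed
    \<comment> \<open>Two of the three factors \<open>(F x)\<^sup>2\<close> take the plain bound and
      cancel two powers of \<open>x\<close>; the third takes the weighted bound.\<close>
    have "F x ^ 6 / x ^ 4 = (F x)\<^sup>2 * (F x)\<^sup>2 / x\<^sup>2 * ((F x)\<^sup>2 / x\<^sup>2)"
      by (simp add: eval_nat_numeral)
    also have "\<dots> \<le> (x * A) * (x * A) / x\<^sup>2 * ((F x)\<^sup>2 / x\<^sup>2)"
      using b(2)[OF x] x A by (intro mult_right_mono divide_right_mono mult_mono) auto
    also have "\<dots> = A\<^sup>2 * ((F x)\<^sup>2 / x\<^sup>2)"
      using x by (simp add: power2_eq_square)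
    finally have "ennreal (F x ^ 6 / x ^ 4) \<le> ennreal (A\<^sup>2 / x\<^sup>2 * (F x)\<^sup>2)"
      by (intro ennreal_leI) simp
    also have "\<dots> = ennreal (A\<^sup>2 / x\<^sup>2) * ennreal ((F x)\<^sup>2)"
      by (rule ennreal_mult') simp
    also have "\<dots> \<le> ennreal (A\<^sup>2 / x\<^sup>2) * (ennreal (2 * x powr (1/2)) * (\<integral>\<^sup>+t. ennreal ((f t)\<^sup>2 * t powr (1/2)) * indicator {0<..<x} t \<partial>lborel))"
      by (rule mult_left_mono[OF b(3)[OF x]]) simp
    also have "\<dots> = ennreal (A\<^sup>2 / x\<^sup>2 * (2 * x powr (1/2))) * (\<integral>\<^sup>+t. ennreal ((f t)\<^sup>2 * t powr (1/2)) * indicator {0<..<x} t \<partial>lborel)"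
      by (subst ennreal_mult') (auto simp: mult.assoc)
    also have "A\<^sup>2 / x\<^sup>2 * (2 * x powr (1/2)) = (2 * A\<^sup>2) * x powr (-3/2)"
    proof -
      have "A\<^sup>2 / x\<^sup>2 * (2 * x powr (1/2)) = A\<^sup>2 * (2 * x powr (1/2) / x\<^sup>2)" by simp
      then show ?thesis unfolding e by simp
    qed
    also have "ennreal ((2 * A\<^sup>2) * x powr (-3/2)) = ennreal (2 * A\<^sup>2) * ennreal (x powr (-3/2))"
      by (rule ennreal_mult') simp
    also have "ennreal (2 * A\<^sup>2) * ennreal (x powr (-3/2)) * (\<integral>\<^sup>+t. ennreal ((f t)\<^sup>2 * t powr (1/2)) * indicator {0<..<x} t \<partial>lborel)
      = ennreal (2 * A\<^sup>2) * (\<integral>\<^sup>+t. ennreal (x powr (-3/2)) * (ennreal ((f t)\<^sup>2 * t powr (1/2)) * indicator {0<..<x} t) \<partial>lborel)"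
      unfolding mult.assoc by (subst nn_integral_cmult) simp_all
    finally show ?thesis .
  qed
  have tail: "(\<integral>\<^sup>+x. ennreal (x powr (-3/2)) * indicator {t..} x \<partial>lborel) = ennreal (2 * t powr (-1/2))" if t: "t > 0" for t :: real
  proof -
    have "(\<integral>\<^sup>+x. ennreal (indicator {t..} x * x powr (-3/2)) \<partial>lborel) = ennreal (-(t powr (-3/2 + 1)) / (-3/2 + 1))"
      by (rule nn_integral_has_integral_lebesgue[OF _ has_integral_powr_to_inf]) (use t in auto)
    moreover have "(\<integral>\<^sup>+x. ennreal (indicator {t..} x * x powr (-3/2)) \<partial>lborel) = (\<integral>\<^sup>+x. ennreal (x powr (-3/2)) * indicator {t..} x \<partial>lborel)"
      by (rule nn_integral_cong) (auto simp: indicator_def)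
    ultimately show ?thesis by (simp add: mult.commute)
  qed
  \<comment> \<open>The kernel on the region \<open>0 < t < x\<close>, made jointly measurable for
    Tonelli. In the other order the inner integral is a tail of \<open>x powr (-3/2)\<close>, which
    cancels the weight \<open>t powr (1/2)\<close> up to the factor 2.\<close>
  define W where "W x t = (if 0 < t \<and> t < x then ennreal (x powr (-3/2)) * ennreal ((f t)\<^sup>2 * t powr (1/2)) else 0)" for x t
  have [measurable]: "(\<lambda>(x, t). W x t) \<in> borel_measurable (lborel \<Otimes>\<^sub>M lborel)"
    unfolding W_def by measurable
  have [measurable]: "(\<lambda>x. \<integral>\<^sup>+t. W x t \<partial>lborel) \<in> borel_measurable lborel"
    by (rule lborel.borel_measurable_nn_integral) simp
  have "(\<integral>\<^sup>+x. ennreal (F x ^ 6 / x ^ 4) * indicator {0<..} x \<partial>lborel) \<le> (\<integral>\<^sup>+x. ennreal (2 * A\<^sup>2) * (\<integral>\<^sup>+t. W x t \<partial>lborel) \<partial>lborel)"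
  proof (rule nn_integral_mono)
    fix x :: real
    show "ennreal (F x ^ 6 / x ^ 4) * indicator {0<..} x \<le> ennreal (2 * A\<^sup>2) * (\<integral>\<^sup>+t. W x t \<partial>lborel)"
    proof (cases "x > 0")
      case True
      have "(\<integral>\<^sup>+t. ennreal (x powr (-3/2)) * (ennreal ((f t)\<^sup>2 * t powr (1/2)) * indicator {0<..<x} t) \<partial>lborel) = (\<integral>\<^sup>+t. W x t \<partial>lborel)"
        by (rule nn_integral_cong) (auto simp: W_def)
      then show ?thesis using pt[OF True] True by simp
    qed simp
  qed
  also have "\<dots> = ennreal (2 * A\<^sup>2) * (\<integral>\<^sup>+x. (\<integral>\<^sup>+t. W x t \<partial>lborel) \<partial>lborel)"
    by (rule nn_integral_cmult) simp
  also have "(\<integral>\<^sup>+x. (\<integral>\<^sup>+t. W x t \<partial>lborel) \<partial>lborel) = (\<integral>\<^sup>+t. (\<integral>\<^sup>+x. W x t \<partial>lborel) \<partial>lborel)"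
    by (rule lborel_pair.Fubini'[symmetric]) measurable
  also have "\<dots> \<le> (\<integral>\<^sup>+t. 2 * (ennreal ((f t)\<^sup>2) * indicator {0<..} t) \<partial>lborel)"
  proof (rule nn_integral_mono)
    fix t :: real
    show "(\<integral>\<^sup>+x. W x t \<partial>lborel) \<le> 2 * (ennreal ((f t)\<^sup>2) * indicator {0<..} t)"
    proof (cases "t > 0")
      case True
      have "(\<integral>\<^sup>+x. W x t \<partial>lborel) \<le> (\<integral>\<^sup>+x. ennreal ((f t)\<^sup>2 * t powr (1/2)) * (ennreal (x powr (-3/2)) * indicator {t..} x) \<partial>lborel)"
        by (rule nn_integral_mono) (auto simp: W_def indicator_def mult.commute)
      also have "\<dots> = ennreal ((f t)\<^sup>2 * t powr (1/2)) * ennreal (2 * t powr (-1/2))"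
        by (subst nn_integral_cmult, simp, simp only: tail[OF True])
      also have "\<dots> = ennreal ((f t)\<^sup>2 * t powr (1/2) * (2 * t powr (-1/2)))"
        by (rule ennreal_mult'[symmetric]) simp
      also have "(f t)\<^sup>2 * t powr (1/2) * (2 * t powr (-1/2)) = 2 * (f t)\<^sup>2"
      proof -
        have "t powr (1/2) * t powr (-1/2) = 1" using True by (simp flip: powr_add)
        moreover have "(f t)\<^sup>2 * t powr (1/2) * (2 * t powr (-1/2)) = 2 * (f t)\<^sup>2 * (t powr (1/2) * t powr (-1/2))"
          by (simp only: ac_simps)
        ultimately show ?thesis by simp
      qed
      also have "ennreal (2 * (f t)\<^sup>2) = 2 * (ennreal ((f t)\<^sup>2) * indicator {0<..} t)"
        using True by (simp add: ennreal_mult')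
      finally show ?thesis .
    qed (auto simp: W_def)
  qed
  also have "\<dots> = 2 * ennreal A"
    by (subst nn_integral_cmult) (auto simp: An)
  also have "ennreal (2 * A\<^sup>2) * (2 * ennreal A) = ennreal (4 * A ^ 3)"
  proof -
    have "ennreal (2 * A\<^sup>2) * (2 * ennreal A) = ennreal (2 * A\<^sup>2) * ennreal (2 * A)"
      using A by (simp add: ennreal_mult')
    also have "\<dots> = ennreal (2 * A\<^sup>2 * (2 * A))"
      by (rule ennreal_mult'[symmetric]) (use A in simp)
    finally show ?thesis by (simp add: power2_eq_square power3_eq_cube mult.assoc)
  qed
  finally have nn: "(\<integral>\<^sup>+x. ennreal (F x ^ 6 / x ^ 4) * indicator {0<..} x \<partial>lborel) \<le> ennreal (4 * A ^ 3)"
    by (simp add: mult_left_mono)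
  have eq: "(\<integral>\<^sup>+x. ennreal (indicator {0<..} x *\<^sub>R (F x ^ 6 / x ^ 4)) \<partial>lborel) = (\<integral>\<^sup>+x. ennreal (F x ^ 6 / x ^ 4) * indicator {0<..} x \<partial>lborel)"
    by (rule nn_integral_cong) (auto simp: indicator_def)
  have i: "integrable lborel (\<lambda>x. indicator {0<..} x *\<^sub>R (F x ^ 6 / x ^ 4))"
  proof (rule integrableI_nonneg)
    show "(\<integral>\<^sup>+x. ennreal (indicator {0<..} x *\<^sub>R (F x ^ 6 / x ^ 4)) \<partial>lborel) < \<infinity>"
      unfolding eq using nn by (rule order_le_less_trans) simp
  qed (auto simp: indicator_def)
  have "ennreal (LINT x:{0<..}|lborel. F x ^ 6 / x ^ 4) \<le> ennreal (4 * A ^ 3)"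
    unfolding set_lebesgue_integral_def using nn
    by (subst nn_integral_eq_integral[symmetric, OF i]) (simp_all only: eq, auto simp: indicator_def)
  then have "(LINT x:{0<..}|lborel. F x ^ 6 / x ^ 4) \<le> 4 * A ^ 3"
    using A by (subst (asm) ennreal_le_iff) auto
  also have "\<dots> \<le> 64 * A ^ 3" using A by simp
  also have "\<dots> = (2 * sqrt A) ^ 6"
    using A by (simp add: power_mult_distrib) (simp add: eval_nat_numeral)
  finally have "root 6 (LINT x:{0<..}|lborel. F x ^ 6 / x ^ 4) \<le> root 6 ((2 * sqrt A) ^ 6)"
    by simp
  also have "\<dots> = 2 * sqrt A"
    using A by (intro real_root_power_cancel) auto
  finally show "set_integrable lborel {0<..} (\<lambda>x. (LINT t:{0<..<x}|lborel. f t) ^ 6 / x ^ 4) \<and>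
        root 6 (LINT x:{0<..}|lborel. (LINT t:{0<..<x}|lborel. f t) ^ 6 / x ^ 4)
          \<le> 2 * sqrt (LINT t:{0<..}|lborel. (f t)\<^sup>2)"
    using i by (simp add: set_integrable_def F_def A_def)
qed

text \<open>On \<open>{0<..1}\<close> the primitive of the test function is \<open>x\<close> and the
  Hardy integrand is \<open>x\<^sup>2\<close>. Positivity also provides the lower bound for the
  infimum of admissible constants.\<close>

lemma hardy_2_6_lower_bound:
  assumes "hardy_2_6 C"
  shows "C > 0" and "1 / 3 \<le> C ^ 6"
proof -
  define f where "f = (indicator {0<..<1} :: real \<Rightarrow> real)"
  have f2: "(\<lambda>t. indicator {0<..} t *\<^sub>R (f t)\<^sup>2) = indicator {0<..<1}"
    by (auto simp: f_def indicator_def)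
  have one: "integrable lborel (indicator {0<..<1} :: real \<Rightarrow> real)"
    by (rule integrable_real_indicator) auto
  have si: "set_integrable lborel {0<..} (\<lambda>t. (f t)\<^sup>2)"
    unfolding set_integrable_def f2 by (rule one)
  have A: "(LINT t:{0<..}|lborel. (f t)\<^sup>2) = 1"
    unfolding set_lebesgue_integral_def f2 by simp
  have F: "(LINT t:{0<..<x}|lborel. f t) = x" if "0 < x" "x \<le> 1" for x
  proof -
    have "(\<lambda>t. indicator {0<..<x} t *\<^sub>R f t) = indicator {0<..<x}"
      using that by (auto simp: f_def indicator_def)
    then show ?thesis using that by (simp add: set_lebesgue_integral_def)
  qed
  have h: "set_integrable lborel {0<..} (\<lambda>x. (LINT t:{0<..<x}|lborel. f t) ^ 6 / x ^ 4)"
    "root 6 (LINT x:{0<..}|lborel. (LINT t:{0<..<x}|lborel. f t) ^ 6 / x ^ 4) \<le> C"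
    using assms[unfolded hardy_2_6_def, rule_format, of f] si A by (auto simp: f_def)
  have fi: "integrable lborel (\<lambda>x::real. indicator {0..1} x *\<^sub>R x\<^sup>2)"
    using borel_integrable_atLeastAtMost'[of 0 1 "\<lambda>x::real. x\<^sup>2"] by (simp add: set_integrable_def continuous_intros)
  have "(\<integral>x. indicator {0..1} x *\<^sub>R x\<^sup>2 \<partial>lborel) = 1 ^ 3 / 3 - 0 ^ 3 / (3::real)"
  proof (rule integral_FTC_atLeastAtMost)
    show "((\<lambda>x. x ^ 3 / 3) has_vector_derivative x\<^sup>2) (at x within {0..1})" for x :: real
      unfolding has_real_derivative_iff_has_vector_derivative[symmetric]
      by (auto intro!: derivative_eq_intros)
  qed (auto intro!: continuous_intros)
  then have "1 / 3 = (\<integral>x. indicator {0..1} x *\<^sub>R (x::real)\<^sup>2 \<partial>lborel)" by simp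
  also have "\<dots> \<le> (LINT x:{0<..}|lborel. (LINT t:{0<..<x}|lborel. f t) ^ 6 / x ^ 4)"
    unfolding set_lebesgue_integral_def[of lborel "{0<..}"]
  proof (rule integral_mono[OF fi h(1)[unfolded set_integrable_def]])
    fix x :: real
    show "indicator {0..1} x *\<^sub>R x\<^sup>2 \<le> indicator {0<..} x *\<^sub>R ((LINT t:{0<..<x}|lborel. f t) ^ 6 / x ^ 4)"
      using F[of x] by (auto simp: indicator_def) (simp add: eval_nat_numeral)
  qed
  finally have "root 6 (1 / 3) \<le> root 6 (LINT x:{0<..}|lborel. (LINT t:{0<..<x}|lborel. f t) ^ 6 / x ^ 4)"
    by simp
  then have r: "root 6 (1 / 3) \<le> C" using h(2) by linarith
  have "0 < root 6 (1 / 3 :: real)" by simp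
  then show "C > 0" using r by linarith
  have "root 6 (1 / 3) ^ 6 \<le> C ^ 6" using r by (intro power_mono) auto
  then show "1 / 3 \<le> C ^ 6" by simp
qed

text \<open>\<open>C26\<close> is a genuine least element: Hardy's inequality is a family of closed conditions on the
  constant, so it passes to the infimum of the admissible constants.\<close>

lemma hardy_2_6_C26: "hardy_2_6 C26"
proof -
  let ?S = "{C. hardy_2_6 C}"
  have bdd: "bdd_below ?S" by (rule bdd_belowI[of _ 0]) (auto dest: hardy_2_6_lower_bound less_imp_le)
  have ne: "?S \<noteq> {}" using hardy_2_6_exists by auto
  define c0 where "c0 = Inf ?S"
  have inf: "hardy_2_6 c0"
    unfolding hardy_2_6_def
  proof (intro allI impI)
    fix f :: "real \<Rightarrow> real"
    assume f: "f \<in> borel_measurable borel \<and> (\<forall>t>0. 0 \<le> f t) \<and> set_integrable lborel {0<..} (\<lambda>t. (f t)\<^sup>2)"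
    let ?R = "root 6 (LINT x:{0<..}|lborel. (LINT t:{0<..<x}|lborel. f t) ^ 6 / x ^ 4)"
    let ?s = "sqrt (LINT t:{0<..}|lborel. (f t)\<^sup>2)"
    have h: "set_integrable lborel {0<..} (\<lambda>x. (LINT t:{0<..<x}|lborel. f t) ^ 6 / x ^ 4) \<and> ?R \<le> C * ?s" if "hardy_2_6 C" for C
      using that f unfolding hardy_2_6_def by blast
    have s: "?s \<ge> 0"
      unfolding set_lebesgue_integral_def real_sqrt_ge_0_iff by (rule integral_nonneg_AE) (auto simp: indicator_def)
    have "?R \<le> c0 * ?s"
    \<comment> \<open>Division by \<open>?s\<close> needs it positive. If it vanishes, any
      admissible constant, such as 2, already shows that the left side is at most 0.\<close>
    proof (cases "?s = 0")
      case True
      then show ?thesis using h[OF hardy_2_6_exists] by (simp only: mult_zero_right)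
    next
      case False
      then have "?s > 0" using s by linarith
      then have "?R / ?s \<le> C" if "hardy_2_6 C" for C
        using h[OF that] by (simp add: pos_divide_le_eq)
      then have "?R / ?s \<le> c0" unfolding c0_def using ne by (intro cInf_greatest) auto
      then show ?thesis using \<open>?s > 0\<close> by (simp add: pos_divide_le_eq)
    qed
    then show "set_integrable lborel {0<..} (\<lambda>x. (LINT t:{0<..<x}|lborel. f t) ^ 6 / x ^ 4) \<and> ?R \<le> c0 * ?s"
      using h[OF hardy_2_6_exists] by blast
  qed
  moreover have "C26 = c0"
    unfolding C26_def using inf by (rule Least_equality) (auto simp: c0_def intro: cInf_lower bdd)
  ultimately show ?thesis by simp
qed

lemma C26_bound: "1 \<le> root 3 3 * C26\<^sup>2"
proof -
  have "1 = root 3 (1 / 3 * 3)" by simp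
  also have "\<dots> \<le> root 3 (C26 ^ 6 * 3)"
    using hardy_2_6_lower_bound(2)[OF hardy_2_6_C26] by (intro real_root_le_mono) auto
  also have "\<dots> = root 3 ((C26\<^sup>2) ^ 3) * root 3 3"
    by (simp add: real_root_mult flip: power_mult)
  also have "root 3 ((C26\<^sup>2) ^ 3) = C26\<^sup>2" by (rule real_root_power_cancel) auto
  finally show ?thesis by (simp add: mult.commute)
qed

section \<open>Ensembles at a fixed time\<close>

lemma ens_mean_real: "ens_mean J (f :: nat \<Rightarrow> real) = (\<Sum>j=1..J. f j) / real J"
  by (simp add: ens_mean_def)

lemma ens_mean_mono:
  fixes f g :: "nat \<Rightarrow> real"
  shows "(\<And>j. j \<in> {1..J} \<Longrightarrow> f j \<le> g j) \<Longrightarrow> ens_mean J f \<le> ens_mean J g"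
  unfolding ens_mean_real by (intro divide_right_mono sum_mono) auto

lemma ens_mean_cong: "(\<And>j. j \<in> {1..J} \<Longrightarrow> f j = g j) \<Longrightarrow> ens_mean J f = ens_mean J g"
  by (simp add: ens_mean_def)

lemma ens_mean_nonneg:
  fixes f :: "nat \<Rightarrow> real"
  shows "(\<And>j. j \<in> {1..J} \<Longrightarrow> 0 \<le> f j) \<Longrightarrow> 0 \<le> ens_mean J f"
  unfolding ens_mean_real by (intro divide_nonneg_nonneg sum_nonneg) auto

lemma ens_mean_add: "ens_mean J (\<lambda>j. f j + g j) = ens_mean J f + ens_mean J g"
  by (simp add: ens_mean_def sum.distrib scaleR_add_right)

lemma ens_mean_cmult:
  fixes c :: real
  shows "ens_mean J (\<lambda>j. c * f j) = c * ens_mean J f"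
  by (simp add: ens_mean_real sum_distrib_left)

lemma ens_mean_const: "J \<ge> 1 \<Longrightarrow> ens_mean J (\<lambda>_. c) = c"
  by (simp add: ens_mean_def sum_constant_scaleR del: sum_constant)

lemma ens_mean_integral:
  fixes f :: "nat \<Rightarrow> 'a \<Rightarrow> real"
  assumes "\<And>j. j \<in> {1..J} \<Longrightarrow> integrable M (f j)"
  shows "integrable M (\<lambda>x. ens_mean J (\<lambda>j. f j x))"
    and "(\<integral>x. ens_mean J (\<lambda>j. f j x) \<partial>M) = ens_mean J (\<lambda>j. \<integral>x. f j x \<partial>M)"
proof -
  show "integrable M (\<lambda>x. ens_mean J (\<lambda>j. f j x))"
    unfolding ens_mean_real by (intro integrable_divide Bochner_Integration.integrable_sum assms)
  have "(\<integral>x. (\<Sum>j=1..J. f j x) \<partial>M) = (\<Sum>j=1..J. \<integral>x. f j x \<partial>M)"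
    by (rule Bochner_Integration.integral_sum) (rule assms)
  then show "(\<integral>x. ens_mean J (\<lambda>j. f j x) \<partial>M) = ens_mean J (\<lambda>j. \<integral>x. f j x \<partial>M)"
    unfolding ens_mean_real by simp
qed

lemma sq_int_ens_mean:
  "(\<And>j. j \<in> {1..J} \<Longrightarrow> sq_int M (f j)) \<Longrightarrow> sq_int M (\<lambda>x. ens_mean J (\<lambda>j. f j x))"
  unfolding ens_mean_def by (intro sq_int_scaleR sq_int_sum)

text \<open>All members share the wall value \<open>d\<close>, which equals its own mean for
  \<open>J \<ge> 1\<close> and cancels.\<close>

lemma upper_wall_value_fluctuation:
  assumes "J \<ge> 1" "\<And>i. i \<in> {1..J} \<Longrightarrow> upper_wall_value L (v i) (G i) d" "j \<in> {1..J}"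
  shows "upper_wall_value L (\<lambda>p. v j p - ens_mean J (\<lambda>i. v i p)) (\<lambda>p. G j p - ens_mean J (\<lambda>i. G i p)) 0"
proof -
  have "upper_wall_value L (\<lambda>p. v j p + (- 1 / real J) *\<^sub>R (\<Sum>i=1..J. v i p)) (\<lambda>p. G j p + (- 1 / real J) *\<^sub>R (\<Sum>i=1..J. G i p))
     (d + (- 1 / real J) *\<^sub>R (\<Sum>i=1..J. d))"
    by (intro upper_wall_value_add upper_wall_value_scaleR upper_wall_value_sum assms)
  moreover have "d + (- 1 / real J) *\<^sub>R (\<Sum>i=1..J. d) = 0"
    using assms(1) by (simp add: sum_constant_scaleR del: sum_constant)
  ultimately show ?thesis by (simp add: ens_mean_def)
qed

lemma norm_background_grad:
  "(norm (background_grad U L b p))\<^sup>2 = (ramp_deriv U L b (p $ 3))\<^sup>2"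
  unfolding background_grad_def power2_norm_eq_inner mat_axis_inner
  by (simp add: axis_def power2_eq_square)

lemma weighted_inner_young:
  assumes "(0::real) \<le> w"
  shows "\<bar>w * (a \<bullet> b)\<bar> \<le> 1/2 * (w * (norm a)\<^sup>2) + 1/2 * (w * (norm b)\<^sup>2)"
proof -
  have "\<bar>a \<bullet> b\<bar> \<le> norm a * norm b" by (rule Cauchy_Schwarz_ineq2)
  also have "\<dots> \<le> 1/2 * (norm a)\<^sup>2 + 1/2 * (norm b)\<^sup>2" using young_norm[of 1 a b] by simp
  finally have "w * \<bar>a \<bullet> b\<bar> \<le> w * (1/2 * (norm a)\<^sup>2 + 1/2 * (norm b)\<^sup>2)"
    using assms by (rule mult_left_mono)
  then show ?thesis using assms by (simp add: abs_mult algebra_simps)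
qed

text \<open>The eddy viscosity couples the members: it is an ensemble mean of squared fluctuations,
  so the eddy energy of the background flow is a mean of weighted L2 norms of fluctuations. Each of
  these obeys the Poincare inequality with zero wall value.\<close>

lemma ensemble_instant_bound:
  fixes v :: "nat \<Rightarrow> real^3 \<Rightarrow> real^3" and G :: "nat \<Rightarrow> real^3 \<Rightarrow> real^3^3" and N :: "real^3 \<Rightarrow> real"
  assumes J: "J \<ge> 1" and b: "0 < b" "b \<le> L" and U: "U > 0" and \<nu>: "\<nu> > 0" and \<kappa>: "\<kappa> \<ge> 0"
    and sc: "\<And>j. j \<in> {1..J} \<Longrightarrow> shear_class L U (v j) (G j)"
    and N: "\<And>p. N p = \<kappa> * ens_mean J (\<lambda>j. (norm (v j p - ens_mean J (\<lambda>i. v i p)))\<^sup>2)"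
    and int: "\<And>j. j \<in> {1..J} \<Longrightarrow> integrable (cubeM L) (\<lambda>p. N p * (norm (G j p))\<^sup>2)"
  shows "ens_mean J (\<lambda>j. (\<integral>p. (\<nu> + N p) * (G j p \<bullet> background_grad U L b p) \<partial>cubeM L)
        + (\<integral>p. (G j p *v v j p) \<bullet> background U L b p \<partial>cubeM L))
    \<le> ens_mean J (\<lambda>j. 1/2 * (\<integral>p. (\<nu> + N p) * (norm (G j p))\<^sup>2 \<partial>cubeM L) + U * b * (\<integral>p. (norm (G j p))\<^sup>2 \<partial>cubeM L))
      + 2/3 * \<nu> * U\<^sup>2 * L\<^sup>2 / b
      + 1/2 * \<kappa> * U\<^sup>2 * (\<integral>p. indicator {L - b<..} (p $ 3) * ens_mean J (\<lambda>j. (norm (column 3 (G j p - ens_mean J (\<lambda>i. G i p))))\<^sup>2) \<partial>cubeM L)"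
proof -
  have L: "L > 0" using b by simp
  let ?D = "background_grad U L b"
  let ?r = "\<lambda>p :: real^3. ramp_deriv U L b (p $ 3)"
  let ?i = "\<lambda>p :: real^3. indicator {L - b<..} (p $ 3) :: real"
  define v' where "v' j p = v j p - ens_mean J (\<lambda>i. v i p)" for j p
  define G' where "G' j p = G j p - ens_mean J (\<lambda>i. G i p)" for j p
  note rp = ramp_props[OF b U]
  note s = shear_class_sq_int[OF sc]
  have sv': "sq_int (cubeM L) (v' j)" and sG': "sq_int (cubeM L) (G' j)" if "j \<in> {1..J}" for j
    unfolding v'_def[abs_def] G'_def[abs_def] using that by (auto intro!: sq_int_diff sq_int_ens_mean s)
  have N': "N p = \<kappa> * ens_mean J (\<lambda>j. (norm (v' j p))\<^sup>2)" for p
    by (simp add: N v'_def)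
  have N0: "0 \<le> N p" for p
    unfolding N' by (intro mult_nonneg_nonneg \<kappa> ens_mean_nonneg) auto
  have r_bd: "\<bar>?r p\<bar> \<le> 2 * U / b" if "p \<in> cube L" for p
    using rp(6)[of "p $ 3"] rp(8)[of "p $ 3"] that by (simp add: cube_def less_imp_le)
  have srv: "sq_int (cubeM L) (\<lambda>p. ?r p *\<^sub>R v' j p)" if "j \<in> {1..J}" for j
    by (rule sq_int_bounded_scaleR[OF sv'[OF that] _ r_bd]) measurable
  have sr: "sq_int (cubeM L) ?r"
    by (rule sq_int_continuous(1)[OF continuous_ramp_deriv_field])
  have siG: "sq_int (cubeM L) (\<lambda>p. ?i p *\<^sub>R column 3 (G' j p))" if "j \<in> {1..J}" for j
  proof (rule sq_int_bounded_scaleR[where K=1])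
    show "sq_int (cubeM L) (\<lambda>p. column 3 (G' j p))"
      by (rule sq_int_bound[OF sG'[OF that] column_measurable[OF sq_int_measurable[OF sG'[OF that]]], where K=1])
        (simp add: norm_column_le)
  qed (auto simp: indicator_def)
  have Nr: "N p * (?r p)\<^sup>2 = \<kappa> * ens_mean J (\<lambda>j. (norm (?r p *\<^sub>R v' j p))\<^sup>2)" for p
  proof -
    have "ens_mean J (\<lambda>j. (norm (?r p *\<^sub>R v' j p))\<^sup>2) = ens_mean J (\<lambda>j. (?r p)\<^sup>2 * (norm (v' j p))\<^sup>2)"
      by (simp add: power_mult_distrib)
    then show ?thesis by (simp add: N' ens_mean_cmult)
  qed
  have iNr: "integrable (cubeM L) (\<lambda>p. N p * (?r p)\<^sup>2)"
    unfolding Nr by (intro integrable_mult_right ens_mean_integral sq_int_integrable srv)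
  have INr: "(\<integral>p. N p * (?r p)\<^sup>2 \<partial>cubeM L) \<le> \<kappa> * U\<^sup>2 * (\<integral>p. ?i p * ens_mean J (\<lambda>j. (norm (column 3 (G' j p)))\<^sup>2) \<partial>cubeM L)"
  proof -
    have "(\<integral>p. N p * (?r p)\<^sup>2 \<partial>cubeM L) = \<kappa> * ens_mean J (\<lambda>j. \<integral>p. (norm (?r p *\<^sub>R v' j p))\<^sup>2 \<partial>cubeM L)"
      unfolding Nr by (subst ens_mean_integral(2)[symmetric]) (rule sq_int_integrable[OF srv], assumption, rule integral_mult_right_zero)
    also have "\<dots> \<le> \<kappa> * ens_mean J (\<lambda>j. U\<^sup>2 * (\<integral>p. (norm (?i p *\<^sub>R column 3 (G' j p)))\<^sup>2 \<partial>cubeM L))"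
    proof (intro mult_left_mono \<kappa> ens_mean_mono)
      fix j assume j: "j \<in> {1..J}"
      have w: "upper_wall_value L (v' j) (G' j) 0"
        unfolding v'_def[abs_def] G'_def[abs_def]
        by (rule upper_wall_value_fluctuation[OF J shear_class_upper_wall[OF sc L] j])
      \<comment> \<open>Here the weight is the slope of the profile, with
        \<open>M = U\<^sup>2 / b\<close>; the layer width \<open>b\<close> cancels the
        denominator.\<close>
      have "(\<integral>p. (norm (?r p *\<^sub>R (v' j p - 0)))\<^sup>2 \<partial>cubeM L)
        \<le> U\<^sup>2 / b * (L - (L - b)) * (\<integral>p. (norm (?i p *\<^sub>R column 3 (G' j p)))\<^sup>2 \<partial>cubeM L)"
        by (rule upper_wall_poincare[OF w L, where K="2 * U / b"])
          (use b rp(6,7,8,9) in auto)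
      then show "(\<integral>p. (norm (?r p *\<^sub>R v' j p))\<^sup>2 \<partial>cubeM L) \<le> U\<^sup>2 * (\<integral>p. (norm (?i p *\<^sub>R column 3 (G' j p)))\<^sup>2 \<partial>cubeM L)"
        using b by simp
    qed
    also have "\<dots> = \<kappa> * U\<^sup>2 * (\<integral>p. ens_mean J (\<lambda>j. (norm (?i p *\<^sub>R column 3 (G' j p)))\<^sup>2) \<partial>cubeM L)"
      by (subst ens_mean_integral(2), rule sq_int_integrable[OF siG], assumption) (simp only: ens_mean_cmult mult.assoc)
    also have "(\<lambda>p. ens_mean J (\<lambda>j. (norm (?i p *\<^sub>R column 3 (G' j p)))\<^sup>2)) = (\<lambda>p. ?i p * ens_mean J (\<lambda>j. (norm (column 3 (G' j p)))\<^sup>2))"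
      by (auto simp: indicator_def ens_mean_real)
    finally show ?thesis .
  qed
  have Ir: "(\<integral>p. (?r p)\<^sup>2 \<partial>cubeM L) = 4 / 3 * U\<^sup>2 * L\<^sup>2 / b" by (rule integral_ramp_deriv_sq[OF b U])
  have ir2: "integrable (cubeM L) (\<lambda>p. (?r p)\<^sup>2)" using sq_int_integrable[OF sr] by simp
  \<comment> \<open>An upper bound for half the viscous and eddy viscous energy of the background
    flow; it is the same for all members.\<close>
  define K where "K = 2/3 * \<nu> * U\<^sup>2 * L\<^sup>2 / b
      + 1/2 * \<kappa> * U\<^sup>2 * (\<integral>p. ?i p * ens_mean J (\<lambda>j. (norm (column 3 (G' j p)))\<^sup>2) \<partial>cubeM L)"
  have each: "(\<integral>p. (\<nu> + N p) * (G j p \<bullet> ?D p) \<partial>cubeM L) \<le> 1/2 * (\<integral>p. (\<nu> + N p) * (norm (G j p))\<^sup>2 \<partial>cubeM L) + K"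
    if j: "j \<in> {1..J}" for j
  proof -
    have iG: "integrable (cubeM L) (\<lambda>p. (\<nu> + N p) * (norm (G j p))\<^sup>2)"
      using int[OF j] sq_int_integrable[OF s(2)[OF j]] by (simp add: distrib_right)
    have iD: "integrable (cubeM L) (\<lambda>p. (\<nu> + N p) * (norm (?D p))\<^sup>2)"
      unfolding norm_background_grad using iNr ir2 by (simp add: distrib_right)
    have nD: "(\<integral>p. (\<nu> + N p) * (norm (?D p))\<^sup>2 \<partial>cubeM L) \<le> 2 * K"
      unfolding norm_background_grad using iNr ir2 INr Ir
      by (simp add: distrib_right K_def)
    have nn: "0 \<le> K"
    proof -
      have "0 \<le> (\<integral>p. (\<nu> + N p) * (norm (?D p))\<^sup>2 \<partial>cubeM L)"
        using N0 \<nu> by (intro Bochner_Integration.integral_nonneg mult_nonneg_nonneg) (auto intro: add_nonneg_nonneg)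
      then show ?thesis using nD by linarith
    qed
    show ?thesis
    \<comment> \<open>Without integrability the integral on the left is \<open>0\<close> by default,
      and the right side is nonnegative.\<close>
    proof (cases "integrable (cubeM L) (\<lambda>p. (\<nu> + N p) * (G j p \<bullet> ?D p))")
      case True
      have "(\<integral>p. (\<nu> + N p) * (G j p \<bullet> ?D p) \<partial>cubeM L)
        \<le> (\<integral>p. 1/2 * ((\<nu> + N p) * (norm (G j p))\<^sup>2) + 1/2 * ((\<nu> + N p) * (norm (?D p))\<^sup>2) \<partial>cubeM L)"
      proof (rule integral_mono[OF True])
        show "(\<nu> + N p) * (G j p \<bullet> ?D p) \<le> 1/2 * ((\<nu> + N p) * (norm (G j p))\<^sup>2) + 1/2 * ((\<nu> + N p) * (norm (?D p))\<^sup>2)" for p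
          using weighted_inner_young[of "\<nu> + N p" "G j p" "?D p"] N0[of p] \<nu> by linarith
      qed (intro Bochner_Integration.integrable_add integrable_mult_right iG iD)
      also have "\<dots> = 1/2 * (\<integral>p. (\<nu> + N p) * (norm (G j p))\<^sup>2 \<partial>cubeM L) + 1/2 * (\<integral>p. (\<nu> + N p) * (norm (?D p))\<^sup>2 \<partial>cubeM L)"
        using iG iD by simp
      finally show ?thesis using nD by linarith
    next
      case False
      have "0 \<le> (\<integral>p. (\<nu> + N p) * (norm (G j p))\<^sup>2 \<partial>cubeM L)"
        using N0 \<nu> by (intro Bochner_Integration.integral_nonneg mult_nonneg_nonneg) (auto intro: add_nonneg_nonneg)
      then show ?thesis using False nn by (simp add: not_integrable_integral_eq)
    qed
  qed
  have "ens_mean J (\<lambda>j. (\<integral>p. (\<nu> + N p) * (G j p \<bullet> ?D p) \<partial>cubeM L)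
        + (\<integral>p. (G j p *v v j p) \<bullet> background U L b p \<partial>cubeM L))
    \<le> ens_mean J (\<lambda>j. (1/2 * (\<integral>p. (\<nu> + N p) * (norm (G j p))\<^sup>2 \<partial>cubeM L) + U * b * (\<integral>p. (norm (G j p))\<^sup>2 \<partial>cubeM L)) + K)"
  proof (rule ens_mean_mono)
    fix j assume j: "j \<in> {1..J}"
    show "(\<integral>p. (\<nu> + N p) * (G j p \<bullet> ?D p) \<partial>cubeM L) + (\<integral>p. (G j p *v v j p) \<bullet> background U L b p \<partial>cubeM L)
      \<le> (1/2 * (\<integral>p. (\<nu> + N p) * (norm (G j p))\<^sup>2 \<partial>cubeM L) + U * b * (\<integral>p. (norm (G j p))\<^sup>2 \<partial>cubeM L)) + K"
      using each[OF j] convection_background_bound(2)[OF sc[OF j] b U] by linarith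
  qed
  also have "\<dots> = ens_mean J (\<lambda>j. 1/2 * (\<integral>p. (\<nu> + N p) * (norm (G j p))\<^sup>2 \<partial>cubeM L) + U * b * (\<integral>p. (norm (G j p))\<^sup>2 \<partial>cubeM L)) + K"
    by (subst ens_mean_add) (simp add: ens_mean_const[OF J])
  finally show ?thesis by (simp add: K_def G'_def)
qed

section \<open>Time averages\<close>

definition timeM :: "real \<Rightarrow> real measure" where
  "timeM T = restrict_space lborel {0..T}"

definition prodM :: "real \<Rightarrow> real \<Rightarrow> (real \<times> (real^3)) measure" where
  "prodM T L = restrict_space lborel ({0..T} \<times> cube L)"

lemma box_measurable: "{0..T :: real} \<times> cube L \<in> sets borel"
proof -
  have "{0..T :: real} \<times> cube L \<in> sets (borel \<Otimes>\<^sub>M borel)" by simp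
  then show ?thesis by (simp only: borel_prod)
qed

lemma integrable_timeM: "integrable (timeM T) f \<longleftrightarrow> set_integrable lborel {0..T} (f :: _ \<Rightarrow> real)"
  by (simp add: timeM_def integrable_restrict_space set_integrable_def)

lemma integral_timeM: "integral\<^sup>L (timeM T) f = (LINT t:{0..T}|lborel. f t :: real)"
  by (simp add: timeM_def integral_restrict_space set_lebesgue_integral_def)

lemma AE_timeM: "(AE t in timeM T. P t) \<longleftrightarrow> (AE t in lborel. t \<in> {0..T} \<longrightarrow> P t)"
  unfolding timeM_def by (subst AE_restrict_space_iff) auto

text \<open>The boundary conditions are imposed only at positive times; the initial instant is
  null.\<close>

lemma AE_timeM_pos:
  assumes "AE t in lborel. 0 < t \<longrightarrow> P t"
  shows "AE t in timeM T. P t"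
  unfolding AE_timeM using assms AE_lborel_singleton[of 0] by eventually_elim auto

lemma integral_timeM_const: "T > 0 \<Longrightarrow> (\<integral>t. c \<partial>timeM T) = T * (c :: real)"
  unfolding integral_timeM set_lebesgue_integral_def by simp

lemma integrable_timeM_const: "integrable (timeM T) (\<lambda>_. c :: real)"
  unfolding integrable_timeM using emeasure_lborel_cbox_finite[of 0 T] by (intro set_integrable_const) auto

lemma integrable_prodM:
  "integrable (prodM T L) f \<longleftrightarrow> set_integrable lborel ({0..T} \<times> cube L) (f :: _ \<Rightarrow> real)"
  by (simp add: prodM_def integrable_restrict_space set_integrable_def box_measurable)

lemma space_prodM [simp]: "space (prodM T L) = {0..T} \<times> cube L"
  by (simp add: prodM_def space_restrict_space)

lemma prodM_measurableI: "f \<in> borel_measurable borel \<Longrightarrow> f \<in> borel_measurable (prodM T L)"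
  unfolding prodM_def by (rule measurable_restrict_space1) simp

lemma integrable_prodM_section:
  fixes f :: "real \<Rightarrow> real^3 \<Rightarrow> real"
  assumes "integrable (prodM T L) (\<lambda>(t, p). f t p)"
  shows "integrable (timeM T) (\<lambda>t. \<integral>p. f t p \<partial>cubeM L)"
    and "AE t in timeM T. integrable (cubeM L) (f t)"
proof -
  define g where "g = (\<lambda>(t, p). indicator {0..T} t * (indicator (cube L) p * f t p))"
  have eq: "g = (\<lambda>x. indicator ({0..T} \<times> cube L) x *\<^sub>R (case x of (t, p) \<Rightarrow> f t p))"
    by (auto simp: g_def indicator_def)
  have "integrable (lborel \<Otimes>\<^sub>M lborel) g"
    using assms unfolding integrable_prodM set_integrable_def lborel_prod eq .
  then have 1: "integrable lborel (\<lambda>t. \<integral>p. g (t, p) \<partial>lborel)" and 2: "AE t in lborel. integrable lborel (\<lambda>p. g (t, p))"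
    by (auto intro: lborel_pair.integrable_fst' lborel_pair.AE_integrable_fst')
  have "(\<integral>p. g (t, p) \<partial>lborel) = indicator {0..T} t * (\<integral>p. f t p \<partial>cubeM L)" for t
    by (simp add: g_def integral_cubeM set_lebesgue_integral_def)
  with 1 show "integrable (timeM T) (\<lambda>t. \<integral>p. f t p \<partial>cubeM L)"
    by (simp add: integrable_timeM set_integrable_def)
  from 2 show "AE t in timeM T. integrable (cubeM L) (f t)"
    unfolding AE_timeM
    by eventually_elim (auto simp: g_def integrable_cubeM set_integrable_def)
qed

text \<open>Tonelli: a bound \<open>C\<close> on the spatial integrals that is uniform in time
  bounds the space-time integral by \<open>C * T\<close>.\<close>

lemma integrable_prodM_nonneg:
  fixes f :: "real \<Rightarrow> real^3 \<Rightarrow> real"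
  assumes m: "(\<lambda>(t, p). f t p) \<in> borel_measurable borel" and nn: "\<And>t p. 0 \<le> f t p"
    and i: "\<And>t. t \<in> {0..T} \<Longrightarrow> integrable (cubeM L) (f t)"
    and C: "\<And>t. t \<in> {0..T} \<Longrightarrow> (\<integral>p. f t p \<partial>cubeM L) \<le> C" and T: "T \<ge> 0"
  shows "integrable (prodM T L) (\<lambda>(t, p). f t p)"
proof -
  define g where "g = (\<lambda>(t, p). indicator {0..T} t * (indicator (cube L) p * f t p))"
  have eq: "g = (\<lambda>x. indicator ({0..T} \<times> cube L) x *\<^sub>R (case x of (t, p) \<Rightarrow> f t p))"
    by (auto simp: g_def indicator_def)
  have mg: "g \<in> borel_measurable borel"
    unfolding eq using m box_measurable[of T L] by measurable
  then have mg': "g \<in> borel_measurable (lborel \<Otimes>\<^sub>M lborel)" by (simp add: lborel_prod)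
  have C0: "C \<ge> 0"
  proof -
    have "0 \<le> (\<integral>p. f 0 p \<partial>cubeM L)" using nn by simp
    then show ?thesis using C[of 0] T by simp
  qed
  have "(\<integral>\<^sup>+x. ennreal (g x) \<partial>(lborel \<Otimes>\<^sub>M lborel)) = (\<integral>\<^sup>+t. (\<integral>\<^sup>+p. ennreal (g (t, p)) \<partial>lborel) \<partial>lborel)"
    by (rule lborel.nn_integral_fst[symmetric]) (use mg' in simp)
  also have "\<dots> \<le> (\<integral>\<^sup>+t. ennreal C * indicator {0..T} t \<partial>lborel)"
  proof (rule nn_integral_mono)
    fix t :: real
    show "(\<integral>\<^sup>+p. ennreal (g (t, p)) \<partial>lborel) \<le> ennreal C * indicator {0..T} t"
    proof (cases "t \<in> {0..T}")
      case True
      have "(\<integral>\<^sup>+p. ennreal (g (t, p)) \<partial>lborel) = (\<integral>\<^sup>+p. ennreal (f t p) \<partial>cubeM L)"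
        unfolding nn_integral_cubeM using True by (intro nn_integral_cong) (auto simp: g_def indicator_def)
      also have "\<dots> = ennreal (\<integral>p. f t p \<partial>cubeM L)"
        by (rule nn_integral_eq_integral[OF i[OF True]]) (simp add: nn)
      also have "\<dots> \<le> ennreal C" by (rule ennreal_leI[OF C[OF True]])
      finally show ?thesis using True by simp
    qed (simp add: g_def)
  qed
  also have "\<dots> = ennreal C * ennreal T" using T by (simp add: nn_integral_cmult_indicator)
  also have "\<dots> < \<infinity>" by (simp add: ennreal_mult_less_top)
  finally have "integrable (lborel \<Otimes>\<^sub>M lborel) g"
    by (intro integrableI_nonneg[OF mg']) (auto simp: g_def nn indicator_def)
  then show ?thesis
    unfolding integrable_prodM set_integrable_def lborel_prod eq .
qed

section \<open>Space-time integrability and the energy inequality\<close>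

lemma sq_int_prodM_norm_sq: "sq_int M (\<lambda>(t, p). f t p) \<Longrightarrow> integrable M (\<lambda>(t, p). (norm (f t p))\<^sup>2)"
  by (auto dest: sq_int_integrable simp: case_prod_beta')

lemma weak_solution_sq_int:
  assumes w: "weak_solution \<nu> \<nu>T L U v G v0" and T: "T > 0"
  shows "sq_int (prodM T L) (\<lambda>(t, p). v t p)" and "sq_int (prodM T L) (\<lambda>(t, p). G t p)"
proof -
  have mv: "(\<lambda>(t, p). v t p) \<in> borel_measurable borel" and mG: "(\<lambda>(t, p). G t p) \<in> borel_measurable borel"
    and L2: "\<And>t. t \<ge> 0 \<Longrightarrow> L2_on_cube L (v t)"
    and bd: "\<exists>C. \<forall>t\<in>{0..T}. (LINT p:cube L|lborel. (norm (v t p))\<^sup>2) \<le> C"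
    and iG: "set_integrable lborel ({0..T} \<times> cube L) (\<lambda>(t, p). (norm (G t p))\<^sup>2)"
    using w T unfolding weak_solution_def by blast+
  from bd obtain C where C: "\<And>t. t \<in> {0..T} \<Longrightarrow> (LINT p:cube L|lborel. (norm (v t p))\<^sup>2) \<le> C" by blast
  have "(\<lambda>x. (norm (case x of (t, p) \<Rightarrow> v t p))\<^sup>2) \<in> borel_measurable borel" using mv by measurable
  then have "integrable (prodM T L) (\<lambda>(t, p). (norm (v t p))\<^sup>2)"
    using T C L2
    by (intro integrable_prodM_nonneg[where C=C]) (auto simp: case_prod_beta' integral_cubeM intro!: sq_int_integrable L2_on_cube_sq_int)
  then show "sq_int (prodM T L) (\<lambda>(t, p). v t p)"
    using prodM_measurableI[OF mv] by (simp add: sq_int_def case_prod_beta')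
  show "sq_int (prodM T L) (\<lambda>(t, p). G t p)"
    using prodM_measurableI[OF mG] iG by (simp add: sq_int_def case_prod_beta' integrable_prodM)
qed

lemma integrable_prodM_bound:
  fixes f g :: "real \<times> (real^3) \<Rightarrow> real"
  assumes "integrable (prodM T L) f" "g \<in> borel_measurable (prodM T L)"
    and "\<And>t p. t \<in> {0..T} \<Longrightarrow> p \<in> cube L \<Longrightarrow> \<bar>g (t, p)\<bar> \<le> f (t, p)"
  shows "integrable (prodM T L) g"
  by (rule Bochner_Integration.integrable_bound[OF assms(1,2)])
    (use assms(3) in \<open>auto intro!: AE_I2 intro: order_trans[OF _ abs_ge_self]\<close>)

text \<open>Discharges the integrability premises of the energy inequality for the background flow
  and removes the energy at the final time. The terms left over from the time derivative do not
  depend on \<open>T\<close>, hence vanish in the time average.\<close>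

lemma energy_background_bound:
  fixes \<nu>T :: "real \<Rightarrow> real^3 \<Rightarrow> real"
  assumes w: "weak_solution \<nu> \<nu>T L U v G v0" and en: "energy_inequality \<nu> \<nu>T L U v G v0"
    and v0: "L2_on_cube L v0"
    and iN: "integrable (prodM T L) (\<lambda>(t, p). \<nu>T t p)" and N0: "\<And>t p. 0 \<le> \<nu>T t p"
    and T: "T > 0" and b: "0 < b" "b \<le> L" and U: "U > 0" and \<nu>: "\<nu> > 0"
  shows "integrable (timeM T) (\<lambda>t. \<integral>p. (\<nu> + \<nu>T t p) * (norm (G t p))\<^sup>2 \<partial>cubeM L)" (is ?c1)
    and "integrable (timeM T) (\<lambda>t. \<integral>p. (norm (G t p))\<^sup>2 \<partial>cubeM L)" (is ?c2)
    and "integrable (timeM T) (\<lambda>t. \<integral>p. (\<nu> + \<nu>T t p) * (G t p \<bullet> background_grad U L b p) \<partial>cubeM L)" (is ?c3)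
    and "integrable (timeM T) (\<lambda>t. \<integral>p. (G t p *v v t p) \<bullet> background U L b p \<partial>cubeM L)" (is ?c4)
    and "AE t in timeM T. integrable (cubeM L) (\<lambda>p. \<nu>T t p * (norm (G t p))\<^sup>2)" (is ?c5)
    and "(\<integral>t. (\<integral>p. (\<nu> + \<nu>T t p) * (norm (G t p))\<^sup>2 \<partial>cubeM L) \<partial>timeM T)
      \<le> 1/2 * (\<integral>p. (norm (background U L b p))\<^sup>2 \<partial>cubeM L) + 1/2 * (\<integral>p. (norm (v0 p))\<^sup>2 \<partial>cubeM L) - (\<integral>p. v0 p \<bullet> background U L b p \<partial>cubeM L)
        + (\<integral>t. (\<integral>p. (\<nu> + \<nu>T t p) * (G t p \<bullet> background_grad U L b p) \<partial>cubeM L) \<partial>timeM T)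
        + (\<integral>t. (\<integral>p. (G t p *v v t p) \<bullet> background U L b p \<partial>cubeM L) \<partial>timeM T)" (is ?c6)
proof -
  note rp = ramp_props[OF b U]
  let ?D = "background_grad U L b" and ?\<phi> = "background U L b"
  note sv = weak_solution_sq_int(1)[OF w T] and sG = weak_solution_sq_int(2)[OF w T]
  note [measurable] = sq_int_measurable[OF sv] sq_int_measurable[OF sG] borel_measurable_integrable[OF iN]
  have D\<phi>[measurable]: "(\<lambda>(t :: real, p). ?D p) \<in> borel_measurable (prodM T L)" "(\<lambda>(t :: real, p). ?\<phi> p) \<in> borel_measurable (prodM T L)"
    by (rule prodM_measurableI, simp add: borel_prod[symmetric])+
  have iNG: "integrable (prodM T L) (\<lambda>(t, p). \<nu>T t p * (norm (G t p))\<^sup>2)"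
    using w T unfolding weak_solution_def integrable_prodM by blast
  have iG: "integrable (prodM T L) (\<lambda>(t, p). (norm (G t p))\<^sup>2)"
    by (rule sq_int_prodM_norm_sq[OF sG])
  have iE: "integrable (prodM T L) (\<lambda>(t, p). (\<nu> + \<nu>T t p) * (norm (G t p))\<^sup>2)"
    using Bochner_Integration.integrable_add[OF integrable_mult_right[OF iG, of \<nu>] iNG]
    by (simp add: case_prod_beta' distrib_right)
  define K where "K = (2 * U / b)\<^sup>2"
  have DK: "(norm (?D p))\<^sup>2 \<le> K" if "p \<in> cube L" for p
    unfolding norm_background_grad K_def
    using rp(6)[of "p $ 3"] rp(8)[of "p $ 3"] that by (intro power_mono) (auto simp: cube_def less_imp_le)
  \<comment> \<open>Weighted Young dominates the mixed term by the dissipation and a multiple of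
    \<open>\<nu> + \<nu>T\<close>. The bounded slope of the background flow thus reduces the matter
    to integrability of the eddy viscosity.\<close>
  have iP: "integrable (prodM T L) (\<lambda>(t, p). (\<nu> + \<nu>T t p) * (G t p \<bullet> ?D p))"
  proof (rule integrable_prodM_bound)
    have c: "integrable (prodM T L) (\<lambda>_. \<nu>)"
      unfolding integrable_prodM
    proof (rule set_integrable_const[OF box_measurable])
      have "emeasure (lborel \<Otimes>\<^sub>M lborel) ({0..T} \<times> cube L) = emeasure lborel {0..T} * emeasure lborel (cube L)"
        by (rule lborel.emeasure_pair_measure_Times) auto
      then show "emeasure lborel ({0..T} \<times> cube L) < \<infinity>"
        using emeasure_cube_finite[of L] T by (simp add: lborel_prod ennreal_mult_less_top)
    qed
    show "integrable (prodM T L) (\<lambda>x. 1/2 * (case x of (t, p) \<Rightarrow> (\<nu> + \<nu>T t p) * (norm (G t p))\<^sup>2) + 1/2 * K * (\<nu> + (case x of (t, p) \<Rightarrow> \<nu>T t p)))"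
      using iE iN c by (intro Bochner_Integration.integrable_add integrable_mult_right)
    have "(\<lambda>x. (\<nu> + (case x of (t, p) \<Rightarrow> \<nu>T t p)) * ((case x of (t, p) \<Rightarrow> G t p) \<bullet> (case x of (t, p) \<Rightarrow> ?D p))) \<in> borel_measurable (prodM T L)"
      by measurable
    then show "(\<lambda>(t, p). (\<nu> + \<nu>T t p) * (G t p \<bullet> ?D p)) \<in> borel_measurable (prodM T L)"
      by (simp add: case_prod_beta')
    show "\<bar>case (t, p) of (t, p) \<Rightarrow> (\<nu> + \<nu>T t p) * (G t p \<bullet> ?D p)\<bar>
      \<le> 1/2 * (case (t, p) of (t, p) \<Rightarrow> (\<nu> + \<nu>T t p) * (norm (G t p))\<^sup>2) + 1/2 * K * (\<nu> + (case (t, p) of (t, p) \<Rightarrow> \<nu>T t p))"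
      if "p \<in> cube L" for t p
    proof -
      have "0 \<le> \<nu> + \<nu>T t p" using N0[of t p] \<nu> by simp
      then have "(\<nu> + \<nu>T t p) * (norm (?D p))\<^sup>2 \<le> (\<nu> + \<nu>T t p) * K" by (intro mult_left_mono DK that)
      moreover have "\<bar>(\<nu> + \<nu>T t p) * (G t p \<bullet> ?D p)\<bar> \<le> 1/2 * ((\<nu> + \<nu>T t p) * (norm (G t p))\<^sup>2) + 1/2 * ((\<nu> + \<nu>T t p) * (norm (?D p))\<^sup>2)"
        using \<open>0 \<le> \<nu> + \<nu>T t p\<close> by (rule weighted_inner_young)
      moreover have "1/2 * K * (\<nu> + \<nu>T t p) = 1/2 * ((\<nu> + \<nu>T t p) * K)" by simp
      ultimately show ?thesis by (simp only: prod.case)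
    qed
  qed
  have iC: "integrable (prodM T L) (\<lambda>(t, p). (G t p *v v t p) \<bullet> ?\<phi> p)"
  proof (rule integrable_prodM_bound)
    show "integrable (prodM T L) (\<lambda>x. U * (norm (case x of (t, p) \<Rightarrow> G t p) * norm (case x of (t, p) \<Rightarrow> v t p)))"
      by (intro integrable_mult_right sq_int_norm_mult sG sv)
    have "(\<lambda>x. (case x of (t, p) \<Rightarrow> G t p) $ 1) \<in> borel_measurable (prodM T L)"
      by (rule borel_measurable_continuous_on[OF _ sq_int_measurable[OF sG]]) (intro continuous_intros)
    moreover have "(\<lambda>x. (case x of (t :: real, p) \<Rightarrow> ?\<phi> p) $ 1) \<in> borel_measurable (prodM T L)"
      by (rule borel_measurable_continuous_on[OF _ D\<phi>(2)]) (intro continuous_intros)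
    ultimately have "(\<lambda>x. ((case x of (t, p) \<Rightarrow> G t p) $ 1 \<bullet> (case x of (t, p) \<Rightarrow> v t p)) * (case x of (t, p) \<Rightarrow> ?\<phi> p) $ 1) \<in> borel_measurable (prodM T L)"
      by measurable
    moreover have eq: "(G t p *v v t p) \<bullet> ?\<phi> p = (G t p $ 1 \<bullet> v t p) * ?\<phi> p $ 1" for t p
      unfolding background_def axis_inner by (simp add: matrix_vector_mult_def inner_vec_def axis_def)
    ultimately show "(\<lambda>(t, p). (G t p *v v t p) \<bullet> ?\<phi> p) \<in> borel_measurable (prodM T L)"
      by (simp add: case_prod_beta')
    show "\<bar>case (t, p) of (t, p) \<Rightarrow> (G t p *v v t p) \<bullet> ?\<phi> p\<bar>
       \<le> U * (norm (case (t, p) of (t, p) \<Rightarrow> G t p) * norm (case (t, p) of (t, p) \<Rightarrow> v t p))" if "p \<in> cube L" for t p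
    proof -
      have "\<bar>(G t p *v v t p) \<bullet> ?\<phi> p\<bar> = \<bar>(G t p *v v t p) $ 1\<bar> * \<bar>ramp U L b (p $ 3)\<bar>"
        unfolding background_def axis_inner by (rule abs_mult)
      also have "\<dots> \<le> (norm (G t p) * norm (v t p)) * U"
        using rp(1)[of "p $ 3"] rp(2)[of "p $ 3"] that
        by (intro mult_mono abs_matrix_vector_nth_le) (auto simp: cube_def less_imp_le)
      finally show ?thesis by (simp add: mult.commute)
    qed
  qed
  show ?c1 ?c2 ?c3 ?c4 ?c5
    by (fact integrable_prodM_section(1)[OF iE] integrable_prodM_section(1)[OF iG] integrable_prodM_section(1)[OF iP]
      integrable_prodM_section(1)[OF iC] integrable_prodM_section(2)[OF iNG])+
  have "1/2 * (LINT p:cube L|lborel. (norm (v T p))\<^sup>2)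
        - 1/2 * (LINT p:cube L|lborel. (norm (v0 p))\<^sup>2)
        + (LINT t:{0..T}|lborel. LINT p:cube L|lborel. (\<nu> + \<nu>T t p) * (norm (G t p))\<^sup>2)
        \<le> (LINT p:cube L|lborel. v T p \<bullet> ?\<phi> p) - (LINT p:cube L|lborel. v0 p \<bullet> ?\<phi> p)
          + (LINT t:{0..T}|lborel. LINT p:cube L|lborel. (\<nu> + \<nu>T t p) * (G t p \<bullet> ?D p))
          + (LINT t:{0..T}|lborel. LINT p:cube L|lborel. (G t p *v v t p) \<bullet> ?\<phi> p)"
    using en[unfolded energy_inequality_def, rule_format, of ?\<phi> ?D T] shear_class_background[OF b U] T iP iC
    unfolding integrable_prodM by blast
  \<comment> \<open>Young with weight 1 yields exactly the half of the final kinetic energy that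
    stands on the left, so it cancels.\<close>
  moreover have "(\<integral>p. v T p \<bullet> ?\<phi> p \<partial>cubeM L) \<le> 1/2 * (\<integral>p. (norm (v T p))\<^sup>2 \<partial>cubeM L) + 1/2 * (\<integral>p. (norm (?\<phi> p))\<^sup>2 \<partial>cubeM L)"
  proof -
    have s: "sq_int (cubeM L) (v T)" "sq_int (cubeM L) ?\<phi>"
    proof -
      have "L2_on_cube L (v T)" using w T unfolding weak_solution_def by simp
      then show "sq_int (cubeM L) (v T)" by (rule L2_on_cube_sq_int)
    qed (rule sq_int_continuous(1)[OF Ck_1_continuous[OF background_Ck]])
    have "(\<integral>p. v T p \<bullet> ?\<phi> p \<partial>cubeM L) \<le> (\<integral>p. norm (v T p) * norm (?\<phi> p) \<partial>cubeM L)"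
      by (rule integral_mono[OF sq_int_inner[OF s] sq_int_norm_mult[OF s] norm_cauchy_schwarz])
    also have "\<dots> \<le> 1/2 * (\<integral>p. (norm (v T p))\<^sup>2 \<partial>cubeM L) + 1/2 * (\<integral>p. (norm (?\<phi> p))\<^sup>2 \<partial>cubeM L)"
      using integral_norm_mult_young[OF s, of 1] by simp
    finally show ?thesis .
  qed
  ultimately show ?c6
    unfolding integral_timeM integral_cubeM by linarith
qed

section \<open>The near wall region\<close>

text \<open>The region includes its lateral faces while the cube is open; they differ only by pieces
  of coordinate planes, which are null. Since \<open>b \<le> L\<close>, the region does not reach
  below the cube.\<close>

lemma near_wall_AE_eq:
  assumes "0 < b" "b \<le> L" "(1 - \<beta>) * L = L - b"
  shows "AE p in lborel. p \<in> near_wall L \<beta> \<longleftrightarrow> p \<in> cube L \<and> L - b < p $ 3"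
proof -
  have ne: "AE p in lborel. p $ k \<noteq> c" for k :: 3 and c :: real
    using AE_lborel_inner_neq[of "axis k 1 :: real^3" c] by (auto simp: axis_inner Basis_vec_def)
  show ?thesis
    using ne[of 1 0] ne[of 1 L] ne[of 2 0] ne[of 2 L]
  proof eventually_elim
    case (elim p)
    have "p \<in> cube L \<longleftrightarrow> 0 < p $ 1 \<and> p $ 1 < L \<and> 0 < p $ 2 \<and> p $ 2 < L \<and> 0 < p $ 3 \<and> p $ 3 < L"
      by (auto simp: cube_def forall_3)
    then show ?case using elim assms by (auto simp: near_wall_def)
  qed
qed

lemma near_wall_integral:
  assumes b: "0 < b" "b \<le> L" and \<beta>: "(1 - \<beta>) * L = L - b" and f: "f \<in> borel_measurable borel"
  shows "(LINT p:near_wall L \<beta>|lborel. f p) = (\<integral>p. indicator {L - b<..} (p $ 3) * f p \<partial>cubeM L :: real)"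
proof -
  note [measurable] = f
  have [measurable]: "near_wall L \<beta> \<in> sets borel"
    unfolding near_wall_def by measurable
  show ?thesis
    unfolding integral_cubeM set_lebesgue_integral_def
    by (rule integral_cong_AE) (use near_wall_AE_eq[OF b \<beta>] in \<open>auto elim!: eventually_mono simp: indicator_def\<close>)
qed

lemma near_wall_measure:
  assumes b: "0 < b" "b \<le> L" and \<beta>: "(1 - \<beta>) * L = L - b"
  shows "measure lborel (near_wall L \<beta>) = b * L\<^sup>2"
proof -
  have L: "L > 0" using b by simp
  have [measurable]: "near_wall L \<beta> \<in> sets borel"
    unfolding near_wall_def by measurable
  have "measure lborel (near_wall L \<beta>) = (LINT p:near_wall L \<beta>|lborel. 1)"
    by (simp add: set_lebesgue_integral_def)
  also have "\<dots> = (LINT p:cube L|lborel. indicator {L - b<..} (p $ 3))"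
    using near_wall_integral[OF b \<beta>, of "\<lambda>_. 1"] by (simp add: integral_cubeM)
  finally have m: "measure lborel (near_wall L \<beta>) = (LINT p:cube L|lborel. indicator {L - b<..} (p $ 3))" .
  have "(LINT s:{0<..<L}|lborel. indicator {L - b<..} s) = (LINT s|lborel. indicator {L - b<..<L} s :: real)"
    unfolding set_lebesgue_integral_def by (rule Bochner_Integration.integral_cong) (use b in \<open>auto simp: indicator_def\<close>)
  then have i: "(LINT s:{0<..<L}|lborel. indicator {L - b<..} s) = b" using b by simp
  have "L * (LINT p:cube L|lborel. indicator {L - b<..} (p $ 3)) = (LINT p:cube L|lborel. LINT s:{0<..<L}|lborel. indicator {L - b<..} (slice 3 s p $ 3))"
    by (rule integral_slice[symmetric, where B=1]) (use L in \<open>auto simp: indicator_def\<close>)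
  also have "\<dots> = L ^ 3 * b"
    unfolding slice_nth by (simp only: if_True refl i) (simp only: integral_const_cubeM[OF L, of b, unfolded integral_cubeM])
  finally have "L * measure lborel (near_wall L \<beta>) = L * (b * L\<^sup>2)"
    unfolding m by (simp add: power2_eq_square power3_eq_cube ac_simps)
  then show ?thesis using L by (subst (asm) mult_left_cancel) auto
qed

text \<open>Nonnegative coefficients make upper bounds on the limits superior additive, and the
  remainder \<open>f\<close> disappears.\<close>

lemma Limsup_linear_bound:
  fixes A B R f :: "real \<Rightarrow> real"
  assumes ev: "\<forall>\<^sub>F T in at_top. A T \<le> f T + p * B T + k + q * R T" and f: "(f \<longlongrightarrow> 0) at_top"
    and p: "p \<ge> 0" and q: "q \<ge> 0"
    and B: "Limsup at_top (\<lambda>T. ereal (B T)) \<le> ereal b" and R: "Limsup at_top (\<lambda>T. ereal (R T)) \<le> ereal r"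
  shows "Limsup at_top (\<lambda>T. ereal (A T)) \<le> ereal (p * b + k + q * r)"
proof (rule ereal_le_epsilon2)
  fix e :: real assume "e > 0"
  \<comment> \<open>The errors of \<open>B\<close>, \<open>R\<close> and \<open>f\<close> enter with
    weights \<open>p\<close>, \<open>q\<close> and 1, so that together they amount to
    \<open>e\<close>; the 1 also keeps the denominator positive.\<close>
  define d where "d = e / (p + q + 1)"
  have d: "d > 0" and de: "d * (p + q + 1) = e" using \<open>e > 0\<close> p q by (auto simp: d_def)
  have "\<forall>\<^sub>F T in at_top. ereal (B T) < ereal (b + d)"
    using B[unfolded Limsup_le_iff, rule_format, of "ereal (b + d)"] d by simp
  moreover have "\<forall>\<^sub>F T in at_top. ereal (R T) < ereal (r + d)"
    using R[unfolded Limsup_le_iff, rule_format, of "ereal (r + d)"] d by simp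
  moreover have "\<forall>\<^sub>F T in at_top. f T < d"
    using f d by (auto dest: order_tendstoD)
  ultimately have "\<forall>\<^sub>F T in at_top. ereal (A T) \<le> ereal (p * b + k + q * r + e)"
    using ev
  proof eventually_elim
    case (elim T)
    have "p * B T \<le> p * (b + d)" "q * R T \<le> q * (r + d)"
      using elim p q by (auto intro: mult_left_mono)
    then have "A T \<le> d + p * (b + d) + k + q * (r + d)" using elim by simp
    also have "\<dots> = p * b + k + q * r + d * (p + q + 1)" by (simp add: algebra_simps)
    finally show ?case by (simp add: de)
  qed
  then show "Limsup at_top (\<lambda>T. ereal (A T)) \<le> ereal (p * b + k + q * r) + ereal e"
    by (auto intro: Limsup_bounded)
qed

lemma ens_mean_measurable:
  fixes f :: "nat \<Rightarrow> 'a \<Rightarrow> 'b::euclidean_space"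
  assumes "\<And>j. j \<in> {1..J} \<Longrightarrow> f j \<in> borel_measurable M"
  shows "(\<lambda>x. ens_mean J (\<lambda>j. f j x)) \<in> borel_measurable M"
  unfolding ens_mean_def by (intro borel_measurable_scaleR borel_measurable_sum assms) simp

section \<open>The dissipation bound\<close>

theorem theorem2:
  fixes L U \<nu> \<mu> \<tau> Tstar \<nu>eff Reeff \<beta> :: real
    and J :: nat
    and u :: "nat \<Rightarrow> real \<Rightarrow> real^3 \<Rightarrow> real^3"
    and Du :: "nat \<Rightarrow> real \<Rightarrow> real^3 \<Rightarrow> real^3^3"
    and u0 :: "nat \<Rightarrow> real^3 \<Rightarrow> real^3"
    and \<nu>turb :: "real \<Rightarrow> real^3 \<Rightarrow> real"
  assumes "L > 0" and "U > 0" and "\<nu> > 0" and "\<mu> > 0" and "\<tau> > 0" and "J \<ge> 1"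
    and "Tstar = L / U" and "\<tau> \<le> Tstar"
    and "\<nu>turb = eddy_viscosity \<mu> \<tau> J u"
    and "\<And>j. j \<in> {1..J} \<Longrightarrow> L2_on_cube L (u0 j) \<and> weakly_div_free L (u0 j)"
    and "\<And>j. j \<in> {1..J} \<Longrightarrow> weak_solution \<nu> \<nu>turb L U (u j) (Du j) (u0 j)"
    and "\<And>j. j \<in> {1..J} \<Longrightarrow> energy_inequality \<nu> \<nu>turb L U (u j) (Du j) (u0 j)"
    and "infinite_time_average (model_dissipation \<nu> \<nu>turb L J Du) < \<infinity>"
    and "infinite_time_average (mean_gradient_energy L J Du) < \<infinity>"
    and "\<nu>eff = effective_viscosity \<nu> \<nu>turb L J Du"
    and "Reeff = U * L / \<nu>eff"
    and "\<beta> = 1/8 * inverse Reeff"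
    and "\<beta> \<le> 1"
  shows "infinite_time_average (model_dissipation \<nu> \<nu>turb L J Du)
    \<le> ereal ((5/2 + 16 * (\<nu> / \<nu>eff)) * (U ^ 3 / L))
      + ereal (root 3 3 / 6 * C26\<^sup>2 * \<mu> * (\<tau> / Tstar))
        * infinite_time_average (\<lambda>t. 1 / measure lborel (near_wall L \<beta>) *
            (LINT p:near_wall L \<beta>|lborel.
               \<nu>eff * ens_mean J (\<lambda>j. (norm (column 3 (fluct J Du j t p)))\<^sup>2)))"
proof -
  note L = assms(1) and U = assms(2) and \<nu> = assms(3) and J = assms(6)
  note ws = assms(11) and en = assms(12)
  define \<kappa> where "\<kappa> = \<mu> * \<tau>"
  have \<kappa>: "\<kappa> > 0" using assms(4,5) by (simp add: \<kappa>_def)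
  have N: "\<nu>turb t p = \<kappa> * ens_mean J (\<lambda>j. (norm (u j t p - ens_mean J (\<lambda>i. u i t p)))\<^sup>2)" for t p
    by (simp add: assms(9) eddy_viscosity_def fluct_def \<kappa>_def)
  have N0: "0 \<le> \<nu>turb t p" for t p
    unfolding N using \<kappa> by (intro mult_nonneg_nonneg ens_mean_nonneg) auto
  have mDu: "(\<lambda>(t, p). Du j t p) \<in> borel_measurable borel" if "j \<in> {1..J}" for j
    using ws[OF that] unfolding weak_solution_def by blast
  have mDu_t: "(\<lambda>p. Du j t p) \<in> borel_measurable borel" if "j \<in> {1..J}" for j t
  proof -
    have "(\<lambda>(t, p). Du j t p) \<in> borel_measurable (borel \<Otimes>\<^sub>M borel)"
      using mDu[OF that] by (simp only: borel_prod)
    from measurable_Pair2[OF this, of t] show ?thesis by simp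
  qed
  \<comment> \<open>The uniform energy bound makes the velocities square integrable over space-time,
    and the eddy viscosity is a multiple of a mean of squared fluctuations.\<close>
  have iN: "integrable (prodM T L) (\<lambda>(t, p). \<nu>turb t p)" if T: "T > 0" for T
  proof -
    have "sq_int (prodM T L) (\<lambda>x. (case x of (t, p) \<Rightarrow> u j t p) - ens_mean J (\<lambda>i. case x of (t, p) \<Rightarrow> u i t p))" if "j \<in> {1..J}" for j
      by (intro sq_int_diff sq_int_ens_mean weak_solution_sq_int(1)[OF ws T] that)
    then have "integrable (prodM T L) (\<lambda>x. \<kappa> * ens_mean J (\<lambda>j. (norm ((case x of (t, p) \<Rightarrow> u j t p) - ens_mean J (\<lambda>i. case x of (t, p) \<Rightarrow> u i t p)))\<^sup>2))"
      by (intro integrable_mult_right ens_mean_integral sq_int_integrable)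
    then show ?thesis by (simp add: N case_prod_beta')
  qed
  have sc: "AE t in timeM T. \<forall>j\<in>{1..J}. shear_class L U (u j t) (Du j t)" for T
  proof (rule AE_timeM_pos)
    have "AE t in lborel. 0 < t \<longrightarrow> shear_class L U (u j t) (Du j t)" if "j \<in> {1..J}" for j
      using ws[OF that] unfolding weak_solution_def by blast
    then have "AE t in lborel. \<forall>j\<in>{1..J}. 0 < t \<longrightarrow> shear_class L U (u j t) (Du j t)"
      by (intro AE_finite_allI) auto
    then show "AE t in lborel. 0 < t \<longrightarrow> (\<forall>j\<in>{1..J}. shear_class L U (u j t) (Du j t))"
      by eventually_elim blast
  qed
  define E where "E j t = (\<integral>p. (\<nu> + \<nu>turb t p) * (norm (Du j t p))\<^sup>2 \<partial>cubeM L)" for j t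
  define Q where "Q j t = (\<integral>p. (norm (Du j t p))\<^sup>2 \<partial>cubeM L)" for j t
  define w where "w t p = ens_mean J (\<lambda>j. (norm (column 3 (fluct J Du j t p)))\<^sup>2)" for t p
  define S where "S b t = (\<integral>p. indicator {L - b<..} (p $ 3) * w t p \<partial>cubeM L)" for b t
  note eb = energy_background_bound[OF ws en _ iN N0 _ _ _ U \<nu>, folded E_def Q_def]
  have u0: "L2_on_cube L (u0 j)" if "j \<in> {1..J}" for j using assms(10)[OF that] by blast
  have iE: "integrable (timeM T) (E j)" and iQ: "integrable (timeM T) (Q j)"
    if "j \<in> {1..J}" "T > 0" for j T
    using eb(1,2)[OF that(1) that(1) u0[OF that(1)] that(2) that(2), of L] L by (simp_all add: E_def[abs_def] Q_def[abs_def])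
  have iNG: "AE t in timeM T. \<forall>j\<in>{1..J}. integrable (cubeM L) (\<lambda>p. \<nu>turb t p * (norm (Du j t p))\<^sup>2)" if "T > 0" for T
  proof -
    have "AE t in timeM T. integrable (cubeM L) (\<lambda>p. \<nu>turb t p * (norm (Du j t p))\<^sup>2)" if "j \<in> {1..J}" for j
      using eb(5)[OF that that u0[OF that] \<open>T > 0\<close> \<open>T > 0\<close>, of L] L by simp
    then show ?thesis by (intro AE_finite_allI) auto
  qed
  have md: "model_dissipation \<nu> \<nu>turb L J Du t = 1 / L ^ 3 * ens_mean J (\<lambda>j. E j t)" for t
    by (simp add: model_dissipation_def E_def measure_cube[OF L] integral_cubeM distrib_right ens_mean_cmult[symmetric])
  have mg: "mean_gradient_energy L J Du t = 1 / L ^ 3 * ens_mean J (\<lambda>j. Q j t)" for t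
    by (simp add: mean_gradient_energy_def Q_def measure_cube[OF L] integral_cubeM ens_mean_cmult[symmetric])
  define A where "A T = 1 / T * (\<integral>t. model_dissipation \<nu> \<nu>turb L J Du t \<partial>timeM T)" for T
  define B where "B T = 1 / T * (\<integral>t. mean_gradient_energy L J Du t \<partial>timeM T)" for T
  have A_avg: "infinite_time_average (model_dissipation \<nu> \<nu>turb L J Du) = Limsup at_top (\<lambda>T. ereal (A T))"
    and B_avg: "infinite_time_average (mean_gradient_energy L J Du) = Limsup at_top (\<lambda>T. ereal (B T))"
    by (simp_all add: infinite_time_average_def A_def B_def integral_timeM)
  have A_eq: "A T = 1 / (T * L ^ 3) * ens_mean J (\<lambda>j. \<integral>t. E j t \<partial>timeM T)" if "T > 0" for T
    unfolding A_def md using ens_mean_integral(2)[of J "timeM T" E, OF iE[OF _ that]] by simp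
  have B_eq: "B T = 1 / (T * L ^ 3) * ens_mean J (\<lambda>j. \<integral>t. Q j t \<partial>timeM T)" if "T > 0" for T
    unfolding B_def mg using ens_mean_integral(2)[of J "timeM T" Q, OF iQ[OF _ that]] by simp
  have B_lower: "U\<^sup>2 / L\<^sup>2 \<le> B T" if T: "T > 0" for T
  proof -
    have "T * (U\<^sup>2 * L) \<le> (\<integral>t. Q j t \<partial>timeM T)" if j: "j \<in> {1..J}" for j
    proof -
      have "(\<integral>t. U\<^sup>2 * L \<partial>timeM T) \<le> (\<integral>t. Q j t \<partial>timeM T)"
      proof (rule integral_mono_AE[OF integrable_timeM_const iQ[OF j T]])
        show "AE t in timeM T. U\<^sup>2 * L \<le> Q j t"
          using sc[of T] by eventually_elim (use j in \<open>auto simp: Q_def intro: shear_gradient_lower_bound[OF _ L U]\<close>)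
      qed
      then show ?thesis by (simp only: integral_timeM_const[OF T])
    qed
    then have "ens_mean J (\<lambda>_. T * (U\<^sup>2 * L)) \<le> ens_mean J (\<lambda>j. \<integral>t. Q j t \<partial>timeM T)"
      by (rule ens_mean_mono)
    then have "1 / (T * L ^ 3) * (T * (U\<^sup>2 * L)) \<le> B T"
      unfolding B_eq[OF T] using T L by (intro mult_left_mono) (auto simp: ens_mean_const[OF J])
    then show ?thesis using T L by (simp add: power2_eq_square power3_eq_cube)
  qed
  \<comment> \<open>The eddy viscosity is nonnegative, so the dissipation dominates its viscous
    part. With the lower bound for \<open>B\<close> this makes the numerator of the effective
    viscosity positive too.\<close>
  have A_lower: "\<nu> * B T \<le> A T" if T: "T > 0" for T
  proof -
    have "\<nu> * (\<integral>t. Q j t \<partial>timeM T) \<le> (\<integral>t. E j t \<partial>timeM T)" if j: "j \<in> {1..J}" for j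
    proof -
      have "(\<integral>t. \<nu> * Q j t \<partial>timeM T) \<le> (\<integral>t. E j t \<partial>timeM T)"
      proof (rule integral_mono_AE[OF integrable_mult_right[OF iQ[OF j T]] iE[OF j T]])
        show "AE t in timeM T. \<nu> * Q j t \<le> E j t"
          using sc[of T] iNG[OF T]
        proof eventually_elim
          case (elim t)
          then have i: "integrable (cubeM L) (\<lambda>p. (norm (Du j t p))\<^sup>2)" "integrable (cubeM L) (\<lambda>p. \<nu>turb t p * (norm (Du j t p))\<^sup>2)"
            using j by (auto intro!: sq_int_integrable shear_class_sq_int)
          have "0 \<le> (\<integral>p. \<nu>turb t p * (norm (Du j t p))\<^sup>2 \<partial>cubeM L)"
            using N0 by (intro Bochner_Integration.integral_nonneg) auto
          then show ?case using i by (simp add: E_def Q_def distrib_right)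
        qed
      qed
      then show ?thesis by simp
    qed
    then have "ens_mean J (\<lambda>j. \<nu> * (\<integral>t. Q j t \<partial>timeM T)) \<le> ens_mean J (\<lambda>j. \<integral>t. E j t \<partial>timeM T)"
      by (rule ens_mean_mono)
    then have "1 / (T * L ^ 3) * (\<nu> * ens_mean J (\<lambda>j. \<integral>t. Q j t \<partial>timeM T)) \<le> A T"
      unfolding A_eq[OF T] ens_mean_cmult using T L by (intro mult_left_mono) auto
    then show ?thesis unfolding B_eq[OF T] by (simp add: mult.left_commute)
  qed
  have pos: "\<forall>\<^sub>F T in at_top. T > (0::real)" by (rule eventually_gt_at_top)
  have B_pos: "ereal (U\<^sup>2 / L\<^sup>2) \<le> Limsup at_top (\<lambda>T. ereal (B T))"
  proof (rule le_Limsup)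
    show "\<forall>\<^sub>F T in at_top. ereal (U\<^sup>2 / L\<^sup>2) \<le> ereal (B T)"
      using pos by eventually_elim (simp only: ereal_less_eq(3) B_lower)
  qed simp
  have A_pos: "ereal (\<nu> * (U\<^sup>2 / L\<^sup>2)) \<le> Limsup at_top (\<lambda>T. ereal (A T))"
  proof (rule le_Limsup)
    show "\<forall>\<^sub>F T in at_top. ereal (\<nu> * (U\<^sup>2 / L\<^sup>2)) \<le> ereal (A T)"
      using pos
    proof eventually_elim
      case (elim T)
      show ?case using order_trans[OF mult_left_mono[OF B_lower[OF elim]] A_lower[OF elim]] \<nu> by simp
    qed
  qed simp
  \<comment> \<open>The lower bounds exclude minus infinity and the finiteness assumptions exclude
    infinity. From here on the conversion to reals in the effective viscosity is faithful.\<close>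
  obtain a where a: "Limsup at_top (\<lambda>T. ereal (A T)) = ereal a"
    using A_pos assms(13) unfolding A_avg by (cases "Limsup at_top (\<lambda>T. ereal (A T))") auto
  obtain g where g: "Limsup at_top (\<lambda>T. ereal (B T)) = ereal g"
    using B_pos assms(14) unfolding B_avg by (cases "Limsup at_top (\<lambda>T. ereal (B T))") auto
  have a0: "a > 0"
  proof -
    have "0 < \<nu> * (U\<^sup>2 / L\<^sup>2)" using \<nu> U L by simp
    also have "\<dots> \<le> a" using A_pos by (simp add: a)
    finally show ?thesis .
  qed
  have g0: "g > 0"
  proof -
    have "0 < U\<^sup>2 / L\<^sup>2" using U L by simp
    also have "\<dots> \<le> g" using B_pos by (simp add: g)
    finally show ?thesis .
  qed
  have eff: "\<nu>eff = a / g" by (simp add: assms(15) effective_viscosity_def A_avg B_avg a g)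
  then have eff0: "\<nu>eff > 0" and effg: "\<nu>eff * g = a" using a0 g0 by auto
  define b where "b = \<beta> * L"
  have b_eq: "b = \<nu>eff / (8 * U)" using L U by (simp add: b_def assms(16,17))
  have b: "0 < b" "b \<le> L" using eff0 U L assms(18) by (simp add: b_eq, simp add: b_def)
  have \<beta>: "(1 - \<beta>) * L = L - b" by (simp add: b_def algebra_simps)
  define R where "R T = 1 / T * (\<integral>t. \<nu>eff / (b * L\<^sup>2) * S b t \<partial>timeM T)" for T
  have w_meas: "(\<lambda>p. w t p) \<in> borel_measurable borel" for t
  proof -
    have "(\<lambda>p. (norm (column 3 (fluct J Du j t p)))\<^sup>2) \<in> borel_measurable borel" if "j \<in> {1..J}" for j
    proof -
      have "(\<lambda>p. fluct J Du j t p) \<in> borel_measurable borel"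
        unfolding fluct_def by (intro borel_measurable_diff ens_mean_measurable mDu_t that)
      then have "(\<lambda>p. column 3 (fluct J Du j t p)) \<in> borel_measurable borel" by (rule column_measurable)
      then show ?thesis by measurable
    qed
    then show ?thesis unfolding w_def by (rule ens_mean_measurable)
  qed
  have R_avg: "infinite_time_average (\<lambda>t. 1 / measure lborel (near_wall L \<beta>) *
            (LINT p:near_wall L \<beta>|lborel. \<nu>eff * ens_mean J (\<lambda>j. (norm (column 3 (fluct J Du j t p)))\<^sup>2)))
      = Limsup at_top (\<lambda>T. ereal (R T))"
  proof -
    have "1 / measure lborel (near_wall L \<beta>) * (LINT p:near_wall L \<beta>|lborel. \<nu>eff * w t p) = \<nu>eff / (b * L\<^sup>2) * S b t" for t
      unfolding near_wall_measure[OF b \<beta>] using near_wall_integral[OF b \<beta> w_meas]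
      by (simp add: S_def)
    then show ?thesis
      by (simp add: infinite_time_average_def R_def integral_timeM w_def)
  qed
  have w0: "0 \<le> w t p" for t p unfolding w_def by (rule ens_mean_nonneg) simp
  have S0: "0 \<le> S b t" for t unfolding S_def using w0 by (intro Bochner_Integration.integral_nonneg) auto
  have iS: "integrable (timeM T) (S b)" if T: "T > 0" for T
  proof -
    have sf: "sq_int (prodM T L) (\<lambda>x. column 3 ((case x of (t, p) \<Rightarrow> Du j t p) - ens_mean J (\<lambda>i. case x of (t, p) \<Rightarrow> Du i t p)))"
      if "j \<in> {1..J}" for j
    proof -
      have h: "sq_int (prodM T L) (\<lambda>x. (case x of (t, p) \<Rightarrow> Du j t p) - ens_mean J (\<lambda>i. case x of (t, p) \<Rightarrow> Du i t p))"
        by (intro sq_int_diff sq_int_ens_mean weak_solution_sq_int(2)[OF ws T] that)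
      show ?thesis
        by (rule sq_int_bound[OF h column_measurable[OF sq_int_measurable[OF h]], where K=1]) (simp add: norm_column_le)
    qed
    have iw: "integrable (prodM T L) (\<lambda>(t, p). w t p)"
      using ens_mean_integral(1)[OF sq_int_integrable[OF sf]] by (simp add: w_def fluct_def case_prod_beta')
    have "(\<lambda>x :: real \<times> (real^3). indicator {L - b<..} (snd x $ 3) :: real) \<in> borel_measurable (prodM T L)"
    proof (rule prodM_measurableI)
      have "(\<lambda>x :: real \<times> (real^3). snd x $ 3) \<in> borel_measurable borel"
        by (intro borel_measurable_continuous_onI continuous_intros)
      then show "(\<lambda>x :: real \<times> (real^3). indicator {L - b<..} (snd x $ 3) :: real) \<in> borel_measurable borel" by measurable
    qed
    then have "(\<lambda>x. indicator {L - b<..} (snd x $ 3) * (case x of (t, p) \<Rightarrow> w t p)) \<in> borel_measurable (prodM T L)"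
      using borel_measurable_integrable[OF iw] by measurable
    then have "integrable (prodM T L) (\<lambda>x. indicator {L - b<..} (snd x $ 3) * (case x of (t, p) \<Rightarrow> w t p))"
      by (rule integrable_prodM_bound[OF iw]) (simp add: indicator_def w0)
    then have "integrable (prodM T L) (\<lambda>(t, p). indicator {L - b<..} (p $ 3) * w t p)"
      by (simp add: case_prod_beta')
    from integrable_prodM_section(1)[OF this] show ?thesis by (simp add: S_def[abs_def])
  qed
  \<comment> \<open>Collects the contributions of the initial datum and of the background energy,
    constant in \<open>T\<close>.\<close>
  define c0 where "c0 j = 1/2 * (\<integral>p. (norm (background U L b p))\<^sup>2 \<partial>cubeM L)
    + 1/2 * (\<integral>p. (norm (u0 j p))\<^sup>2 \<partial>cubeM L) - (\<integral>p. u0 j p \<bullet> background U L b p \<partial>cubeM L)" for j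
  define c where "c = ens_mean J c0"
  define K where "K = 2/3 * \<nu> * U\<^sup>2 * L\<^sup>2 / b"
  have energy: "ens_mean J (\<lambda>j. \<integral>t. E j t \<partial>timeM T)
      \<le> c + 1/2 * ens_mean J (\<lambda>j. \<integral>t. E j t \<partial>timeM T) + U * b * ens_mean J (\<lambda>j. \<integral>t. Q j t \<partial>timeM T)
        + T * K + 1/2 * \<kappa> * U\<^sup>2 * (\<integral>t. S b t \<partial>timeM T)" if T: "T > 0" for T
  proof -
    define P where "P j t = (\<integral>p. (\<nu> + \<nu>turb t p) * (Du j t p \<bullet> background_grad U L b p) \<partial>cubeM L)" for j t
    define C where "C j t = (\<integral>p. (Du j t p *v u j t p) \<bullet> background U L b p \<partial>cubeM L)" for j t
    note ebj = eb[OF _ _ u0 T T b, folded P_def C_def]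
    have iP: "integrable (timeM T) (P j)" and iC: "integrable (timeM T) (C j)" if "j \<in> {1..J}" for j
      using ebj(3,4)[OF that that that] by (auto simp: P_def[abs_def] C_def[abs_def])
    have iPC: "integrable (timeM T) (\<lambda>t. P j t + C j t)" if "j \<in> {1..J}" for j
      using iP[OF that] iC[OF that] by simp
    have iEQ: "integrable (timeM T) (\<lambda>t. 1/2 * E j t + U * b * Q j t)" if "j \<in> {1..J}" for j
      using iE[OF that T] iQ[OF that T] by simp
    have "ens_mean J (\<lambda>j. \<integral>t. E j t \<partial>timeM T) \<le> ens_mean J (\<lambda>j. c0 j + (\<integral>t. P j t + C j t \<partial>timeM T))"
    proof (rule ens_mean_mono)
      fix j assume j: "j \<in> {1..J}"
      show "(\<integral>t. E j t \<partial>timeM T) \<le> c0 j + (\<integral>t. P j t + C j t \<partial>timeM T)"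
        using ebj(6)[OF j j j] iP[OF j] iC[OF j] by (simp add: c0_def)
    qed
    also have "\<dots> = c + (\<integral>t. ens_mean J (\<lambda>j. P j t + C j t) \<partial>timeM T)"
      unfolding ens_mean_add[of J _ "\<lambda>j. \<integral>t. P j t + C j t \<partial>timeM T"] c_def
      by (simp only: ens_mean_integral(2)[OF iPC])
    \<comment> \<open>The instantaneous estimate holds at almost every time only, since the shear
      class and the integrability of the eddy dissipation are known only there.\<close>
    also have "(\<integral>t. ens_mean J (\<lambda>j. P j t + C j t) \<partial>timeM T)
      \<le> (\<integral>t. ens_mean J (\<lambda>j. 1/2 * E j t + U * b * Q j t) + K + 1/2 * \<kappa> * U\<^sup>2 * S b t \<partial>timeM T)"
    proof (rule integral_mono_AE)
      show "integrable (timeM T) (\<lambda>t. ens_mean J (\<lambda>j. P j t + C j t))"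
        by (rule ens_mean_integral(1)[OF iPC])
      show "integrable (timeM T) (\<lambda>t. ens_mean J (\<lambda>j. 1/2 * E j t + U * b * Q j t) + K + 1/2 * \<kappa> * U\<^sup>2 * S b t)"
        by (intro Bochner_Integration.integrable_add integrable_mult_right ens_mean_integral(1)[OF iEQ] integrable_timeM_const iS T)
      show "AE t in timeM T. ens_mean J (\<lambda>j. P j t + C j t) \<le> ens_mean J (\<lambda>j. 1/2 * E j t + U * b * Q j t) + K + 1/2 * \<kappa> * U\<^sup>2 * S b t"
        using sc[of T] iNG[OF T]
      proof eventually_elim
        case (elim t)
        show ?case
          unfolding P_def C_def E_def Q_def S_def K_def w_def fluct_def
          by (rule ensemble_instant_bound[OF J b U \<nu> less_imp_le[OF \<kappa>]]) (use elim N in auto)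
      qed
    qed
    also have "\<dots> = ens_mean J (\<lambda>j. \<integral>t. 1/2 * E j t + U * b * Q j t \<partial>timeM T) + T * K + 1/2 * \<kappa> * U\<^sup>2 * (\<integral>t. S b t \<partial>timeM T)"
      using ens_mean_integral[OF iEQ] iS[OF T] integrable_timeM_const[of T K] integral_timeM_const[OF T, of K] by simp
    also have "ens_mean J (\<lambda>j. \<integral>t. 1/2 * E j t + U * b * Q j t \<partial>timeM T)
      = ens_mean J (\<lambda>j. 1/2 * (\<integral>t. E j t \<partial>timeM T) + U * b * (\<integral>t. Q j t \<partial>timeM T))"
      by (rule ens_mean_cong) (simp add: iE[OF _ T] iQ[OF _ T])
    also have "\<dots> = 1/2 * ens_mean J (\<lambda>j. \<integral>t. E j t \<partial>timeM T) + U * b * ens_mean J (\<lambda>j. \<integral>t. Q j t \<partial>timeM T)"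
      unfolding ens_mean_add ens_mean_cmult ..
    finally show ?thesis by linarith
  qed
  \<comment> \<open>The doubled eddy term carries \<open>\<kappa> * U\<^sup>2 / L ^ 3\<close>;
    dividing it by the prefactor \<open>\<nu>eff / (b * L\<^sup>2)\<close> of \<open>R\<close>
    leaves \<open>\<kappa> * U / (8 * L)\<close>.\<close>
  define q where "q = \<kappa> * U / (8 * L)"
  have q0: "q > 0" using \<kappa> U L by (simp add: q_def)
  have A_le: "A T \<le> 2 * c / L ^ 3 / T + \<nu>eff / 4 * B T + 32 / 3 * (\<nu> / \<nu>eff) * (U ^ 3 / L) + q * R T" if T: "T > 0" for T
  proof -
    define e y s where "e = ens_mean J (\<lambda>j. \<integral>t. E j t \<partial>timeM T)" and "y = ens_mean J (\<lambda>j. \<integral>t. Q j t \<partial>timeM T)"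
      and "s = (\<integral>t. S b t \<partial>timeM T)"
    \<comment> \<open>The half of the dissipation on the right is absorbed, which doubles all other
      terms.\<close>
    have "e \<le> 2 * c + 2 * (U * b) * y + 2 * (T * K) + \<kappa> * U\<^sup>2 * s"
      using energy[OF T] unfolding e_def y_def s_def by linarith
    then have "1 / (T * L ^ 3) * e \<le> 1 / (T * L ^ 3) * (2 * c + 2 * (U * b) * y + 2 * (T * K) + \<kappa> * U\<^sup>2 * s)"
      using T L by (intro mult_left_mono) auto
    also have "\<dots> = 2 * c / L ^ 3 / T + 2 * (U * b) * (1 / (T * L ^ 3) * y) + 2 * K / L ^ 3 + \<kappa> * U\<^sup>2 * s / (T * L ^ 3)"
      using T L by (simp add: field_simps)
    \<comment> \<open>This is where the 1/8 in \<open>\<beta>\<close> acts: the convection term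
      costs one quarter of the averaged dissipation, so three quarters remain.\<close>
    also have "2 * (U * b) = \<nu>eff / 4" using U by (simp add: b_eq)
    also have "2 * K / L ^ 3 = 32 / 3 * (\<nu> / \<nu>eff) * (U ^ 3 / L)"
      using U L eff0 by (simp add: K_def b_eq power2_eq_square power3_eq_cube)
    also have "\<kappa> * U\<^sup>2 * s / (T * L ^ 3) = q * R T"
      using U L T eff0 by (simp add: R_def s_def q_def b_eq power2_eq_square power3_eq_cube ac_simps)
    finally show ?thesis unfolding A_eq[OF T] B_eq[OF T] e_def y_def .
  qed
  have Tstar: "\<tau> / Tstar = \<tau> * U / L" using L U by (simp add: assms(7))
  define z where "z = root 3 3 / 6 * C26\<^sup>2 * \<mu> * (\<tau> / Tstar)"
  \<comment> \<open>Dividing by the remaining 3/4 turns the 1/8 in \<open>q\<close> into 1/6 of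
    \<open>\<mu> * (\<tau> / Tstar)\<close>; the bound on the Hardy constant then gives the stated
    coefficient.\<close>
  have zq: "4 / 3 * q \<le> z"
  proof -
    have "1 / 6 * (\<mu> * (\<tau> / Tstar)) \<le> (root 3 3 * C26\<^sup>2) / 6 * (\<mu> * (\<tau> / Tstar))"
      using C26_bound assms(4,5) L U by (intro mult_right_mono) (auto simp: Tstar)
    then show ?thesis by (simp add: z_def q_def \<kappa>_def Tstar ac_simps)
  qed
  \<comment> \<open>Strict positivity matters in the extended reals: if the near wall average is
    infinite, its product with \<open>z\<close> is infinite as well.\<close>
  have z0: "z > 0" using zq q0 by linarith
  have R0: "0 \<le> R T" if "T > 0" for T
    unfolding R_def using that S0 eff0 b L by (intro mult_nonneg_nonneg Bochner_Integration.integral_nonneg) auto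
  have R_lim0: "0 \<le> Limsup at_top (\<lambda>T. ereal (R T))"
  proof (rule le_Limsup)
    show "\<forall>\<^sub>F T in at_top. 0 \<le> ereal (R T)"
      using pos by eventually_elim (simp add: R0)
  qed simp
  have "Limsup at_top (\<lambda>T. ereal (A T)) \<le> ereal ((5/2 + 16 * (\<nu> / \<nu>eff)) * (U ^ 3 / L)) + ereal z * Limsup at_top (\<lambda>T. ereal (R T))" (is ?goal)
  proof (cases "Limsup at_top (\<lambda>T. ereal (R T))")
    case (real r)
    then have r0: "0 \<le> r" using R_lim0 by simp
    have "Limsup at_top (\<lambda>T. ereal (A T)) \<le> ereal (\<nu>eff / 4 * g + 32 / 3 * (\<nu> / \<nu>eff) * (U ^ 3 / L) + q * r)"
    proof (rule Limsup_linear_bound)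
      show "\<forall>\<^sub>F T in at_top. A T \<le> 2 * c / L ^ 3 / T + \<nu>eff / 4 * B T + 32 / 3 * (\<nu> / \<nu>eff) * (U ^ 3 / L) + q * R T"
        using pos by eventually_elim (rule A_le)
      show "((\<lambda>T. 2 * c / L ^ 3 / T) \<longlongrightarrow> 0) at_top"
        by (rule tendsto_divide_0[OF tendsto_const]) (rule filterlim_at_top_imp_at_infinity[OF filterlim_ident])
    qed (use eff0 q0 g real in auto)
    \<comment> \<open>By \<open>\<nu>eff * g = a\<close> the averaged gradient energy is expressed
      through the averaged dissipation, so it can be absorbed.\<close>
    then have "a \<le> a / 4 + 32 / 3 * (\<nu> / \<nu>eff) * (U ^ 3 / L) + q * r"
      using effg by (simp add: a)
    then have "a \<le> 128 / 9 * ((\<nu> / \<nu>eff) * (U ^ 3 / L)) + 4 / 3 * q * r" by simp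
    also have "\<dots> \<le> (5/2 + 16 * (\<nu> / \<nu>eff)) * (U ^ 3 / L) + z * r"
    proof (rule add_mono)
      \<comment> \<open>The coefficient 128/9 is 32/3 divided by the remaining 3/4, and it lies
        below 16.\<close>
      have "128 / 9 * x \<le> 5/2 * y + 16 * x" if "0 \<le> x" "0 \<le> y" for x y :: real
        using that by linarith
      from this[of "\<nu> / \<nu>eff * (U ^ 3 / L)" "U ^ 3 / L"]
      show "128 / 9 * ((\<nu> / \<nu>eff) * (U ^ 3 / L)) \<le> (5/2 + 16 * (\<nu> / \<nu>eff)) * (U ^ 3 / L)"
        unfolding distrib_right mult.assoc using \<nu> eff0 U L by simp
      show "4 / 3 * q * r \<le> z * r" by (rule mult_right_mono[OF zq r0])
    qed
    finally show ?goal
      by (simp add: a real)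
  next
    case PInf
    then show ?goal
      using z0 by simp
  next
    case MInf
    then show ?goal
      using R_lim0 by simp
  qed
  then show ?thesis unfolding A_avg R_avg z_def[symmetric] .
qed

end
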